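(* Let $u:\mathbb R^n\times[0,\infty)\to[-1,1]$ be the viscosity solution of $u_t=|Du|\operatorname{div}\left(\frac{Du}{|Du|}\right)$ with obstacles $u^-\equiv-1$ and $u^+$ and initial condition $u_0$, where every sublevel set $\{u_0\le s\}$, $s\in[-1,1]$, is a minimizing hull. Then $u$ is nondecreasing in time, and as $t\to+\infty$ the functions $u(\cdot,t)$ converge locally uniformly to a limit $u_\infty$ which is a viscosity solution of $$|Du|\operatorname{div}\left(\frac{Du}{|Du|}\right)=0$$ with obstacles $u^+,u^-$.
   Context: A set $E\subset\mathbb R^n$ is a minimizing hull if $|\partial E|=0$ and $\operatorname{Per}(E)\le\operatorname{Per}(F)$ for all $F\supset E$ with $F\setminus E$ compact, where $\operatorname{Per}$ is the perimeter of a set of finite perimeter. Standing assumptions: $u_0:\mathbb R^n\to[-1,1]$ is uniformly continuous; $u^+:\mathbb R^n\to[-1,1]$ is uniformly continuous, independent of time, with $u^+\ge u_0$; $u^-\equiv-1$. Let $F(p,X)=-\operatorname{Tr}\left(\left(I-\frac{p\otimes p}{|p|^2}\right)X\right)$ for $p\ne0$, with upper and lower semicontinuous envelopes $F^\ast$, $F_\ast$ on $\mathbb R^n\times\mathcal S_n$ ($\mathcal S_n$ the symmetric $n\times n$ matrices). A subsolution of the evolution problem is an upper semicontinuous $u$ with $u^-\le u\le u^+$, $u(\cdot,0)\le u_0$, and such that whenever $\varphi$ is a $C^2$ function of $(x,t)$, $(\hat x,\hat t)$ with $\hat t>0$ is a maximizer of $u-\varphi$ and $u(\hat x,\hat t)>u^-(\hat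 x)$, one has $\varphi_t+F_\ast(D\varphi,D^2\varphi)\le0$ at $(\hat x,\hat t)$. A supersolution is a lower semicontinuous $u$ with $u^-\le u\le u^+$, $u(\cdot,0)\ge u_0$, and such that whenever $\varphi$ is $C^2$, $(\hat x,\hat t)$ with $\hat t>0$ is a minimizer of $u-\varphi$ and $u(\hat x,\hat t)<u^+(\hat x)$, one has $\varphi_t+F^\ast(D\varphi,D^2\varphi)\ge0$ at $(\hat x,\hat t)$. A solution is both. Viscosity solutions of the stationary equation with obstacles $u^-\le u^+$ are defined in the same way, for functions of $x$ only, with test functions of $x$ only, without the term $\varphi_t$ and without initial condition.
   Formalization: In the definition of minimizing hull, E itself has finite perimeter and "F\E compact" is read as "F\E relatively compact"; literally, every closed set of finite perimeter with null boundary would be a hull and the claim fails, e.g. for n≥2, u^+=1, u_0=max(-1,1-|x|). *)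

theory Defs
  imports "HOL-Analysis.Analysis"
begin

section \<open>Perimeter and minimizing hulls\<close>

definition C1c_field ::
  "('a::euclidean_space \<Rightarrow> 'a) \<Rightarrow> ('a \<Rightarrow> 'a \<Rightarrow>\<^sub>L 'a) \<Rightarrow> bool" where
  "C1c_field X X' \<longleftrightarrow>
     (\<forall>x. (X has_derivative blinfun_apply (X' x)) (at x)) \<and>
     continuous_on UNIV X' \<and>
     compact (closure {x. X x \<noteq> 0})"

definition divergence :: "('a::euclidean_space \<Rightarrow> 'a \<Rightarrow>\<^sub>L 'a) \<Rightarrow> 'a \<Rightarrow> real" where
  "divergence X' x = (\<Sum>b\<in>Basis. blinfun_apply (X' x) b \<bullet> b)"

text \<open>De Giorgi's perimeter; it is meaningful for Lebesgue measurable sets only.\<close>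

definition Per :: "'a::euclidean_space set \<Rightarrow> ereal" where
  "Per E = (SUP (X, X') \<in> {(X, X'). C1c_field X X' \<and> (\<forall>x. norm (X x) \<le> 1)}.
              ereal (LINT x:E|lebesgue. divergence X' x))"

definition finite_perimeter :: "'a::euclidean_space set \<Rightarrow> bool" where
  "finite_perimeter E \<longleftrightarrow> E \<in> sets lebesgue \<and> Per E < \<infinity>"

text \<open>
  The competitors are the sets that agree with \<open>E\<close> outside a compact set: \<open>F - E\<close> is required
  to be relatively compact. If \<open>F - E\<close> itself had to be compact, then for closed \<open>E\<close> it would
  have positive distance to \<open>E\<close>, so that \<open>Per F = Per E + Per (F - E)\<close>, and every closed set
  with negligible frontier would be a minimizing hull.
  Finiteness of \<open>Per E\<close> rules out sets for which the comparison is vacuous because all competitors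
  have infinite perimeter; competitors of infinite perimeter satisfy the inequality trivially.
\<close>

definition minimizing_hull :: "'a::euclidean_space set \<Rightarrow> bool" where
  "minimizing_hull E \<longleftrightarrow>
     finite_perimeter E \<and> negligible (frontier E) \<and>
     (\<forall>F. F \<in> sets lebesgue \<and> E \<subseteq> F \<and> compact (closure (F - E)) \<longrightarrow> Per E \<le> Per F)"


section \<open>The mean curvature operator and its semicontinuous envelopes\<close>

definition tensor :: "real^'n \<Rightarrow> real^'n \<Rightarrow> real^'n^'n" where
  "tensor p q = (\<chi> i j. p $ i * q $ j)"

definition F_mc :: "real^'n \<Rightarrow> real^'n^'n \<Rightarrow> real" where
  "F_mc p X = - trace ((mat 1 - (1 / (norm p)\<^sup>2) *\<^sub>R tensor p p) ** X)"

definition F_mc_dom :: "((real^'n) \<times> (real^'n^'n)) set" where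
  "F_mc_dom = {(p, X). p \<noteq> 0 \<and> transpose X = X}"

text \<open>
  The filter includes the point itself whenever it belongs to the domain, as is usual for envelopes.
\<close>

definition F_upper :: "real^'n \<Rightarrow> real^'n^'n \<Rightarrow> ereal" where
  "F_upper p X = Limsup (inf (nhds (p, X)) (principal F_mc_dom)) (\<lambda>(q, Y). ereal (F_mc q Y))"

definition F_lower :: "real^'n \<Rightarrow> real^'n^'n \<Rightarrow> ereal" where
  "F_lower p X = Liminf (inf (nhds (p, X)) (principal F_mc_dom)) (\<lambda>(q, Y). ereal (F_mc q Y))"


section \<open>Viscosity solutions with obstacles\<close>

definition usc_on :: "'a::topological_space set \<Rightarrow> ('a \<Rightarrow> real) \<Rightarrow> bool" where
  "usc_on S f \<longleftrightarrow> (\<forall>x\<in>S. \<forall>a. f x < a \<longrightarrow> (\<forall>\<^sub>F y in at x within S. f y < a))"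

definition lsc_on :: "'a::topological_space set \<Rightarrow> ('a \<Rightarrow> real) \<Rightarrow> bool" where
  "lsc_on S f \<longleftrightarrow> (\<forall>x\<in>S. \<forall>a. a < f x \<longrightarrow> (\<forall>\<^sub>F y in at x within S. a < f y))"

text \<open>\<open>C2_fun \<phi> G H\<close>: the function \<open>\<phi>\<close> is of class \<open>C\<^sup>2\<close> with gradient \<open>G\<close> and Hessian \<open>H\<close>.\<close>

definition C2_fun ::
  "('a::euclidean_space \<Rightarrow> real) \<Rightarrow> ('a \<Rightarrow> 'a) \<Rightarrow> ('a \<Rightarrow> 'a \<Rightarrow>\<^sub>L 'a) \<Rightarrow> bool" where
  "C2_fun \<phi> G H \<longleftrightarrow>
     (\<forall>x. (\<phi> has_derivative (\<lambda>h. G x \<bullet> h)) (at x)) \<and>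
     (\<forall>x. (G has_derivative blinfun_apply (H x)) (at x)) \<and>
     continuous_on UNIV H"

text \<open>
  For the evolution problem the gradient of \<open>\<phi>\<close> on \<open>(real^'n) \<times> real\<close> is the pair of the spatial
  gradient and the time derivative; the spatial Hessian is the corresponding block of the full one.
\<close>

definition space_hessian ::
  "((real^'n) \<times> real) \<Rightarrow>\<^sub>L ((real^'n) \<times> real) \<Rightarrow> real^'n^'n" where
  "space_hessian A = matrix (\<lambda>h. fst (blinfun_apply A (h, 0)))"

definition spacetime :: "((real^'n) \<times> real) set" where
  "spacetime = UNIV \<times> {0..}"

definition evol_subsolution ::
  "(real^'n \<Rightarrow> real) \<Rightarrow> (real^'n \<Rightarrow> real) \<Rightarrow> (real^'n \<Rightarrow> real) \<Rightarrow> ((real^'n) \<times> real \<Rightarrow> real) \<Rightarrow> bool" where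
  "evol_subsolution um up u0 u \<longleftrightarrow>
     usc_on spacetime u \<and>
     (\<forall>x. \<forall>t\<ge>0. um x \<le> u (x, t) \<and> u (x, t) \<le> up x) \<and>
     (\<forall>x. u (x, 0) \<le> u0 x) \<and>
     (\<forall>\<phi> G H x t. C2_fun \<phi> G H \<and> t > 0 \<and>
        (\<forall>z\<in>spacetime. u z - \<phi> z \<le> u (x, t) - \<phi> (x, t)) \<and> u (x, t) > um x \<longrightarrow>
        ereal (snd (G (x, t))) + F_lower (fst (G (x, t))) (space_hessian (H (x, t))) \<le> 0)"

definition evol_supersolution ::
  "(real^'n \<Rightarrow> real) \<Rightarrow> (real^'n \<Rightarrow> real) \<Rightarrow> (real^'n \<Rightarrow> real) \<Rightarrow> ((real^'n) \<times> real \<Rightarrow> real) \<Rightarrow> bool" where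
  "evol_supersolution um up u0 u \<longleftrightarrow>
     lsc_on spacetime u \<and>
     (\<forall>x. \<forall>t\<ge>0. um x \<le> u (x, t) \<and> u (x, t) \<le> up x) \<and>
     (\<forall>x. u (x, 0) \<ge> u0 x) \<and>
     (\<forall>\<phi> G H x t. C2_fun \<phi> G H \<and> t > 0 \<and>
        (\<forall>z\<in>spacetime. u z - \<phi> z \<ge> u (x, t) - \<phi> (x, t)) \<and> u (x, t) < up x \<longrightarrow>
        ereal (snd (G (x, t))) + F_upper (fst (G (x, t))) (space_hessian (H (x, t))) \<ge> 0)"

definition evol_solution ::
  "(real^'n \<Rightarrow> real) \<Rightarrow> (real^'n \<Rightarrow> real) \<Rightarrow> (real^'n \<Rightarrow> real) \<Rightarrow> ((real^'n) \<times> real \<Rightarrow> real) \<Rightarrow> bool" where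
  "evol_solution um up u0 u \<longleftrightarrow> evol_subsolution um up u0 u \<and> evol_supersolution um up u0 u"

definition stat_subsolution ::
  "(real^'n \<Rightarrow> real) \<Rightarrow> (real^'n \<Rightarrow> real) \<Rightarrow> (real^'n \<Rightarrow> real) \<Rightarrow> bool" where
  "stat_subsolution um up w \<longleftrightarrow>
     usc_on UNIV w \<and>
     (\<forall>x. um x \<le> w x \<and> w x \<le> up x) \<and>
     (\<forall>\<phi> G H x. C2_fun \<phi> G H \<and> (\<forall>y. w y - \<phi> y \<le> w x - \<phi> x) \<and> w x > um x \<longrightarrow>
        F_lower (G x) (matrix (blinfun_apply (H x))) \<le> 0)"

definition stat_supersolution ::
  "(real^'n \<Rightarrow> real) \<Rightarrow> (real^'n \<Rightarrow> real) \<Rightarrow> (real^'n \<Rightarrow> real) \<Rightarrow> bool" where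
  "stat_supersolution um up w \<longleftrightarrow>
     lsc_on UNIV w \<and>
     (\<forall>x. um x \<le> w x \<and> w x \<le> up x) \<and>
     (\<forall>\<phi> G H x. C2_fun \<phi> G H \<and> (\<forall>y. w y - \<phi> y \<ge> w x - \<phi> x) \<and> w x < up x \<longrightarrow>
        F_upper (G x) (matrix (blinfun_apply (H x))) \<ge> 0)"

definition stat_solution ::
  "(real^'n \<Rightarrow> real) \<Rightarrow> (real^'n \<Rightarrow> real) \<Rightarrow> (real^'n \<Rightarrow> real) \<Rightarrow> bool" where
  "stat_solution um up w \<longleftrightarrow> stat_subsolution um up w \<and> stat_supersolution um up w"

end

theory Submission
  imports Defs
begin

text \<open>
  A calibration of the region between a sublevel set of \<open>u0\<close> and a sublevel set of a smooth test
  function shows that a minimizing hull cannot be touched from outside by a strictly mean convex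
  surface; hence \<open>u0\<close>, seen as a function independent of time, is a subsolution wherever
  \<open>u0 > -1\<close>. Comparison with \<open>u\<close> gives \<open>u0 \<le> u\<close>, comparison of \<open>u\<close> with its own time shifts then
  gives monotonicity in time, and comparison with its spatial shifts gives equicontinuity in space,
  uniformly in time. So the limit exists locally uniformly, and the stationary equation
  follows by adding a penalty \<open>(t - T)\<^sup>2\<close>, with \<open>T\<close> large, to a stationary test function.

  In the comparison principle the variables are doubled with the quartic kernel
  \<open>\<alpha> |x - y|\<^sup>4\<close>: where its gradient vanishes, so does its Hessian, which disposes of the singularity
  of the operator. Jensen's lemma is obtained without Alexandrov's theorem: at a maximum of the sum
  of two semiconvex functions both are \<open>C\<^sup>1\<^sup>,\<^sup>1\<close>, so Rademacher's theorem applies to the gradient of the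
  upper \<open>C\<^sup>1\<^sup>,\<^sup>1\<close> hull of one of them.
\<close>

section \<open>Rademacher's theorem\<close>

text \<open>The sublevel sets of \<open>u0\<close> have finite perimeter but no regular boundary, so
  no first variation is computed on them: the calibration only needs the normal field of the
  touching quadratic and Gauss' theorem for compactly supported C1 fields on the whole space. Two
  features shape the comparison principle. The obstacles switch the equation off; but the doubled
  points are close and the gap exceeds the claimed bound by a fixed margin, so uniform continuity of
  \<open>up\<close> puts the subsolution above -1 and the supersolution below \<open>up\<close> at
  the contact points. And F is discontinuous at gradient zero: contact points far apart have a
  gradient bounded away from zero, where F is continuous, while contact points close together have
  Hessians so small that the crude bound (n + 1) K suffices. The identity F(-p, -X) = -F(p, X) lets
  u and -u share one theory. All functions are bounded by 1, hence oscillate by at most 2; the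
  localisation constants come from this.\<close>

text \<open>
  \<open>\<phi> t + (L + 1) * t\<close> is increasing with slope at least 1, so its Stieltjes measure is absolutely
  continuous and the Radon-Nikodym theorem applies.
\<close>

lemma lipschitz_imp_has_density:
  fixes \<phi> :: "real \<Rightarrow> real"
  assumes lip: "\<And>s t. \<bar>\<phi> s - \<phi> t\<bar> \<le> L * \<bar>s - t\<bar>" and "0 \<le> L"
  shows "\<exists>d. \<forall>a b. a \<le> b \<longrightarrow> (d has_integral \<phi> b - \<phi> a) {a..b}"
proof -
  define F where "F t = \<phi> t + (L + 1) * t" for t
  have F_inc: "t - s \<le> F t - F s" if "s \<le> t" for s t
    using lip[of t s] that by (auto simp: F_def algebra_simps abs_le_iff)
  have F_lip: "\<bar>F t - F s\<bar> \<le> (2 * L + 1) * \<bar>t - s\<bar>" for s t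
  proof -
    have "\<bar>F t - F s\<bar> \<le> \<bar>\<phi> t - \<phi> s\<bar> + \<bar>(L + 1) * (t - s)\<bar>"
      by (simp add: F_def algebra_simps)
    also have "\<dots> \<le> L * \<bar>t - s\<bar> + (L + 1) * \<bar>t - s\<bar>"
      using lip[of t s] \<open>0 \<le> L\<close> by (simp add: abs_mult)
    finally show ?thesis
      by (simp add: algebra_simps)
  qed
  have F_mono: "F s \<le> F t \<longleftrightarrow> s \<le> t" for s t
    using F_inc[of s t] F_inc[of t s] by linarith
  have contF: "continuous_on UNIV F"
  proof (rule lipschitz_on_continuous_on[of "2 * L + 1"])
    show "(2 * L + 1)-lipschitz_on UNIV F"
      using F_lip \<open>0 \<le> L\<close> by (auto intro!: lipschitz_onI simp: dist_real_def)
  qed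
  have "surj F"
  proof -
    have "\<exists>x. F x = y" for y
    proof -
      define r where "r = \<bar>y - F 0\<bar>"
      have "F (- r) \<le> y" "y \<le> F r" "- r \<le> r"
        using F_inc[of "-r" 0] F_inc[of 0 r] by (auto simp: r_def)
      then show ?thesis
        using IVT'[of F "-r" y r] contF continuous_on_subset by blast
    qed
    then show ?thesis by (metis surjI)
  qed
  moreover have "inj F"
    by (rule injI, metis F_mono antisym order_refl)
  ultimately have bijF: "bij F" by (simp add: bij_def)
  \<comment> \<open>The image of Lebesgue measure under the inverse \<open>G\<close> gives a set the
    measure of its image under \<open>F\<close>; this is the Stieltjes measure of
    \<open>F\<close>.\<close>
  define G where "G = inv F"
  have FG: "F (G y) = y" and GF: "G (F x) = x" for x y
    using bijF by (simp_all add: G_def bij_inv_eq_iff bij_is_inj bij_is_surj surj_f_inv_f)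
  have G_mono: "G x \<le> G y" if "x \<le> y" for x y
    using F_mono FG that by metis
  have measG: "G \<in> borel_measurable borel"
    using G_mono by (intro borel_measurable_mono monoI)
  define \<mu> where "\<mu> = distr lborel borel G"
  have vimG: "G -` A = F ` A" for A
    using FG GF by (auto simp: image_iff) metis
  \<comment> \<open>Lipschitz maps send null sets to null sets, and the preimage of \<open>N\<close>
    under \<open>G\<close> is the image of \<open>N\<close> under \<open>F\<close>.\<close>
  have \<mu>_null: "absolutely_continuous lborel \<mu>"
    unfolding absolutely_continuous_def
  proof
    fix N :: "real set" assume N: "N \<in> null_sets lborel"
    then have Nb: "N \<in> sets borel" by auto
    have "negligible N"
      using N negligible_iff_null_sets null_sets_completionI by blast
    then have "negligible (F ` N)"
      using F_lip by (intro negligible_locally_Lipschitz_image) (auto intro!: exI[of _ UNIV] exI[of _ "2 * L + 1"])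
    moreover have "G -` N \<in> sets borel"
      using measurable_sets[OF measG Nb] by simp
    ultimately have "emeasure lborel (G -` N) = 0"
      unfolding vimG[symmetric] negligible_iff_emeasure0[OF sets_completionI_sets[OF \<open>G -` N \<in> sets borel\<close>[folded sets_lborel]]]
      by (simp add: \<open>G -` N \<in> sets borel\<close>)
    then show "N \<in> null_sets \<mu>"
      using Nb measG by (auto simp: null_sets_def \<mu>_def emeasure_distr)
  qed
  have \<mu>_int: "emeasure \<mu> {a..b} = ennreal (F b - F a)" if "a \<le> b" for a b
  proof -
    have "G -` {a..b} = {F a..F b}"
      by (auto simp: F_mono FG) (metis F_mono FG)+
    then show ?thesis
      using that measG by (simp add: \<mu>_def emeasure_distr F_mono)
  qed
  obtain f where f: "f \<in> borel_measurable lborel" "density lborel f = \<mu>"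
    using sigma_finite_measure.Radon_Nikodym[OF sigma_finite_lborel \<mu>_null] by (auto simp: \<mu>_def)
  have fb[measurable]: "f \<in> borel_measurable borel" using f by simp
  have fint: "(\<integral>\<^sup>+t. f t * indicator {a..b} t \<partial>lborel) = ennreal (F b - F a)" if "a \<le> b" for a b
    using \<mu>_int[OF that] emeasure_density[OF f(1), of "{a..b}"] f(2) by simp
  show ?thesis
  proof (intro exI allI impI)
    fix a b :: real assume ab: "a \<le> b"
    \<comment> \<open>The Radon-Nikodym density is extended-valued; its integral over an interval is
      finite, so \<open>enn2real\<close> changes it only on a null set.\<close>
    have "AE t in lborel. f t * indicator {a..b} t \<noteq> \<infinity>"
      by (rule nn_integral_PInf_AE) (auto simp: fint[OF ab])
    then have "(\<integral>\<^sup>+t. ennreal (enn2real (f t) * indicator {a..b} t) \<partial>lborel) = (\<integral>\<^sup>+t. f t * indicator {a..b} t \<partial>lborel)"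
      by (intro nn_integral_cong_AE) (auto simp: indicator_def less_top ennreal_enn2real_if split: if_splits)
    then have "((\<lambda>t. enn2real (f t) * indicator {a..b} t) has_integral F b - F a) UNIV"
      using fint[OF ab] F_mono ab by (subst (asm) fint[OF ab], intro nn_integral_has_integral) auto
    moreover have "(\<lambda>t. enn2real (f t) * indicator {a..b} t) = (\<lambda>t. if t \<in> {a..b} then enn2real (f t) else 0)"
      by (auto simp: indicator_def)
    ultimately have "((\<lambda>t. enn2real (f t)) has_integral F b - F a) {a..b}"
      using has_integral_restrict_UNIV[of "{a..b}" "\<lambda>t. enn2real (f t)"] by simp
    from has_integral_diff[OF this has_integral_const_real[of "L + 1" a b]]
    show "((\<lambda>t. enn2real (f t) - (L + 1)) has_integral \<phi> b - \<phi> a) {a..b}"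
      using ab by (simp add: F_def algebra_simps)
  qed
qed

text \<open>A directional derivative that is defined everywhere and Borel measurable.\<close>

definition upper_dd :: "('a::real_normed_vector \<Rightarrow> real) \<Rightarrow> 'a \<Rightarrow> 'a \<Rightarrow> real" where
  "upper_dd g b z = real_of_ereal (limsup (\<lambda>k. ereal (real (Suc k) * (g (z + b /\<^sub>R real (Suc k)) - g z))))"

lemma upper_dd_measurable:
  fixes g :: "'a::euclidean_space \<Rightarrow> real"
  assumes "continuous_on UNIV g"
  shows "upper_dd g b \<in> borel_measurable borel"
proof -
  have [measurable]: "g \<in> borel_measurable borel"
    using assms by (rule borel_measurable_continuous_onI)
  show ?thesis
    unfolding upper_dd_def[abs_def] by measurable
qed

text \<open>All difference quotients lie in one bounded interval, so the limsup is finite and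
  \<open>real_of_ereal\<close> never takes its default value.\<close>

lemma upper_dd_bound:
  fixes g :: "'a::real_normed_vector \<Rightarrow> real"
  assumes lip: "\<And>x y. \<bar>g x - g y\<bar> \<le> L * norm (x - y)"
  shows "\<bar>upper_dd g b z\<bar> \<le> L * norm b"
proof -
  let ?q = "\<lambda>k. real (Suc k) * (g (z + b /\<^sub>R real (Suc k)) - g z)"
  have q: "\<bar>?q k\<bar> \<le> L * norm b" for k
  proof -
    have "\<bar>?q k\<bar> = real (Suc k) * \<bar>g (z + b /\<^sub>R real (Suc k)) - g z\<bar>"
      by (simp add: abs_mult)
    also have "\<dots> \<le> real (Suc k) * (L * norm (b /\<^sub>R real (Suc k)))"
      using lip[of "z + b /\<^sub>R real (Suc k)" z] by (intro mult_left_mono) auto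
    also have "\<dots> = L * norm b"
      by simp
    finally show ?thesis .
  qed
  have "limsup (\<lambda>k. ereal (?q k)) \<le> ereal (L * norm b)"
    using q by (intro Limsup_bounded always_eventually allI) (simp add: abs_le_iff)
  moreover have "ereal (- (L * norm b)) \<le> limsup (\<lambda>k. ereal (?q k))"
  proof -
    have "ereal (- (L * norm b)) \<le> liminf (\<lambda>k. ereal (?q k))"
      using q by (intro Liminf_bounded always_eventually allI) (simp add: abs_le_iff, metis neg_le_iff_le minus_minus)
    also have "\<dots> \<le> limsup (\<lambda>k. ereal (?q k))"
      by (intro Liminf_le_Limsup) simp
    finally show ?thesis .
  qed
  ultimately show ?thesis
    unfolding upper_dd_def by (cases "limsup (\<lambda>k. ereal (?q k))") (auto simp: abs_le_iff)
qed

text \<open>At almost every point the density is the derivative of its indefinite integral over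
  intervals starting there, and these are exactly the forward difference quotients in
  \<open>upper_dd\<close>. So the two functions differ only on a null set.\<close>

lemma upper_dd_has_integral_real:
  fixes \<phi> :: "real \<Rightarrow> real"
  assumes lip: "\<And>s t. \<bar>\<phi> s - \<phi> t\<bar> \<le> L * \<bar>s - t\<bar>" and "0 \<le> L" and "a \<le> b"
  shows "(upper_dd \<phi> 1 has_integral \<phi> b - \<phi> a) {a..b}"
proof -
  obtain d where d: "\<And>a b. a \<le> b \<Longrightarrow> (d has_integral \<phi> b - \<phi> a) {a..b}"
    using lipschitz_imp_has_density[OF lip \<open>0 \<le> L\<close>] by metis
  then have "d integrable_on cbox a b" for a b
    by (cases "a \<le> b") (auto intro: has_integral_integrable)
  then obtain N where N: "negligible N"
    "\<And>x e. \<lbrakk>x \<notin> N; 0 < e\<rbrakk> \<Longrightarrow> \<exists>\<delta>>0. \<forall>h. 0 < h \<and> h < \<delta> \<longrightarrow>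
        norm (integral (cbox x (x + h *\<^sub>R One)) d /\<^sub>R h ^ DIM(real) - d x) < e"
    using integrable_ccontinuous_explicit[of d] by metis
  have "upper_dd \<phi> 1 x = d x" if xN: "x \<notin> N" for x
  proof -
    have "(\<lambda>k. real (Suc k) * (\<phi> (x + 1 /\<^sub>R real (Suc k)) - \<phi> x)) \<longlonglongrightarrow> d x"
    proof (rule LIMSEQ_I)
      fix e :: real assume "e > 0"
      then obtain \<delta> where "\<delta> > 0" and \<delta>: "\<And>h. 0 < h \<Longrightarrow> h < \<delta> \<Longrightarrow>
        norm (integral (cbox x (x + h *\<^sub>R One)) d /\<^sub>R h ^ DIM(real) - d x) < e"
        using N(2)[OF xN, of e] by metis
      obtain m where m: "inverse (real (Suc m)) < \<delta>"
        using reals_Archimedean[OF \<open>\<delta> > 0\<close>] by blast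
      show "\<exists>no. \<forall>n\<ge>no. norm (real (Suc n) * (\<phi> (x + 1 /\<^sub>R real (Suc n)) - \<phi> x) - d x) < e"
      proof (intro exI allI impI)
        fix n assume "m \<le> n"
        then have "inverse (real (Suc n)) \<le> inverse (real (Suc m))"
          by (intro le_imp_inverse_le) auto
        with m have "inverse (real (Suc n)) < \<delta>" by linarith
        then have "norm (integral (cbox x (x + inverse (real (Suc n)) *\<^sub>R One)) d /\<^sub>R inverse (real (Suc n)) ^ DIM(real) - d x) < e"
          by (intro \<delta>) auto
        moreover have "integral {x..x + inverse (real (Suc n))} d = \<phi> (x + inverse (real (Suc n))) - \<phi> x"
          using d[of x "x + inverse (real (Suc n))"] by (intro integral_unique) auto
        ultimately show "norm (real (Suc n) * (\<phi> (x + 1 /\<^sub>R real (Suc n)) - \<phi> x) - d x) < e"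
          by simp
      qed
    qed
    then have "limsup (\<lambda>k. ereal (real (Suc k) * (\<phi> (x + 1 /\<^sub>R real (Suc k)) - \<phi> x))) = ereal (d x)"
      by (intro lim_imp_Limsup) auto
    then show ?thesis by (simp add: upper_dd_def)
  qed
  then show ?thesis
    using has_integral_spike[OF N(1) _ d[OF \<open>a \<le> b\<close>]] by blast
qed

text \<open>Since \<open>upper_dd\<close> is defined everywhere, the fundamental theorem holds on
  every line; no exceptional lines have to be removed before Fubini is used.\<close>

lemma upper_dd_has_integral_line:
  fixes g :: "'a::euclidean_space \<Rightarrow> real"
  assumes lip: "\<And>x y. \<bar>g x - g y\<bar> \<le> L * norm (x - y)" and "0 \<le> L" "0 \<le> s"
  shows "((\<lambda>t. upper_dd g b (z + t *\<^sub>R b)) has_integral g (z + s *\<^sub>R b) - g z) {0..s}"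
proof -
  define \<phi> where "\<phi> t = g (z + t *\<^sub>R b)" for t
  have "\<bar>\<phi> s - \<phi> t\<bar> \<le> L * norm b * \<bar>s - t\<bar>" for s t
    using lip[of "z + s *\<^sub>R b" "z + t *\<^sub>R b"] by (simp add: \<phi>_def mult_ac flip: scaleR_diff_left)
  from upper_dd_has_integral_real[OF this _ \<open>0 \<le> s\<close>] \<open>0 \<le> L\<close>
  have "(upper_dd \<phi> 1 has_integral \<phi> s - \<phi> 0) {0..s}" by simp
  moreover have "upper_dd \<phi> 1 = (\<lambda>t. upper_dd g b (z + t *\<^sub>R b))"
    by (auto simp: upper_dd_def \<phi>_def algebra_simps)
  ultimately show ?thesis by (simp add: \<phi>_def)
qed

section \<open>Lebesgue points with respect to centred cubes\<close>

lemma nn_integral_translate: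
  fixes f :: "'a::euclidean_space \<Rightarrow> ennreal"
  assumes [measurable]: "f \<in> borel_measurable borel"
  shows "(\<integral>\<^sup>+w. f (c + w) \<partial>lborel) = (\<integral>\<^sup>+w. f w \<partial>lborel)"
  by (subst (2) lborel_distr_plus[of c, symmetric]) (simp add: nn_integral_distr)

text \<open>
  The differentiation theorem for indefinite integrals uses cubes with \<open>z\<close> as a corner;
  reflections turn it into a statement about cubes centred at \<open>z\<close>.
\<close>

definition reflect :: "'a::euclidean_space set \<Rightarrow> 'a \<Rightarrow> 'a" where
  "reflect T y = (\<Sum>b\<in>Basis. ((if b \<in> T then - 1 else 1) * (y \<bullet> b)) *\<^sub>R b)"

lemma inner_reflect: "b \<in> Basis \<Longrightarrow> reflect T y \<bullet> b = (if b \<in> T then - (y \<bullet> b) else y \<bullet> b)"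
  by (simp add: reflect_def)

lemma reflect_reflect [simp]: "reflect T (reflect T y) = y"
  by (rule euclidean_eqI) (simp add: inner_reflect)

lemma linear_reflect: "linear (reflect T)"
  by (rule linearI; rule euclidean_eqI) (simp_all add: inner_reflect inner_add_left)

lemma negligible_reflect:
  assumes "negligible N"
  shows "negligible (reflect T ` N)"
proof -
  obtain K where "\<And>x. norm (reflect T x) \<le> K * norm x"
    using linear_bounded[OF linear_reflect] by blast
  then have "norm (reflect T y - reflect T x) \<le> K * norm (y - x)" for x y
    using linear_diff[OF linear_reflect] by metis
  with assms show ?thesis
    by (intro negligible_locally_Lipschitz_image) (auto intro!: exI[of _ UNIV])
qed

lemma reflect_measurable [measurable]: "reflect T \<in> borel_measurable borel"
  by (intro borel_measurable_continuous_onI linear_continuous_on linear_conv_bounded_linear[THEN iffD1] linear_reflect)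

lemma nn_integral_reflect:
  fixes f :: "'a::euclidean_space \<Rightarrow> ennreal"
  assumes [measurable]: "f \<in> borel_measurable borel"
  shows "(\<integral>\<^sup>+w. f (reflect T w) \<partial>lborel) = (\<integral>\<^sup>+w. f w \<partial>lborel)"
proof -
  have "(lborel :: 'a measure) = density (distr lborel borel (\<lambda>x. 0 + (\<Sum>j\<in>Basis. ((if j \<in> T then - 1 else 1) * (x \<bullet> j)) *\<^sub>R j)))
      (\<lambda>_. \<Prod>j\<in>Basis. \<bar>if j \<in> T then - 1 else 1::real\<bar>)"
    by (rule lborel_affine_euclidean) auto
  also have "(\<lambda>x. 0 + (\<Sum>j\<in>Basis. ((if j \<in> T then - 1 else 1) * (x \<bullet> j)) *\<^sub>R j)) = reflect T"
    by (auto simp: reflect_def)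
  also have "(\<Prod>j\<in>Basis. \<bar>if j \<in> T then - 1 else 1::real\<bar>) = 1"
    by (rule prod.neutral) auto
  finally have "(lborel :: 'a measure) = distr lborel borel (reflect T)"
    by (simp add: density_1)
  then have "(\<integral>\<^sup>+w. f w \<partial>lborel) = (\<integral>\<^sup>+w. f w \<partial>distr lborel borel (reflect T))" by simp
  then show ?thesis by (simp add: nn_integral_distr)
qed

lemma bounded_borel_set_integrable:
  fixes f :: "'a::euclidean_space \<Rightarrow> real"
  assumes [measurable]: "f \<in> borel_measurable borel" and bound: "\<And>y. \<bar>f y\<bar> \<le> B"
  shows "set_integrable lborel (cbox a b) f"
  unfolding set_integrable_def
proof (rule Bochner_Integration.integrable_bound)
  show "integrable lborel (\<lambda>y. B * indicator (cbox a b) y)"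
    by (auto intro!: integrable_mult_right integrable_real_indicator emeasure_lborel_cbox_finite)
  show "AE y in lborel. norm (indicat_real (cbox a b) y *\<^sub>R f y) \<le> norm (B * indicator (cbox a b) y)"
    using order_trans[OF bound abs_ge_self] by (intro AE_I2) (auto simp: indicator_def)
qed auto

text \<open>The differentiation theorem is applied to the functions |f - q| composed with a
  reflection, for rational \<open>q\<close> and the finitely many reflections. This leaves one null
  set, outside of which the value \<open>f z\<close> may be replaced by a nearby rational.\<close>

lemma lebesgue_points:
  fixes f :: "'a::euclidean_space \<Rightarrow> real"
  assumes [measurable]: "f \<in> borel_measurable borel" and bound: "\<And>y. \<bar>f y\<bar> \<le> B"
  obtains N where "negligible N"
    "\<And>z e. z \<notin> N \<Longrightarrow> 0 < e \<Longrightarrow> \<exists>d>0. \<forall>r. 0 < r \<and> r < d \<longrightarrow>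
       (\<integral>\<^sup>+y. ennreal \<bar>f y - f z\<bar> * indicator (cbox (z - r *\<^sub>R One) (z + r *\<^sub>R One)) y \<partial>lborel) \<le> ennreal (e * r ^ DIM('a))"
proof -
  define F where "F q T y = \<bar>f (reflect T y) - q\<bar>" for q T y
  have [measurable]: "F q T \<in> borel_measurable borel" for q T
    unfolding F_def by measurable
  have Fb: "\<bar>F q T y\<bar> \<le> B + \<bar>q\<bar>" for q T y
    using bound[of "reflect T y"] by (auto simp: F_def)
  have Fint: "set_integrable lborel (cbox a b) (F q T)" for q T a b
    by (rule bounded_borel_set_integrable[OF _ Fb]) simp
  have "\<exists>N. negligible N \<and> (\<forall>x e. x \<notin> N \<longrightarrow> 0 < e \<longrightarrow> (\<exists>d>0. \<forall>h. 0 < h \<and> h < d \<longrightarrow>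
           norm (integral (cbox x (x + h *\<^sub>R One)) (F q T) /\<^sub>R h ^ DIM('a) - F q T x) < e))" for q T
    by (rule integrable_ccontinuous_explicit[of "F q T"])
       (use Fint[THEN set_borel_integral_eq_integral(1)] in auto)
  then obtain N where N: "\<And>q T. negligible (N q T)"
    "\<And>q T x e. x \<notin> N q T \<Longrightarrow> 0 < e \<Longrightarrow> (\<exists>d>0. \<forall>h. 0 < h \<and> h < d \<longrightarrow>
           norm (integral (cbox x (x + h *\<^sub>R One)) (F q T) /\<^sub>R h ^ DIM('a) - F q T x) < e)"
    by metis
  define M where "M = (\<Union>q\<in>\<rat>. \<Union>T\<in>Pow Basis. reflect T ` N q T)"
  have negM: "negligible M"
  proof -
    have "negligible (\<Union>T\<in>Pow Basis. reflect T ` N q T)" for q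
      by (rule negligible_Union) (auto intro: negligible_reflect N)
    then show ?thesis
      unfolding M_def by (intro negligible_countable_Union[OF countable_image]) (auto simp: countable_rat)
  qed
  show thesis
  proof (rule that[OF negM])
    fix z :: 'a and e :: real assume z: "z \<notin> M" and "0 < e"
    \<comment> \<open>The centred cube splits into 2^n corner cubes, each costing at most
      \<open>3 * c\<close> times r^n: one \<open>c\<close> for |f z - q|, one for the error of the
      average, one for replacing \<open>q\<close> by \<open>f z\<close>.\<close>
    define c where "c = e / (3 * 2 ^ DIM('a))"
    have "c > 0" using \<open>0 < e\<close> by (simp add: c_def)
    obtain q where q: "q \<in> \<rat>" "\<bar>f z - q\<bar> < c"
      using Rats_dense_in_real[of "f z - c" "f z"] \<open>c > 0\<close> by (auto simp: abs_if)
    have "\<exists>d>0. \<forall>h. 0 < h \<and> h < d \<longrightarrow>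
        norm (integral (cbox (reflect T z) (reflect T z + h *\<^sub>R One)) (F q T) /\<^sub>R h ^ DIM('a) - F q T (reflect T z)) < c"
      if "T \<in> Pow Basis" for T
    proof -
      have "reflect T z \<notin> N q T"
      proof
        assume "reflect T z \<in> N q T"
        then have "reflect T (reflect T z) \<in> M" using that q(1) unfolding M_def by blast
        then show False using z by simp
      qed
      then show ?thesis using N(2) \<open>c > 0\<close> by blast
    qed
    then obtain d where d: "\<And>T. T \<in> Pow Basis \<Longrightarrow> 0 < d T"
      "\<And>T h. T \<in> Pow Basis \<Longrightarrow> 0 < h \<Longrightarrow> h < d T \<Longrightarrow>
        norm (integral (cbox (reflect T z) (reflect T z + h *\<^sub>R One)) (F q T) /\<^sub>R h ^ DIM('a) - F q T (reflect T z)) < c"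
      by metis
    define d0 where "d0 = Min (d ` Pow Basis)"
    have finP: "finite (Pow (Basis :: 'a set))" by simp
    have "d0 > 0"
      unfolding d0_def by (subst Min_gr_iff) (use d(1) in auto)
    have d0: "d0 \<le> d T" if "T \<in> Pow Basis" for T
      unfolding d0_def using that by (intro Min_le) auto
    have main: "(\<integral>\<^sup>+y. ennreal \<bar>f y - f z\<bar> * indicator (cbox (z - r *\<^sub>R One) (z + r *\<^sub>R One)) y \<partial>lborel) \<le> ennreal (e * r ^ DIM('a))"
      if r: "0 < r" "r < d0" for r
    proof -
      define C where "C T = cbox (reflect T z) (reflect T z + r *\<^sub>R One)" for T
      have one: "(\<integral>\<^sup>+y. ennreal \<bar>f (reflect T y) - f z\<bar> * indicator (C T) y \<partial>lborel) \<le> ennreal (3 * c * r ^ DIM('a))"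
        if T: "T \<in> Pow Basis" for T
      proof -
        have contC: "measure lborel (C T) = r ^ DIM('a)"
          using r unfolding C_def by (simp add: content_cbox_if box_eq_empty inner_add_left inner_diff_left prod_constant)
        have "norm (integral (C T) (F q T) /\<^sub>R r ^ DIM('a) - F q T (reflect T z)) < c"
          unfolding C_def using d(2)[OF T] d0[OF T] r by simp
        moreover have "F q T (reflect T z) < c" using q by (simp add: F_def)
        ultimately have "integral (C T) (F q T) /\<^sub>R r ^ DIM('a) \<le> 2 * c"
          by (simp add: abs_less_iff)
        then have "integral (C T) (F q T) \<le> 2 * c * r ^ DIM('a)"
          using r by (simp add: field_simps)
        moreover have "integral (C T) (F q T) = (LINT y:C T|lborel. F q T y)"
          unfolding C_def using set_borel_integral_eq_integral(2)[OF Fint] by simp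
        ultimately have I2: "(LINT y:C T|lborel. F q T y) \<le> 2 * c * r ^ DIM('a)" by simp
        have i1: "integrable lborel (\<lambda>y. indicator (C T) y *\<^sub>R F q T y)"
          using Fint unfolding C_def set_integrable_def .
        have i2: "integrable lborel (\<lambda>y. c * indicator (C T) y)"
          unfolding C_def by (auto intro!: integrable_mult_right integrable_real_indicator emeasure_lborel_cbox_finite)
        have "(\<integral>\<^sup>+y. ennreal \<bar>f (reflect T y) - f z\<bar> * indicator (C T) y \<partial>lborel)
            \<le> (\<integral>\<^sup>+y. ennreal (indicator (C T) y *\<^sub>R F q T y + c * indicator (C T) y) \<partial>lborel)"
        proof (intro nn_integral_mono)
          fix y show "ennreal \<bar>f (reflect T y) - f z\<bar> * indicator (C T) y \<le> ennreal (indicator (C T) y *\<^sub>R F q T y + c * indicator (C T) y)"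
            using q(2) \<open>c > 0\<close> by (auto simp: indicator_def F_def simp flip: ennreal_plus intro!: ennreal_leI)
        qed
        also have "\<dots> = ennreal (LINT y|lborel. indicator (C T) y *\<^sub>R F q T y + c * indicator (C T) y)"
          using \<open>c > 0\<close> by (intro nn_integral_eq_integral Bochner_Integration.integrable_add i1 i2) (auto simp: F_def)
        also have "(LINT y|lborel. indicator (C T) y *\<^sub>R F q T y + c * indicator (C T) y) = (LINT y:C T|lborel. F q T y) + c * r ^ DIM('a)"
          using contC by (subst Bochner_Integration.integral_add[OF i1 i2]) (simp add: set_lebesgue_integral_def)
        also have "\<dots> \<le> 3 * c * r ^ DIM('a)" using I2 by simp
        finally show ?thesis by (simp add: ennreal_leI)
      qed
      have cover: "indicator (cbox (z - r *\<^sub>R One) (z + r *\<^sub>R One)) y \<le> (\<Sum>T\<in>Pow Basis. indicator (C T) (reflect T y) :: ennreal)" for y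
      proof (cases "y \<in> cbox (z - r *\<^sub>R One) (z + r *\<^sub>R One)")
        case True
        \<comment> \<open>Reflecting the coordinates in which \<open>y\<close> lies below
          \<open>z\<close> moves \<open>y\<close> into the cube whose lowest corner is the reflected
          \<open>z\<close>.\<close>
        define T where "T = {b\<in>Basis. y \<bullet> b < z \<bullet> b}"
        have "reflect T y \<in> C T"
          using True by (auto simp: C_def mem_box inner_reflect inner_add_left inner_diff_left T_def)
        then have "(1::ennreal) = (\<Sum>T\<in>{T}. indicator (C T) (reflect T y))" by simp
        also have "\<dots> \<le> (\<Sum>T\<in>Pow Basis. indicator (C T) (reflect T y))"
          by (rule sum_mono2) (auto simp: T_def)
        finally show ?thesis using True by simp
      qed simp
      have "(\<integral>\<^sup>+y. ennreal \<bar>f y - f z\<bar> * indicator (cbox (z - r *\<^sub>R One) (z + r *\<^sub>R One)) y \<partial>lborel)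
          \<le> (\<integral>\<^sup>+y. (\<Sum>T\<in>Pow Basis. ennreal \<bar>f y - f z\<bar> * indicator (C T) (reflect T y)) \<partial>lborel)"
        using cover by (intro nn_integral_mono) (auto simp: sum_distrib_left[symmetric] intro!: mult_left_mono)
      also have "\<dots> = (\<Sum>T\<in>Pow Basis. (\<integral>\<^sup>+y. ennreal \<bar>f y - f z\<bar> * indicator (C T) (reflect T y) \<partial>lborel))"
        by (rule nn_integral_sum) (simp add: C_def)
      also have "\<dots> = (\<Sum>T\<in>Pow Basis. (\<integral>\<^sup>+y. ennreal \<bar>f (reflect T y) - f z\<bar> * indicator (C T) y \<partial>lborel))"
      proof (rule sum.cong[OF refl])
        fix T :: "'a set"
        show "(\<integral>\<^sup>+y. ennreal \<bar>f y - f z\<bar> * indicator (C T) (reflect T y) \<partial>lborel) = (\<integral>\<^sup>+y. ennreal \<bar>f (reflect T y) - f z\<bar> * indicator (C T) y \<partial>lborel)"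
          by (subst nn_integral_reflect[of _ T, symmetric]) (simp_all add: C_def)
      qed
      also have "\<dots> \<le> (\<Sum>T\<in>Pow (Basis::'a set). ennreal (3 * c * r ^ DIM('a)))"
        by (rule sum_mono) (rule one)
      also have "\<dots> = ennreal (\<Sum>T\<in>Pow (Basis::'a set). 3 * c * r ^ DIM('a))"
        using r \<open>c > 0\<close> by (intro sum_ennreal) auto
      also have "(\<Sum>T\<in>Pow (Basis::'a set). 3 * c * r ^ DIM('a)) = e * r ^ DIM('a)"
        by (simp add: card_Pow c_def)
      finally show ?thesis .
    qed
    show "\<exists>d>0. \<forall>r. 0 < r \<and> r < d \<longrightarrow>
       (\<integral>\<^sup>+y. ennreal \<bar>f y - f z\<bar> * indicator (cbox (z - r *\<^sub>R One) (z + r *\<^sub>R One)) y \<partial>lborel) \<le> ennreal (e * r ^ DIM('a))"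
      using main \<open>d0 > 0\<close> by (intro exI[of _ d0]) simp
  qed
qed

lemma increment_bound_line:
  fixes g :: "'a::euclidean_space \<Rightarrow> real"
  assumes lip: "\<And>x y. \<bar>g x - g y\<bar> \<le> L * norm (x - y)" and "0 \<le> L" "0 \<le> s"
  shows "ennreal \<bar>g (z + s *\<^sub>R b) - g z - s * c\<bar>
    \<le> (\<integral>\<^sup>+t. ennreal \<bar>upper_dd g b (z + t *\<^sub>R b) - c\<bar> * indicator {0..s} t \<partial>lborel)"
proof -
  have cont: "continuous_on UNIV g"
    using lip \<open>0 \<le> L\<close> by (intro lipschitz_on_continuous_on[of L] lipschitz_onI) (auto simp: dist_real_def dist_norm)
  note [measurable] = upper_dd_measurable[OF cont]
  let ?h = "\<lambda>t. upper_dd g b (z + t *\<^sub>R b) - c"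
  have bnd: "\<bar>?h t\<bar> \<le> L * norm b + \<bar>c\<bar>" for t
    using upper_dd_bound[OF lip, of b "z + t *\<^sub>R b"] by linarith
  have int: "set_integrable lborel {0..s} ?h"
    using bounded_borel_set_integrable[of ?h, OF _ bnd, where a = 0 and b = s] by (simp add: cbox_interval)
  have "(?h has_integral (g (z + s *\<^sub>R b) - g z - s * c)) {0..s}"
    using has_integral_diff[OF upper_dd_has_integral_line[OF lip \<open>0 \<le> L\<close> \<open>0 \<le> s\<close>, of b z] has_integral_const_real[of c 0 s]] \<open>0 \<le> s\<close>
    by simp
  then have "g (z + s *\<^sub>R b) - g z - s * c = (LINT t:{0..s}|lborel. ?h t)"
    using set_borel_integral_eq_integral(2)[OF int] by (simp add: integral_unique)
  moreover have "ennreal (norm (LINT t:{0..s}|lborel. ?h t)) \<le> (\<integral>\<^sup>+t. ennreal (norm (indicator {0..s} t *\<^sub>R ?h t)) \<partial>lborel)"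
    using int unfolding set_lebesgue_integral_def set_integrable_def by (rule integral_norm_bound_ennreal)
  moreover have "(\<integral>\<^sup>+t. ennreal (norm (indicator {0..s} t *\<^sub>R ?h t)) \<partial>lborel) = (\<integral>\<^sup>+t. ennreal \<bar>?h t\<bar> * indicator {0..s} t \<partial>lborel)"
    by (intro nn_integral_cong) (auto simp: indicator_def)
  ultimately show ?thesis by simp
qed

text \<open>A Lebesgue point controls integrals over cubes but no single segment. Translating the
  segment by \<open>w\<close> and exchanging the integrals bounds the averaged deviation by the
  length \<open>s\<close> times one volume integral.\<close>

lemma increment_bound_average:
  fixes g :: "'a::euclidean_space \<Rightarrow> real"
  assumes lip: "\<And>x y. \<bar>g x - g y\<bar> \<le> L * norm (x - y)" and "0 \<le> L" "0 \<le> s"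
    and Q: "Q \<in> sets borel" "\<And>w t. w \<in> W \<Longrightarrow> 0 \<le> t \<Longrightarrow> t \<le> s \<Longrightarrow> a + w + t *\<^sub>R b \<in> Q"
    and W: "W \<in> sets borel"
  shows "(\<integral>\<^sup>+w. ennreal \<bar>g (a + w + s *\<^sub>R b) - g (a + w) - s * c\<bar> * indicator W w \<partial>lborel)
    \<le> ennreal s * (\<integral>\<^sup>+y. ennreal \<bar>upper_dd g b y - c\<bar> * indicator Q y \<partial>lborel)" (is "_ \<le> ennreal s * ?J")
proof -
  have cont: "continuous_on UNIV g"
    using lip \<open>0 \<le> L\<close> by (intro lipschitz_on_continuous_on[of L] lipschitz_onI) (auto simp: dist_real_def dist_norm)
  note [measurable] = upper_dd_measurable[OF cont] Q(1) W
  let ?f = "\<lambda>y. ennreal \<bar>upper_dd g b y - c\<bar>"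
  have "(\<integral>\<^sup>+w. ennreal \<bar>g (a + w + s *\<^sub>R b) - g (a + w) - s * c\<bar> * indicator W w \<partial>lborel)
    \<le> (\<integral>\<^sup>+w. (\<integral>\<^sup>+t. ?f (a + w + t *\<^sub>R b) * indicator {0..s} t * indicator W w \<partial>lborel) \<partial>lborel)"
  proof (rule nn_integral_mono)
    fix w :: 'a
    have "ennreal \<bar>g (a + w + s *\<^sub>R b) - g (a + w) - s * c\<bar> * indicator W w
      \<le> (\<integral>\<^sup>+t. ?f (a + w + t *\<^sub>R b) * indicator {0..s} t \<partial>lborel) * indicator W w"
      using increment_bound_line[OF lip \<open>0 \<le> L\<close> \<open>0 \<le> s\<close>, of "a + w" b c] by (rule mult_right_mono) simp
    also have "\<dots> = (\<integral>\<^sup>+t. ?f (a + w + t *\<^sub>R b) * indicator {0..s} t * indicator W w \<partial>lborel)"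
      by (rule nn_integral_multc[symmetric]) measurable
    finally show "ennreal \<bar>g (a + w + s *\<^sub>R b) - g (a + w) - s * c\<bar> * indicator W w \<le> \<dots>" .
  qed
  also have "\<dots> = (\<integral>\<^sup>+t. (\<integral>\<^sup>+w. ?f (a + w + t *\<^sub>R b) * indicator {0..s} t * indicator W w \<partial>lborel) \<partial>lborel)"
    by (rule lborel_pair.Fubini') (measurable)
  also have "\<dots> \<le> (\<integral>\<^sup>+t. ?J * indicator {0..s} t \<partial>lborel)"
  proof (rule nn_integral_mono)
    fix t :: real
    have "(\<integral>\<^sup>+w. ?f (a + w + t *\<^sub>R b) * indicator {0..s} t * indicator W w \<partial>lborel)
       \<le> (\<integral>\<^sup>+w. (?f ((a + t *\<^sub>R b) + w) * indicator Q ((a + t *\<^sub>R b) + w)) * indicator {0..s} t \<partial>lborel)"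
      using Q(2)[where t = t] by (intro nn_integral_mono) (auto simp: indicator_def algebra_simps)
    also have "\<dots> = (\<integral>\<^sup>+w. (?f ((a + t *\<^sub>R b) + w) * indicator Q ((a + t *\<^sub>R b) + w)) \<partial>lborel) * indicator {0..s} t"
      by (rule nn_integral_multc) measurable
    also have "(\<integral>\<^sup>+w. (?f ((a + t *\<^sub>R b) + w) * indicator Q ((a + t *\<^sub>R b) + w)) \<partial>lborel) = ?J"
      by (rule nn_integral_translate) measurable
    finally show "(\<integral>\<^sup>+w. ?f (a + w + t *\<^sub>R b) * indicator {0..s} t * indicator W w \<partial>lborel) \<le> ?J * indicator {0..s} t" .
  qed
  also have "\<dots> = ?J * ennreal s"
    using \<open>0 \<le> s\<close> by (simp add: nn_integral_cmult)
  finally show ?thesis by (simp add: mult.commute)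
qed

text \<open>Off a null set the point is a Lebesgue point of every partial derivative; their values
  form the candidate gradient \<open>H\<close>. An increment is split into legs parallel to the
  axes, each leg is controlled after averaging over translates by a small ball, and the Lipschitz
  bound removes the averaging.\<close>

theorem rademacher:
  fixes g :: "'a::euclidean_space \<Rightarrow> real"
  assumes lip: "\<And>x y. \<bar>g x - g y\<bar> \<le> L * norm (x - y)"
  shows "negligible {z. \<not> g differentiable (at z)}"
proof -
  have "0 \<le> L"
  proof -
    obtain b :: 'a where "b \<in> Basis" using nonempty_Basis by blast
    moreover have "0 \<le> L * norm (b - 0)"
      using abs_ge_zero lip[of b 0] by (rule order_trans)
    ultimately show ?thesis by simp
  qed
  have cont: "continuous_on UNIV g"
    using lip \<open>0 \<le> L\<close> by (intro lipschitz_on_continuous_on[of L] lipschitz_onI) (auto simp: dist_real_def dist_norm)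
  note [measurable] = upper_dd_measurable[OF cont] borel_measurable_continuous_onI[OF cont]
  define n where "n = real DIM('a)"
  have "n \<ge> 1" using DIM_positive[where 'a='a] by (simp add: n_def)
  define LP where "LP b z e r \<longleftrightarrow> (\<integral>\<^sup>+y. ennreal \<bar>upper_dd g b y - upper_dd g b z\<bar> *
      indicator (cbox (z - r *\<^sub>R One) (z + r *\<^sub>R One)) y \<partial>lborel) \<le> ennreal (e * r ^ DIM('a))" for b z e r
  have "\<exists>N. negligible N \<and> (\<forall>z e. z \<notin> N \<longrightarrow> 0 < e \<longrightarrow> (\<exists>d>0. \<forall>r. 0 < r \<and> r < d \<longrightarrow> LP b z e r))" for b
    unfolding LP_def
    by (rule lebesgue_points[of "upper_dd g b", OF _ upper_dd_bound[OF lip]]) (use upper_dd_measurable[OF cont] in auto)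
  then obtain N where N: "\<And>b. negligible (N b)"
    "\<And>b z e. z \<notin> N b \<Longrightarrow> 0 < e \<Longrightarrow> \<exists>d>0. \<forall>r. 0 < r \<and> r < d \<longrightarrow> LP b z e r"
    by metis
  have "g differentiable (at z)" if z: "z \<notin> (\<Union>b\<in>Basis. N b)" for z
  proof -
    define H where "H = (\<Sum>b\<in>Basis. upper_dd g b z *\<^sub>R b)"
    have Hb: "H \<bullet> b = upper_dd g b z" if "b \<in> Basis" for b
      using that by (simp add: H_def)
    define k where "k w = g w - H \<bullet> w" for w
    define K where "K = L + norm H"
    have klip: "\<bar>k x - k y\<bar> \<le> K * norm (x - y)" for x y
    proof -
      have "\<bar>k x - k y\<bar> \<le> \<bar>g x - g y\<bar> + \<bar>H \<bullet> (x - y)\<bar>"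
        by (simp add: k_def inner_diff_right)
      also have "\<dots> \<le> L * norm (x - y) + norm H * norm (x - y)"
        using lip[of x y] Cauchy_Schwarz_ineq2[of H "x - y"] by linarith
      finally show ?thesis by (simp add: K_def algebra_simps)
    qed
    have "K \<ge> 0" using \<open>0 \<le> L\<close> by (simp add: K_def)
    have [measurable]: "k \<in> borel_measurable borel"
      unfolding k_def by measurable
    define V where "V = unit_ball_vol (real DIM('a))"
    have "V > 0" by (simp add: V_def)
    have small: "\<exists>d>0. \<forall>h. norm h < d \<longrightarrow> \<bar>k (z + h) - k z\<bar> \<le> e * norm h" if "e > 0" for e
    proof -
      \<comment> \<open>The averaging ball has radius \<open>\<tau>\<close> times |h|. Removing the
        average costs 2 K \<tau> |h|, kept to half of the allowed error.\<close>
      define \<tau> where "\<tau> = min 1 (e / (4 * (K + 1)))"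
      have \<tau>01: "0 < \<tau>" "\<tau> \<le> 1"
        using \<open>e > 0\<close> \<open>K \<ge> 0\<close> by (auto simp: \<tau>_def)
      have "\<tau> \<le> e / (4 * (K + 1))" by (simp add: \<tau>_def)
      then have "\<tau> * (4 * (K + 1)) \<le> e"
        using \<open>K \<ge> 0\<close> by (subst (asm) pos_le_divide_eq) auto
      with \<tau>01 have \<tau>: "0 < \<tau>" "\<tau> \<le> 1" "2 * K * \<tau> \<le> e / 2"
        by (auto simp: algebra_simps)
      \<comment> \<open>This makes the \<open>n\<close> legs cost the other half: n r J equals e r /
        2 times the volume of the averaging ball.\<close>
      define \<epsilon> where "\<epsilon> = e * V * \<tau> ^ DIM('a) / (2 * n * 2 ^ DIM('a))"
      have "\<epsilon> > 0" using \<open>e > 0\<close> \<open>V > 0\<close> \<tau> \<open>n \<ge> 1\<close> by (simp add: \<epsilon>_def)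
      have "\<exists>d>0. \<forall>r. 0 < r \<and> r < d \<longrightarrow> LP b z \<epsilon> r" if "b \<in> Basis" for b
        using N(2)[OF _ \<open>\<epsilon> > 0\<close>] z that by blast
      then obtain d where d: "\<And>b. b \<in> Basis \<Longrightarrow> d b > 0"
        "\<And>b r. b \<in> Basis \<Longrightarrow> 0 < r \<Longrightarrow> r < d b \<Longrightarrow> LP b z \<epsilon> r"
        by metis
      define d0 where "d0 = Min (d ` Basis)"
      have "d0 > 0"
        unfolding d0_def by (subst Min_gr_iff) (use d(1) in auto)
      have d0: "d0 \<le> d b" if "b \<in> Basis" for b
        unfolding d0_def using that by (intro Min_le) auto
      have "\<bar>k (z + h) - k z\<bar> \<le> e * norm h" if h: "norm h < d0 / 2" "h \<noteq> 0" for h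
      proof -
        define r where "r = norm h"
        have "r > 0" using h by (simp add: r_def)
        define \<rho> where "\<rho> = \<tau> * r"
        have \<rho>: "0 < \<rho>" "\<rho> \<le> r" using \<tau> \<open>r > 0\<close> by (auto simp: \<rho>_def mult_left_le_one_le)
        define W where "W = cball (0::'a) \<rho>"
        have [measurable]: "W \<in> sets borel" by (simp add: W_def)
        \<comment> \<open>Half of the side is 2 r: averaging moves a coordinate by at most r, the
          path along the axes by at most r more.\<close>
        define Q where "Q = cbox (z - (2 * r) *\<^sub>R One) (z + (2 * r) *\<^sub>R One)"
        have mQ: "Q \<in> sets borel" by (simp add: Q_def)
        define J where "J = \<epsilon> * (2 * r) ^ DIM('a)"
        have J: "(\<integral>\<^sup>+y. ennreal \<bar>upper_dd g b y - upper_dd g b z\<bar> * indicator Q y \<partial>lborel) \<le> ennreal J"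
          if "b \<in> Basis" for b
          unfolding Q_def J_def LP_def[symmetric] using \<open>r > 0\<close> h d0[OF that] by (intro d(2)[OF that]) (auto simp: r_def)
        define p where "p S = (\<Sum>b\<in>S. (h \<bullet> b) *\<^sub>R b)" for S
        have pb: "p S \<bullet> b = (if b \<in> S then h \<bullet> b else 0)" if "S \<subseteq> Basis" "b \<in> Basis" for S b
        proof -
          have "p S \<bullet> b = (\<Sum>b'\<in>S. if b' = b then h \<bullet> b else 0)"
            unfolding p_def inner_sum_left using that by (intro sum.cong) (auto simp: inner_Basis)
          also have "\<dots> = (if b \<in> S then h \<bullet> b else 0)"
            using that(1) by (simp add: finite_subset[OF _ finite_Basis])
          finally show ?thesis .
        qed
        have hb: "\<bar>h \<bullet> b\<bar> \<le> r" if "b \<in> Basis" for b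
          using Basis_le_norm[OF that] by (simp add: r_def)
        have avg: "(\<integral>\<^sup>+w. ennreal \<bar>k (z + w + p S) - k (z + w)\<bar> * indicator W w \<partial>lborel) \<le> of_nat (card S) * ennreal (r * J)"
          if "finite S" "S \<subseteq> Basis" for S
          using that
        proof (induction S rule: finite_induct)
          case empty
          then show ?case by (simp add: p_def)
        next
          case (insert b S)
          then have bB: "b \<in> Basis" and SB: "S \<subseteq> Basis" by auto
          define s where "s = h \<bullet> b"
          have pins: "p (insert b S) = p S + s *\<^sub>R b"
            using insert.hyps by (simp add: p_def s_def)
          \<comment> \<open>For negative \<open>s\<close> the leg starts from its other end, so that
            the parameter stays nonnegative.\<close>
          define a where "a = z + p S + (if 0 \<le> s then 0 else s *\<^sub>R b)"
          have inQ: "a + w + t *\<^sub>R b \<in> Q" if w: "w \<in> W" and t: "0 \<le> t" "t \<le> \<bar>s\<bar>" for w t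
          proof -
            have "z \<bullet> i - 2 * r \<le> (a + w + t *\<^sub>R b) \<bullet> i \<and> (a + w + t *\<^sub>R b) \<bullet> i \<le> z \<bullet> i + 2 * r" if i: "i \<in> Basis" for i
            proof -
              have "\<bar>w \<bullet> i\<bar> \<le> r"
                using Basis_le_norm[OF i, of w] w \<rho> by (simp add: W_def)
              moreover have "\<bar>(p S + (if 0 \<le> s then 0 else s *\<^sub>R b) + t *\<^sub>R b) \<bullet> i\<bar> \<le> r"
              proof (cases "i = b")
                case True
                then show ?thesis
                  using pb[OF SB bB] insert.hyps hb[OF bB] t bB by (auto simp: inner_add_left s_def)
              next
                case False
                then show ?thesis
                  using pb[OF SB i] hb[OF i] i bB \<open>r > 0\<close> by (auto simp: inner_add_left inner_Basis)
              qed
              ultimately show ?thesis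
                by (auto simp: a_def inner_add_left abs_le_iff split: if_splits)
            qed
            then show ?thesis by (simp add: Q_def mem_box inner_diff_left inner_add_left)
          qed
          have step: "(\<integral>\<^sup>+w. ennreal \<bar>k (z + w + p (insert b S)) - k (z + w + p S)\<bar> * indicator W w \<partial>lborel) \<le> ennreal (r * J)"
          proof -
            have "(\<integral>\<^sup>+w. ennreal \<bar>k (z + w + p (insert b S)) - k (z + w + p S)\<bar> * indicator W w \<partial>lborel)
              = (\<integral>\<^sup>+w. ennreal \<bar>g (a + w + \<bar>s\<bar> *\<^sub>R b) - g (a + w) - \<bar>s\<bar> * upper_dd g b z\<bar> * indicator W w \<partial>lborel)"
            proof (rule nn_integral_cong)
              fix w
              have "\<bar>k (z + w + p (insert b S)) - k (z + w + p S)\<bar> = \<bar>g (a + w + \<bar>s\<bar> *\<^sub>R b) - g (a + w) - \<bar>s\<bar> * upper_dd g b z\<bar>"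
                by (cases "0 \<le> s") (auto simp: a_def pins k_def inner_add_right Hb[OF bB] algebra_simps)
              then show "ennreal \<bar>k (z + w + p (insert b S)) - k (z + w + p S)\<bar> * indicator W w = ennreal \<bar>g (a + w + \<bar>s\<bar> *\<^sub>R b) - g (a + w) - \<bar>s\<bar> * upper_dd g b z\<bar> * indicator W w"
                by simp
            qed
            also have "\<dots> \<le> ennreal \<bar>s\<bar> * (\<integral>\<^sup>+y. ennreal \<bar>upper_dd g b y - upper_dd g b z\<bar> * indicator Q y \<partial>lborel)"
              by (rule increment_bound_average[OF lip \<open>0 \<le> L\<close>]) (use mQ inQ in auto)
            also have "\<dots> \<le> ennreal r * ennreal J"
              using hb[OF bB] J[OF bB] by (intro mult_mono) (auto simp: s_def intro: ennreal_leI)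
            finally show ?thesis using \<open>r > 0\<close> \<open>\<epsilon> > 0\<close> by (simp add: J_def ennreal_mult)
          qed
          have "(\<integral>\<^sup>+w. ennreal \<bar>k (z + w + p (insert b S)) - k (z + w)\<bar> * indicator W w \<partial>lborel)
             \<le> (\<integral>\<^sup>+w. ennreal \<bar>k (z + w + p (insert b S)) - k (z + w + p S)\<bar> * indicator W w
                   + ennreal \<bar>k (z + w + p S) - k (z + w)\<bar> * indicator W w \<partial>lborel)"
            by (intro nn_integral_mono) (auto simp: indicator_def simp flip: ennreal_plus intro!: ennreal_leI)
          also have "\<dots> = (\<integral>\<^sup>+w. ennreal \<bar>k (z + w + p (insert b S)) - k (z + w + p S)\<bar> * indicator W w \<partial>lborel)
                   + (\<integral>\<^sup>+w. ennreal \<bar>k (z + w + p S) - k (z + w)\<bar> * indicator W w \<partial>lborel)"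
            by (rule nn_integral_add) measurable
          also have "\<dots> \<le> ennreal (r * J) + of_nat (card S) * ennreal (r * J)"
            by (intro add_mono step insert.IH SB)
          finally show ?case
            using insert.hyps by (simp add: distrib_right)
        qed
        have pB: "p Basis = h" by (simp add: p_def euclidean_representation)
        have emW: "emeasure lborel W = ennreal (V * \<rho> ^ DIM('a))"
          unfolding W_def V_def using \<rho> by (simp add: emeasure_cball)
        have "ennreal \<bar>k (z + h) - k z\<bar> * emeasure lborel W = (\<integral>\<^sup>+w. ennreal \<bar>k (z + h) - k z\<bar> * indicator W w \<partial>lborel)"
          by (simp add: nn_integral_cmult_indicator)
        also have "\<dots> \<le> (\<integral>\<^sup>+w. ennreal \<bar>k (z + w + p Basis) - k (z + w)\<bar> * indicator W w + ennreal (2 * K * \<rho>) * indicator W w \<partial>lborel)"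
        proof (rule nn_integral_mono)
          fix w
          have "\<bar>k (z + h) - k z\<bar> \<le> \<bar>k (z + w + p Basis) - k (z + w)\<bar> + 2 * K * \<rho>" if "w \<in> W"
          proof -
            have "norm w \<le> \<rho>" using that by (simp add: W_def)
            then have "K * norm w \<le> K * \<rho>" using \<open>K \<ge> 0\<close> by (rule mult_left_mono)
            then show ?thesis
              using klip[of "z + h" "z + w + h"] klip[of "z + w" z] unfolding pB by (simp add: algebra_simps)
          qed
          then show "ennreal \<bar>k (z + h) - k z\<bar> * indicator W w \<le> ennreal \<bar>k (z + w + p Basis) - k (z + w)\<bar> * indicator W w + ennreal (2 * K * \<rho>) * indicator W w"
            using \<open>K \<ge> 0\<close> \<rho> by (auto simp: indicator_def simp flip: ennreal_plus intro!: ennreal_leI)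
        qed
        also have "\<dots> = (\<integral>\<^sup>+w. ennreal \<bar>k (z + w + p Basis) - k (z + w)\<bar> * indicator W w \<partial>lborel) + ennreal (2 * K * \<rho>) * emeasure lborel W"
          by (subst nn_integral_add) (auto simp: nn_integral_cmult_indicator)
        also have "\<dots> \<le> of_nat DIM('a) * ennreal (r * J) + ennreal (2 * K * \<rho>) * emeasure lborel W"
          by (intro add_mono order_refl avg) auto
        finally have "ennreal (\<bar>k (z + h) - k z\<bar> * (V * \<rho> ^ DIM('a))) \<le> ennreal (n * (r * J) + 2 * K * \<rho> * (V * \<rho> ^ DIM('a)))"
          unfolding emW using \<open>V > 0\<close> \<rho> \<open>K \<ge> 0\<close> \<open>r > 0\<close> \<open>\<epsilon> > 0\<close>
          by (simp add: n_def J_def ennreal_mult ennreal_of_nat_eq_real_of_nat)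
        then have "\<bar>k (z + h) - k z\<bar> * (V * \<rho> ^ DIM('a)) \<le> n * (r * J) + 2 * K * \<rho> * (V * \<rho> ^ DIM('a))"
          using \<open>V > 0\<close> \<rho> \<open>K \<ge> 0\<close> \<open>r > 0\<close> \<open>\<epsilon> > 0\<close> \<open>n \<ge> 1\<close> by (subst (asm) ennreal_le_iff) (auto simp: J_def)
        also have "n * (r * J) = (e / 2 * r) * (V * \<rho> ^ DIM('a))"
          using \<open>n \<ge> 1\<close> by (simp add: J_def \<epsilon>_def \<rho>_def power_mult_distrib)
        also have "(e / 2 * r) * (V * \<rho> ^ DIM('a)) + 2 * K * \<rho> * (V * \<rho> ^ DIM('a)) = (e / 2 * r + (2 * K * \<tau>) * r) * (V * \<rho> ^ DIM('a))"
          by (simp add: \<rho>_def algebra_simps)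
        finally have "\<bar>k (z + h) - k z\<bar> \<le> e / 2 * r + (2 * K * \<tau>) * r"
          using \<open>V > 0\<close> \<rho> by (simp add: mult_le_cancel_right)
        also have "\<dots> \<le> e / 2 * r + e / 2 * r"
          using \<tau> \<open>r > 0\<close> by (intro add_mono mult_right_mono) auto
        finally show ?thesis by (simp add: r_def)
      qed
      then show ?thesis
        using \<open>d0 > 0\<close> \<open>e > 0\<close> by (intro exI[of _ "d0 / 2"]) (metis abs_zero add.right_neutral cancel_comm_monoid_add_class.diff_cancel half_gt_zero mult_zero_right norm_zero order_refl)
    qed
    have "(g has_derivative (\<lambda>h. H \<bullet> h)) (at z)"
      unfolding has_derivative_at_alt
    proof (intro conjI allI impI bounded_linear_inner_right)
      fix e :: real assume "e > 0"
      then obtain d where "d > 0" and d: "\<And>h. norm h < d \<Longrightarrow> \<bar>k (z + h) - k z\<bar> \<le> e * norm h"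
        using small by blast
      have "norm (g y - g z - H \<bullet> (y - z)) \<le> e * norm (y - z)" if "norm (y - z) < d" for y
        using d[OF that] by (simp add: k_def inner_diff_right algebra_simps)
      then show "\<exists>d>0. \<forall>y. norm (y - z) < d \<longrightarrow> norm (g y - g z - H \<bullet> (y - z)) \<le> e * norm (y - z)"
        using \<open>d > 0\<close> by blast
    qed
    then show ?thesis by (rule differentiableI)
  qed
  then have "{z. \<not> g differentiable (at z)} \<subseteq> (\<Union>b\<in>Basis. N b)"
    by blast
  moreover have "negligible (\<Union>b\<in>Basis. N b)"
    by (rule negligible_Union) (auto simp: N)
  ultimately show ?thesis
    using negligible_subset by blast
qed

section \<open>Jets at a maximum of a sum of semiconvex functions\<close>

text \<open>Encoded by a supporting paraboloid at every point, because the slope \<open>q\<close> is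
  what later arguments use. That A + \<Lambda> |z|^2 is then convex is derived in
  \<open>semiconvex_imp_continuous\<close>.\<close>

definition semiconvex :: "real \<Rightarrow> ('a::real_inner \<Rightarrow> real) \<Rightarrow> bool" where
  "semiconvex \<Lambda> A \<longleftrightarrow> (\<forall>z. \<exists>q. \<forall>h. A z + q \<bullet> h - \<Lambda> * (norm h)\<^sup>2 \<le> A (z + h))"

lemma linear_le_quadratic_imp_zero:
  fixes v :: "'a::real_inner"
  assumes "0 < r" and le: "\<And>h. norm h < r \<Longrightarrow> v \<bullet> h \<le> C * (norm h)\<^sup>2"
  shows "v = 0"
proof (rule ccontr)
  assume "v \<noteq> 0"
  \<comment> \<open>The first bound keeps \<open>t *\<^sub>R v\<close> inside the ball of radius
    \<open>r\<close>, the second makes C t at most 1/2.\<close>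
  define t where "t = min (r / (2 * norm v)) (1 / (2 * (\<bar>C\<bar> + 1)))"
  have "t > 0" using \<open>v \<noteq> 0\<close> \<open>0 < r\<close> by (simp add: t_def)
  have "t \<le> r / (2 * norm v)" by (simp add: t_def)
  then have "norm (t *\<^sub>R v) < r"
    using \<open>t > 0\<close> \<open>v \<noteq> 0\<close> \<open>0 < r\<close> by (simp add: field_simps)
  then have "t * (v \<bullet> v) \<le> t * ((C * t) * (v \<bullet> v))"
    using le[of "t *\<^sub>R v"] \<open>t > 0\<close> by (simp add: dot_square_norm algebra_simps power2_eq_square)
  then have "v \<bullet> v \<le> (C * t) * (v \<bullet> v)"
    using \<open>t > 0\<close> by simp
  also have "C * t \<le> (\<bar>C\<bar> + 1) * (1 / (2 * (\<bar>C\<bar> + 1)))"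
    using \<open>t > 0\<close> by (intro mult_mono) (auto simp: t_def)
  also have "(\<bar>C\<bar> + 1) * (1 / (2 * (\<bar>C\<bar> + 1))) = 1 / 2"
    by (simp add: field_simps)
  finally show False using \<open>v \<noteq> 0\<close> by (simp add: mult_right_mono)
qed

text \<open>The supporting paraboloid at the intermediate point is evaluated at both ends; in the
  convex combination the slope cancels.\<close>

lemma semiconvex_segment:
  assumes "semiconvex \<Lambda> A" "0 \<le> t" "t \<le> 1"
  shows "A (z + t *\<^sub>R d) \<le> (1 - t) * A z + t * A (z + d) + \<Lambda> * t * (1 - t) * (norm d)\<^sup>2"
proof -
  obtain q where q: "\<And>h. A (z + t *\<^sub>R d) + q \<bullet> h - \<Lambda> * (norm h)\<^sup>2 \<le> A (z + t *\<^sub>R d + h)"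
    using assms(1) unfolding semiconvex_def by blast
  have "A (z + t *\<^sub>R d) - t * (q \<bullet> d) - \<Lambda> * t\<^sup>2 * (norm d)\<^sup>2 \<le> A z"
    using q[of "- (t *\<^sub>R d)"] by (simp add: power_mult_distrib mult.assoc)
  moreover have "A (z + t *\<^sub>R d) + (1 - t) * (q \<bullet> d) - \<Lambda> * (1 - t)\<^sup>2 * (norm d)\<^sup>2 \<le> A (z + d)"
  proof -
    have e: "t *\<^sub>R d + (1 - t) *\<^sub>R d = d" by (simp flip: scaleR_left_distrib)
    show ?thesis
      using q[of "(1 - t) *\<^sub>R d"] by (simp add: power_mult_distrib mult.assoc add.assoc e)
  qed
  ultimately have "(1 - t) * (A (z + t *\<^sub>R d) - t * (q \<bullet> d) - \<Lambda> * t\<^sup>2 * (norm d)\<^sup>2)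
      + t * (A (z + t *\<^sub>R d) + (1 - t) * (q \<bullet> d) - \<Lambda> * (1 - t)\<^sup>2 * (norm d)\<^sup>2) \<le> (1 - t) * A z + t * A (z + d)"
    using assms(2,3) by (intro add_mono mult_left_mono) auto
  then show ?thesis by (simp add: algebra_simps power2_eq_square)
qed

lemma semiconvex_imp_continuous:
  fixes A :: "'a::euclidean_space \<Rightarrow> real"
  assumes "semiconvex \<Lambda> A"
  shows "continuous_on UNIV A"
proof -
  have "convex_on UNIV (\<lambda>z. A z + \<Lambda> * (norm z)\<^sup>2)"
  proof (rule convex_onI)
    fix t :: real and x y :: 'a assume t: "0 < t" "t < 1"
    have e: "x + t *\<^sub>R (y - x) = (1 - t) *\<^sub>R x + t *\<^sub>R y" by (simp add: algebra_simps)
    have "t * (1 - t) * (norm (y - x))\<^sup>2 + (norm (x + t *\<^sub>R (y - x)))\<^sup>2 = (1 - t) * (norm x)\<^sup>2 + t * (norm y)\<^sup>2"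
      unfolding power2_norm_eq_inner by (simp add: inner_add_left inner_add_right inner_diff_left inner_diff_right inner_commute algebra_simps)
    then have n: "\<Lambda> * (t * (1 - t) * (norm (y - x))\<^sup>2 + (norm (x + t *\<^sub>R (y - x)))\<^sup>2) = \<Lambda> * ((1 - t) * (norm x)\<^sup>2 + t * (norm y)\<^sup>2)"
      by (rule arg_cong)
    from semiconvex_segment[OF assms, of t x "y - x"] t
    have "A (x + t *\<^sub>R (y - x)) \<le> (1 - t) * A x + t * A y + \<Lambda> * t * (1 - t) * (norm (y - x))\<^sup>2" by simp
    with n show "A ((1 - t) *\<^sub>R x + t *\<^sub>R y) + \<Lambda> * (norm ((1 - t) *\<^sub>R x + t *\<^sub>R y))\<^sup>2
        \<le> (1 - t) * (A x + \<Lambda> * (norm x)\<^sup>2) + t * (A y + \<Lambda> * (norm y)\<^sup>2)"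
      unfolding e by (simp add: algebra_simps)
  qed simp
  then have "continuous_on UNIV (\<lambda>z. A z + \<Lambda> * (norm z)\<^sup>2)"
    by (rule convex_on_continuous[OF open_UNIV])
  then have "continuous_on UNIV (\<lambda>z. (A z + \<Lambda> * (norm z)\<^sup>2) - \<Lambda> * (norm z)\<^sup>2)"
    by (rule continuous_on_diff) (intro continuous_intros)
  moreover have "(\<lambda>z. (A z + \<Lambda> * (norm z)\<^sup>2) - \<Lambda> * (norm z)\<^sup>2) = A" by auto
  ultimately show ?thesis by metis
qed

text \<open>A slope that supports with some constant \<open>C\<close> supports with the
  semiconvexity constant: test with t h, use semiconvexity along the segment, divide by t and let t
  tend to 0.\<close>

lemma semiconvex_slope:
  assumes sc: "semiconvex \<mu> g" and low: "\<And>h. g y + s \<bullet> h - C * (norm h)\<^sup>2 \<le> g (y + h)"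
  shows "g y + s \<bullet> h - \<mu> * (norm h)\<^sup>2 \<le> g (y + h)"
proof -
  define Z where "Z = (C - \<mu>) * (norm h)\<^sup>2"
  have *: "g y + s \<bullet> h - \<mu> * (norm h)\<^sup>2 - g (y + h) \<le> t * Z" if t: "0 < t" "t < 1" for t
  proof -
    have "g y + t * (s \<bullet> h) - C * (t\<^sup>2 * (norm h)\<^sup>2) \<le> (1 - t) * g y + t * g (y + h) + \<mu> * t * (1 - t) * (norm h)\<^sup>2"
      using low[of "t *\<^sub>R h"] semiconvex_segment[OF sc, of t y h] t by (simp add: power_mult_distrib)
    then have "t * (g y + s \<bullet> h - \<mu> * (norm h)\<^sup>2 - g (y + h)) \<le> t * (t * Z)"
      by (simp add: Z_def algebra_simps power2_eq_square)
    then show ?thesis using t by simp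
  qed
  have "g y + s \<bullet> h - \<mu> * (norm h)\<^sup>2 - g (y + h) \<le> 0"
  proof (rule field_le_epsilon)
    fix e :: real assume "e > 0"
    define t where "t = min (1/2) (e / (\<bar>Z\<bar> + 1))"
    have t: "0 < t" "t < 1" using \<open>e > 0\<close> by (auto simp: t_def)
    have "t * Z \<le> t * (\<bar>Z\<bar> + 1)" using t by (intro mult_left_mono) auto
    also have "\<dots> \<le> e / (\<bar>Z\<bar> + 1) * (\<bar>Z\<bar> + 1)" by (intro mult_right_mono) (auto simp: t_def)
    also have "\<dots> = e" by simp
    finally show "g y + s \<bullet> h - \<mu> * (norm h)\<^sup>2 - g (y + h) \<le> 0 + e"
      using *[OF t] by simp
  qed
  then show ?thesis by simp
qed

lemma coercive_attains_sup:
  fixes F :: "'a::euclidean_space \<Rightarrow> real"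
  assumes cont: "continuous_on UNIV F" and "0 < k" and le: "\<And>h. F (z + h) \<le> c + q \<bullet> h - k * (norm h)\<^sup>2"
  shows "\<exists>y. \<forall>w. F w \<le> F y"
proof -
  \<comment> \<open>Beyond this radius the quadratic term outweighs both the linear term and the
    difference of \<open>c\<close> and \<open>F z\<close>, so no value there exceeds
    \<open>F z\<close>.\<close>
  define R where "R = (norm q + \<bar>c - F z\<bar>) / k + 1"
  have "R \<ge> 1" using \<open>0 < k\<close> by (simp add: R_def)
  obtain y where y: "y \<in> cball z R" "\<And>w. w \<in> cball z R \<Longrightarrow> F w \<le> F y"
    using continuous_attains_sup[of "cball z R" F] \<open>R \<ge> 1\<close> cont continuous_on_subset by (metis cball_eq_empty compact_cball linorder_not_less order.trans subset_UNIV zero_le_one)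
  have "F w \<le> F y" for w
  proof (cases "w \<in> cball z R")
    case False
    define h where "h = w - z"
    have h: "norm h > R" using False by (simp add: h_def dist_norm norm_minus_commute)
    have "F w \<le> c + q \<bullet> h - k * (norm h)\<^sup>2" using le[of h] by (simp add: h_def)
    moreover have "q \<bullet> h \<le> norm q * norm h" by (rule norm_cauchy_schwarz)
    moreover have "k * (norm h)\<^sup>2 \<ge> (k * R) * norm h"
      using h \<open>0 < k\<close> mult_right_mono[of R "norm h" "norm h"] by (simp add: power2_eq_square)
    moreover have "k * R = norm q + \<bar>c - F z\<bar> + k"
      using \<open>0 < k\<close> by (simp add: R_def field_simps)
    then have "(k * R) * norm h = norm q * norm h + \<bar>c - F z\<bar> * norm h + k * norm h"
      by (simp add: distrib_right)
    ultimately have "F w \<le> c - \<bar>c - F z\<bar> * norm h - k * norm h" by (simp add: algebra_simps)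
    moreover have "\<bar>c - F z\<bar> \<le> \<bar>c - F z\<bar> * norm h"
      using h \<open>R \<ge> 1\<close> mult_left_mono[of 1 "norm h" "\<bar>c - F z\<bar>"] by simp
    moreover have "0 \<le> k * norm h" using \<open>0 < k\<close> by simp
    ultimately have "F w \<le> c - \<bar>c - F z\<bar>" by linarith
    then have "F w \<le> F z" by linarith
    also have "\<dots> \<le> F y" using \<open>R \<ge> 1\<close> by (intro y(2)) simp
    finally show ?thesis .
  qed (use y in auto)
  then show ?thesis by blast
qed

text \<open>The value at z' + h is expanded from both base points, with h in the direction of p - p'
  and of length |z - z'|. The errors 4 + 1 + 1 add up to the constant 6.\<close>

lemma C11_gradient_lipschitz:
  fixes f :: "'a::real_inner \<Rightarrow> real"
  assumes 1: "\<And>h. \<bar>f (z + h) - f z - p \<bullet> h\<bar> \<le> \<Lambda> * (norm h)\<^sup>2"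
    and 2: "\<And>h. \<bar>f (z' + h) - f z' - p' \<bullet> h\<bar> \<le> \<Lambda> * (norm h)\<^sup>2"
  shows "norm (p - p') \<le> 6 * \<Lambda> * norm (z - z')"
proof (cases "p = p'")
  case True
  have "0 \<le> \<Lambda> * (norm (z - z'))\<^sup>2" using order_trans[OF abs_ge_zero 1[of "z - z'"]] .
  then have "0 \<le> \<Lambda> * norm (z - z')" by (auto simp: zero_le_mult_iff)
  then show ?thesis using True by simp
next
  case False
  define d where "d = norm (z - z')"
  define e where "e = (p - p') /\<^sub>R norm (p - p')"
  have ne: "norm e = 1" using False by (simp add: e_def)
  have pe: "(p - p') \<bullet> e = norm (p - p')"
    using False by (simp add: e_def dot_square_norm power2_eq_square)
  have \<Lambda>: "0 \<le> \<Lambda>" using order_trans[OF abs_ge_zero 1[of e]] ne by simp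
  show ?thesis
  proof (cases "d = 0")
    case True
    then have zz: "z = z'" by (simp add: d_def)
    have "p - p' = 0"
    proof (rule linear_le_quadratic_imp_zero[of 1])
      fix h :: 'a show "(p - p') \<bullet> h \<le> (2 * \<Lambda>) * (norm h)\<^sup>2"
        using 1[of h] 2[of h] unfolding zz by (simp add: inner_diff_left)
    qed simp
    then show ?thesis using \<Lambda> by simp
  next
    case False
    then have "d > 0" by (simp add: d_def)
    define h where "h = d *\<^sub>R e"
    have nh: "norm h = d" using \<open>d > 0\<close> ne by (simp add: h_def)
    have "norm (z' - z + h) \<le> 2 * d"
      using norm_triangle_ineq[of "z' - z" h] nh by (simp add: d_def norm_minus_commute)
    then have "(norm (z' - z + h))\<^sup>2 \<le> (2 * d)\<^sup>2" by (rule power_mono) simp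
    then have "\<Lambda> * (norm (z' - z + h))\<^sup>2 \<le> \<Lambda> * (4 * d\<^sup>2)"
      using \<Lambda> by (intro mult_left_mono) (auto simp: power_mult_distrib)
    moreover have "\<bar>f (z' + h) - f z - p \<bullet> (z' - z + h)\<bar> \<le> \<Lambda> * (norm (z' - z + h))\<^sup>2"
      using 1[of "z' - z + h"] by (simp add: algebra_simps)
    moreover have "\<bar>f z' - f z - p \<bullet> (z' - z)\<bar> \<le> \<Lambda> * d\<^sup>2"
      using 1[of "z' - z"] by (simp add: d_def norm_minus_commute)
    moreover have "\<bar>f (z' + h) - f z' - p' \<bullet> h\<bar> \<le> \<Lambda> * d\<^sup>2"
      using 2[of h] nh by simp
    ultimately have "(p - p') \<bullet> h \<le> 6 * (\<Lambda> * d\<^sup>2)"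
      by (simp add: inner_add_right inner_diff_right inner_diff_left)
    moreover have "(p - p') \<bullet> h = d * norm (p - p')" by (simp add: h_def pe)
    ultimately have "d * norm (p - p') \<le> d * (6 * \<Lambda> * d)" by (simp add: power2_eq_square mult_ac)
    then show ?thesis using \<open>d > 0\<close> by (simp add: d_def)
  qed
qed

text \<open>The mean value theorem along the segment reduces the second-order remainder of
  \<open>f\<close> to the first-order remainder of its gradient.\<close>

lemma C11_second_order_expansion:
  fixes f :: "'a::euclidean_space \<Rightarrow> real"
  assumes C11: "\<And>z h. \<bar>f (z + h) - f z - G z \<bullet> h\<bar> \<le> \<Lambda> * (norm h)\<^sup>2"
    and D: "(G has_derivative D) (at z)" and "0 < \<kappa>"
  obtains r where "0 < r"
    "\<And>h. norm h < r \<Longrightarrow> \<bar>f (z + h) - f z - G z \<bullet> h - (D h \<bullet> h) / 2\<bar> \<le> \<kappa> * (norm h)\<^sup>2"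
proof -
  have fder: "(f has_derivative (\<lambda>h. G z \<bullet> h)) (at z)" for z
    unfolding has_derivative_at_alt
  proof (intro conjI allI impI bounded_linear_inner_right)
    fix e :: real assume "e > 0"
    have "norm (f y - f z - G z \<bullet> (y - z)) \<le> e * norm (y - z)" if "norm (y - z) < e / (\<bar>\<Lambda>\<bar> + 1)" for y
    proof -
      have "norm (f y - f z - G z \<bullet> (y - z)) \<le> \<Lambda> * (norm (y - z))\<^sup>2"
        using C11[of z "y - z"] by simp
      also have "\<dots> \<le> (\<bar>\<Lambda>\<bar> + 1) * norm (y - z) * norm (y - z)"
        unfolding power2_eq_square mult.assoc by (intro mult_right_mono) auto
      also have "\<dots> \<le> e * norm (y - z)"
        using that by (intro mult_right_mono) (auto simp: field_simps)
      finally show ?thesis .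
    qed
    then show "\<exists>d>0. \<forall>y. norm (y - z) < d \<longrightarrow> norm (f y - f z - G z \<bullet> (y - z)) \<le> e * norm (y - z)"
      using \<open>e > 0\<close> by (intro exI[of _ "e / (\<bar>\<Lambda>\<bar> + 1)"]) auto
  qed
  obtain r where r: "0 < r" "\<And>y. norm (y - z) < r \<Longrightarrow> norm (G y - G z - D (y - z)) \<le> \<kappa> * norm (y - z)"
    using D \<open>0 < \<kappa>\<close> unfolding has_derivative_at_alt by blast
  have linD: "linear D" using D has_derivative_linear by blast
  show thesis
  proof (rule that[OF r(1)])
    fix h :: 'a assume h: "norm h < r"
    define \<psi> where "\<psi> t = f (z + t *\<^sub>R h) - t * (G z \<bullet> h) - t\<^sup>2 * (D h \<bullet> h) / 2" for t
    have "(\<psi> has_real_derivative (G (z + t *\<^sub>R h) \<bullet> h - G z \<bullet> h - t * (D h \<bullet> h))) (at t)" for t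
    proof -
      have "((\<lambda>t. f (z + t *\<^sub>R h)) has_derivative (\<lambda>s. G (z + t *\<^sub>R h) \<bullet> (s *\<^sub>R h))) (at t)"
        by (rule has_derivative_compose[OF _ fder]) (auto intro!: derivative_eq_intros)
      then have "((\<lambda>t. f (z + t *\<^sub>R h)) has_real_derivative (G (z + t *\<^sub>R h) \<bullet> h)) (at t)"
        unfolding has_field_derivative_def by (rule has_derivative_eq_rhs) auto
      then show ?thesis
        unfolding \<psi>_def by (auto intro!: derivative_eq_intros)
    qed
    then obtain t where t: "0 < t" "t < 1" "\<psi> 1 - \<psi> 0 = G (z + t *\<^sub>R h) \<bullet> h - G z \<bullet> h - t * (D h \<bullet> h)"
      using MVT2[of 0 1 \<psi> "\<lambda>t. G (z + t *\<^sub>R h) \<bullet> h - G z \<bullet> h - t * (D h \<bullet> h)"] by auto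
    have "\<psi> 1 - \<psi> 0 = (G (z + t *\<^sub>R h) - G z - D (t *\<^sub>R h)) \<bullet> h"
      by (simp add: t(3) inner_diff_left linear_scale[OF linD])
    also have "\<bar>\<dots>\<bar> \<le> norm (G (z + t *\<^sub>R h) - G z - D (t *\<^sub>R h)) * norm h"
      by (rule Cauchy_Schwarz_ineq2)
    also have "\<dots> \<le> (\<kappa> * norm (t *\<^sub>R h)) * norm h"
    proof -
      have "t * norm h \<le> norm h" using t by (simp add: mult_left_le_one_le)
      then show ?thesis
        using r(2)[of "z + t *\<^sub>R h"] t h by (intro mult_right_mono) auto
    qed
    also have "\<dots> \<le> (\<kappa> * norm h) * norm h"
      using t \<open>0 < \<kappa>\<close> by (intro mult_right_mono mult_left_mono) (auto simp: mult_left_le_one_le)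
    finally show "\<bar>f (z + h) - f z - G z \<bullet> h - (D h \<bullet> h) / 2\<bar> \<le> \<kappa> * (norm h)\<^sup>2"
      by (simp add: \<psi>_def power2_eq_square algebra_simps)
  qed
qed

text \<open>
  The hull \<open>a\<close> is the lower envelope of the paraboloids of opening \<open>\<Lambda>\<close> lying above \<open>A\<close>;
  the last property is its minimality.
\<close>

theorem C11_hull:
  fixes A :: "'a::euclidean_space \<Rightarrow> real"
  assumes sc: "semiconvex \<Lambda> A" and "0 < \<Lambda>" and bdd: "\<And>z. A z \<le> C"
  obtains a G where
    "\<And>z. A z \<le> a z"
    "\<And>z h. \<bar>a (z + h) - a z - G z \<bullet> h\<bar> \<le> \<Lambda> * (norm h)\<^sup>2"
    "\<And>V z q. (\<And>y. A y \<le> V y) \<Longrightarrow> (\<And>h. V (z + h) \<le> V z + q \<bullet> h + \<Lambda> * (norm h)\<^sup>2) \<Longrightarrow> a z \<le> V z"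
proof -
  have contA: "continuous_on UNIV A" by (rule semiconvex_imp_continuous[OF sc])
  have "\<exists>w. \<forall>w'. A w' - \<Lambda> * (norm (y - w'))\<^sup>2 \<le> A w - \<Lambda> * (norm (y - w))\<^sup>2" for y
    by (rule coercive_attains_sup[where k = \<Lambda> and z = y and c = C and q = 0])
       (use bdd \<open>0 < \<Lambda>\<close> in \<open>auto intro!: continuous_intros contA\<close>)
  then obtain W where W: "\<And>y w. A w - \<Lambda> * (norm (y - w))\<^sup>2 \<le> A (W y) - \<Lambda> * (norm (y - W y))\<^sup>2"
    by metis
  \<comment> \<open>\<open>g y\<close> is the least constant for which the paraboloid of opening
    \<open>\<Lambda>\<close> with vertex at \<open>y\<close> lies above \<open>A\<close>; the hull
    \<open>a\<close> below is the infimum of these paraboloids, so it is a double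
    convolution.\<close>
  define g where "g y = A (W y) - \<Lambda> * (norm (y - W y))\<^sup>2" for y
  have g_ge: "A w - \<Lambda> * (norm (y - w))\<^sup>2 \<le> g y" for y w
    using W by (simp add: g_def)
  \<comment> \<open>At the maximiser, \<open>A\<close> lies between two paraboloids, which
    determines the slope. Moving the maximiser by h / 2 splits the increment evenly between both
    quadratic terms, and this yields the improved constant \<Lambda> / 2.\<close>
  have g_low: "\<exists>q. \<forall>h. g y + q \<bullet> h - (\<Lambda> / 2) * (norm h)\<^sup>2 \<le> g (y + h)" for y
  proof -
    obtain q where q: "\<And>h. A (W y) + q \<bullet> h - \<Lambda> * (norm h)\<^sup>2 \<le> A (W y + h)"
      using sc unfolding semiconvex_def by blast
    have up: "A (W y + h) \<le> A (W y) + (2 * \<Lambda>) * ((W y - y) \<bullet> h) + \<Lambda> * (norm h)\<^sup>2" for h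
    proof -
      have "(norm (y - (W y + h)))\<^sup>2 = (norm (y - W y))\<^sup>2 + 2 * ((W y - y) \<bullet> h) + (norm h)\<^sup>2"
        unfolding power2_norm_eq_inner by (simp add: inner_diff_left inner_diff_right inner_add_left inner_add_right inner_commute)
      then show ?thesis using W[of "W y + h" y] by (simp only:) (simp add: algebra_simps)
    qed
    have "q - (2 * \<Lambda>) *\<^sub>R (W y - y) = 0"
    proof (rule linear_le_quadratic_imp_zero[of 1])
      show "(q - (2 * \<Lambda>) *\<^sub>R (W y - y)) \<bullet> h \<le> (2 * \<Lambda>) * (norm h)\<^sup>2" for h
        using q[of h] up[of h] by (simp add: inner_diff_left algebra_simps)
    qed simp
    then have q_eq: "q = (2 * \<Lambda>) *\<^sub>R (W y - y)" by simp
    have "g y + q \<bullet> h - (\<Lambda> / 2) * (norm h)\<^sup>2 \<le> g (y + h)" for h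
    proof -
      have "A (W y) + q \<bullet> ((1/2) *\<^sub>R h) - \<Lambda> * (norm ((1/2) *\<^sub>R h))\<^sup>2 - \<Lambda> * (norm ((y + h) - (W y + (1/2) *\<^sub>R h)))\<^sup>2 \<le> g (y + h)"
        using q[of "(1/2) *\<^sub>R h"] g_ge[of "W y + (1/2) *\<^sub>R h" "y + h"] by simp
      moreover have "(norm ((y + h) - (W y + (1/2) *\<^sub>R h)))\<^sup>2 = (norm (y - W y))\<^sup>2 - (W y - y) \<bullet> h + (norm h)\<^sup>2 / 4"
        unfolding power2_norm_eq_inner
        by (simp add: inner_diff_left inner_diff_right inner_add_left inner_add_right inner_commute algebra_simps)
      moreover have "(norm ((1/2) *\<^sub>R h))\<^sup>2 = (norm h)\<^sup>2 / 4" by (simp add: power_divide)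
      moreover have "q \<bullet> h = (2 * \<Lambda>) * ((W y - y) \<bullet> h)" unfolding q_eq by simp
      ultimately have "A (W y) + (q \<bullet> h) / 2 - \<Lambda> * ((norm h)\<^sup>2 / 4) - \<Lambda> * ((norm (y - W y))\<^sup>2 - (W y - y) \<bullet> h + (norm h)\<^sup>2 / 4) \<le> g (y + h)"
        and "q \<bullet> h = 2 * (\<Lambda> * ((W y - y) \<bullet> h))"
        by (simp_all only: inner_scaleR_right times_divide_eq_left mult_1_left mult.assoc)
      then show ?thesis unfolding g_def[of y] by (simp add: right_diff_distrib distrib_left del: inner_diff_left)
    qed
    then show ?thesis by blast
  qed
  then have scg: "semiconvex (\<Lambda> / 2) g" unfolding semiconvex_def by blast
  have contg: "continuous_on UNIV g" by (rule semiconvex_imp_continuous[OF scg])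
  have "\<exists>y. \<forall>y'. - (g y' + \<Lambda> * (norm (z - y'))\<^sup>2) \<le> - (g y + \<Lambda> * (norm (z - y))\<^sup>2)" for z
  proof -
    obtain q where q: "\<And>h. g z + q \<bullet> h - (\<Lambda> / 2) * (norm h)\<^sup>2 \<le> g (z + h)"
      using g_low by blast
    show ?thesis
    proof (rule coercive_attains_sup[where k = "\<Lambda> / 2" and z = z and c = "- g z" and q = "- q"])
      show "- (g (z + h) + \<Lambda> * (norm (z - (z + h)))\<^sup>2) \<le> - g z + - q \<bullet> h - \<Lambda> / 2 * (norm h)\<^sup>2" for h
        using q[of h] by simp
    qed (use \<open>0 < \<Lambda>\<close> in \<open>auto intro!: continuous_intros contg\<close>)
  qed
  then obtain Y where Y: "\<And>z y. g (Y z) + \<Lambda> * (norm (z - Y z))\<^sup>2 \<le> g y + \<Lambda> * (norm (z - y))\<^sup>2"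
    by (metis neg_le_iff_le)
  define a where "a z = g (Y z) + \<Lambda> * (norm (z - Y z))\<^sup>2" for z
  define G where "G z = (2 * \<Lambda>) *\<^sub>R (z - Y z)" for z
  have a_le: "a z \<le> g y + \<Lambda> * (norm (z - y))\<^sup>2" for z y
    using Y by (simp add: a_def)
  show thesis
  proof (rule that[of a G])
    show "A z \<le> a z" for z
      using g_ge[of z "Y z"] by (simp add: a_def norm_minus_commute)
    show "\<bar>a (z + h) - a z - G z \<bullet> h\<bar> \<le> \<Lambda> * (norm h)\<^sup>2" for z h
    proof -
      have sq: "(norm (z + h - Y z))\<^sup>2 = (norm (z - Y z))\<^sup>2 + 2 * ((z - Y z) \<bullet> h) + (norm h)\<^sup>2" for h
        unfolding power2_norm_eq_inner by (simp add: inner_diff_left inner_diff_right inner_add_left inner_add_right inner_commute)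
      have up: "a (z + h) \<le> a z + G z \<bullet> h + \<Lambda> * (norm h)\<^sup>2"
        using a_le[of "z + h" "Y z"] unfolding sq by (simp add: a_def G_def algebra_simps)
      have slope: "g (Y z) + G z \<bullet> e - \<Lambda> * (norm e)\<^sup>2 \<le> g (Y z + e)" for e
      proof -
        have "(norm (z - (Y z + e)))\<^sup>2 = (norm (z - Y z))\<^sup>2 - 2 * ((z - Y z) \<bullet> e) + (norm e)\<^sup>2"
          unfolding power2_norm_eq_inner by (simp add: inner_diff_left inner_diff_right inner_add_left inner_add_right inner_commute)
        then show ?thesis using Y[of z "Y z + e"] by (simp only:) (simp add: G_def algebra_simps)
      qed
      \<comment> \<open>With the constant \<Lambda> / 2 the quadratic terms below combine to a
        perfect square; with \<Lambda> they would not.\<close>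
      have slope': "g (Y z) + G z \<bullet> e - (\<Lambda> / 2) * (norm e)\<^sup>2 \<le> g (Y z + e)" for e
        by (rule semiconvex_slope[OF scg slope])
      define y where "y = Y (z + h)"
      define e where "e = y - Y z"
      have "a (z + h) = g y + \<Lambda> * (norm (z + h - y))\<^sup>2" by (simp add: a_def y_def)
      also have "(norm (z + h - y))\<^sup>2 = (norm (z - Y z))\<^sup>2 + 2 * ((z - Y z) \<bullet> (h - e)) + (norm (h - e))\<^sup>2"
      proof -
        have "z + (h - e) - Y z = z + h - y" by (simp add: e_def)
        then show ?thesis using sq[of "h - e"] by metis
      qed
      finally have "a (z + h) \<ge> g (Y z) + G z \<bullet> e - (\<Lambda> / 2) * (norm e)\<^sup>2 + \<Lambda> * ((norm (z - Y z))\<^sup>2 + 2 * ((z - Y z) \<bullet> (h - e)) + (norm (h - e))\<^sup>2)"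
        using slope'[of e] by (simp add: e_def)
      moreover have "\<Lambda> * (norm (h - e))\<^sup>2 - (\<Lambda> / 2) * (norm e)\<^sup>2 + \<Lambda> * (norm h)\<^sup>2 = (\<Lambda> / 2) * (norm (e - 2 *\<^sub>R h))\<^sup>2"
        unfolding power2_norm_eq_inner
        by (simp add: inner_diff_left inner_diff_right inner_commute algebra_simps)
      moreover have "0 \<le> (\<Lambda> / 2) * (norm (e - 2 *\<^sub>R h))\<^sup>2" using \<open>0 < \<Lambda>\<close> by simp
      ultimately have "a z + G z \<bullet> h - \<Lambda> * (norm h)\<^sup>2 \<le> a (z + h)"
        by (simp add: a_def G_def inner_diff_right algebra_simps)
      with up show ?thesis by (simp add: abs_le_iff)
    qed
    fix V z q assume V: "\<And>y. A y \<le> V y" and Vup: "\<And>h. V (z + h) \<le> V z + q \<bullet> h + \<Lambda> * (norm h)\<^sup>2"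
    \<comment> \<open>\<open>y\<close> and \<open>c\<close> are the vertex and the minimum of the
      paraboloid V z + q h + \<Lambda> |h|^2, which lies above \<open>A\<close>.\<close>
    define y where "y = z - (1 / (2 * \<Lambda>)) *\<^sub>R q"
    define c where "c = V z - \<Lambda> * (norm (z - y))\<^sup>2"
    have "A w \<le> c + \<Lambda> * (norm (y - w))\<^sup>2" for w
    proof -
      define h where "h = w - z"
      have "(norm (y - w))\<^sup>2 = (norm (z - y))\<^sup>2 + 2 * ((z - y) \<bullet> h) + (norm h)\<^sup>2"
        unfolding power2_norm_eq_inner h_def by (simp add: inner_diff_left inner_diff_right inner_add_left inner_add_right inner_commute)
      moreover have "\<Lambda> * (2 * ((z - y) \<bullet> h)) = q \<bullet> h"
        using \<open>0 < \<Lambda>\<close> by (simp add: y_def)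
      moreover have "A w \<le> V z + q \<bullet> h + \<Lambda> * (norm h)\<^sup>2"
        using V[of w] Vup[of h] by (simp add: h_def)
      ultimately show ?thesis by (simp add: c_def distrib_left)
    qed
    from this[of "W y"] have "g y \<le> c" by (simp add: g_def)
    then show "a z \<le> V z" using a_le[of z y] by (simp add: c_def)
  qed
qed

lemma lipschitz_gradient_ae_differentiable:
  fixes G :: "'a::euclidean_space \<Rightarrow> 'b::euclidean_space"
  assumes lip: "\<And>x y. norm (G x - G y) \<le> L * norm (x - y)"
  shows "negligible {z. \<not> G differentiable (at z)}"
proof -
  have "\<bar>G x \<bullet> b - G y \<bullet> b\<bar> \<le> L * norm (x - y)" if "b \<in> Basis" for b x y
    using Basis_le_norm[OF that, of "G x - G y"] lip[of x y] by (simp add: inner_diff_left)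
  then have "negligible (\<Union>b\<in>Basis. {z. \<not> (\<lambda>x. G x \<bullet> b) differentiable (at z)})"
    by (intro negligible_Union) (auto intro: rademacher)
  moreover have "{z. \<not> G differentiable (at z)} \<subseteq> (\<Union>b\<in>Basis. {z. \<not> (\<lambda>x. G x \<bullet> b) differentiable (at z)})"
    using differentiable_componentwise_within[of G _ UNIV] by auto
  ultimately show ?thesis by (rule negligible_subset)
qed

text \<open>
  The set \<open>K\<close> of maximum points of all small linear perturbations of \<open>A + B\<close> is not negligible, since the
  slope of the perturbation is a Lipschitz function of the maximum point and covers a ball.
  So the gradient of the hull of \<open>A\<close> is differentiable at some point of \<open>K\<close>, where \<open>A\<close> touches its hull.
\<close>

theorem theorem_on_sums:
  fixes A B :: "'a::euclidean_space \<Rightarrow> real"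
  assumes scA: "semiconvex \<Lambda> A" and scB: "semiconvex \<Lambda> B" and "0 < \<Lambda>"
    and bdd: "\<And>z. A z \<le> C"
    and strict: "\<And>z. A z + B z \<le> A z0 + B z0 - c * (norm (z - z0))\<^sup>2" and "0 < c" and "0 < \<kappa>"
  obtains z P Q L r where "linear L" "\<And>x y. L x \<bullet> y = x \<bullet> L y"
    "norm (z - z0) < \<kappa>" "norm (P + Q) < \<kappa>" "A z0 + B z0 - \<kappa> < A z + B z" "0 < r"
    "\<And>h. norm h < r \<Longrightarrow> A (z + h) \<le> A z + P \<bullet> h + (L h \<bullet> h) / 2 + \<kappa> * (norm h)\<^sup>2"
    "\<And>h. norm h < r \<Longrightarrow> B (z + h) \<le> B z + Q \<bullet> h - (L h \<bullet> h) / 2 + \<kappa> * (norm h)\<^sup>2"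
proof -
  obtain a G where A_le: "\<And>z. A z \<le> a z"
    and C11: "\<And>z h. \<bar>a (z + h) - a z - G z \<bullet> h\<bar> \<le> \<Lambda> * (norm h)\<^sup>2"
    and hull: "\<And>V z q. (\<And>y. A y \<le> V y) \<Longrightarrow> (\<And>h. V (z + h) \<le> V z + q \<bullet> h + \<Lambda> * (norm h)\<^sup>2) \<Longrightarrow> a z \<le> V z"
    apply (rule C11_hull[OF scA \<open>0 < \<Lambda>\<close> bdd])
    subgoal premises hull by (rule that) (fact hull)+
    done
  \<comment> \<open>\<open>\<delta>\<close> bounds the slopes of the perturbations. Being below
    \<kappa> it controls |P + Q|, being below c \<kappa> it keeps z within \<kappa> of z0, and being
    below c it keeps z within 1, which controls the loss of value.\<close>
  define \<delta> where "\<delta> = min \<kappa> (c * min \<kappa> 1) / 2"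
  have \<delta>: "0 < \<delta>" "\<delta> < \<kappa>" "\<delta> < c * \<kappa>" "\<delta> < c"
    using \<open>0 < c\<close> \<open>0 < \<kappa>\<close> by (auto simp: \<delta>_def min_def field_simps split: if_splits)
  define mx where "mx p z \<longleftrightarrow> (\<forall>y. A y + B y + p \<bullet> y \<le> A z + B z + p \<bullet> z)" for p z
  define K where "K = {z. \<exists>p. norm p < \<delta> \<and> mx p z}"
  have "\<forall>z\<in>K. \<exists>q. norm q < \<delta> \<and> mx q z" by (auto simp: K_def)
  from bchoice[OF this] obtain p where p: "\<And>z. z \<in> K \<Longrightarrow> norm (p z) < \<delta>" "\<And>z. z \<in> K \<Longrightarrow> mx (p z) z"
    by blast
  \<comment> \<open>The maximum property places \<open>A\<close> below the function
    \<open>V\<close>, which is a constant minus \<open>B\<close> minus a linear term. Semiconvexity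
    of \<open>B\<close> bounds \<open>V\<close> from above by paraboloids of opening \<Lambda>, so
    minimality puts the hull below \<open>V\<close> as well, and all three agree at
    \<open>z\<close>.\<close>
  have contact: "A z = a z" and B_le: "B y \<le> B z + a z + q \<bullet> (z - y) - a y" if "mx q z" for q y z
  proof -
    define V where "V y = A z + B z + q \<bullet> z - B y - q \<bullet> y" for y
    have AV: "A y \<le> V y" for y using that[unfolded mx_def, rule_format, of y] by (simp add: V_def)
    have aV: "a y \<le> V y" for y
    proof -
      obtain s where s: "\<And>h. B y + s \<bullet> h - \<Lambda> * (norm h)\<^sup>2 \<le> B (y + h)"
        using scB unfolding semiconvex_def by blast
      have "V (y + h) \<le> V y + (- s - q) \<bullet> h + \<Lambda> * (norm h)\<^sup>2" for h
        using s[of h] by (simp add: V_def inner_diff_left inner_add_right)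
      then show ?thesis using hull[OF AV] by blast
    qed
    show az: "A z = a z" using A_le[of z] aV[of z] by (simp add: V_def)
    show "B y \<le> B z + a z + q \<bullet> (z - y) - a y"
      using aV[of y] az by (simp add: V_def inner_diff_right)
  qed
  \<comment> \<open>\<open>B\<close> is bounded above through the hull by \<open>B_le\<close> and
    below by its own semiconvexity; the two slopes must agree.\<close>
  have B_C11: "\<bar>B (z + h) - B z - (- (q + G z)) \<bullet> h\<bar> \<le> \<Lambda> * (norm h)\<^sup>2" if "mx q z" for q z h
  proof -
    have up: "B (z + h) \<le> B z - (q + G z) \<bullet> h + \<Lambda> * (norm h)\<^sup>2" for h
      using B_le[OF that, of "z + h"] C11[of z h] by (simp add: inner_add_left abs_le_iff)
    obtain s where s: "\<And>h. B z + s \<bullet> h - \<Lambda> * (norm h)\<^sup>2 \<le> B (z + h)"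
      using scB unfolding semiconvex_def by blast
    have "s + (q + G z) = 0"
    proof (rule linear_le_quadratic_imp_zero[of 1])
      show "(s + (q + G z)) \<bullet> h \<le> (2 * \<Lambda>) * (norm h)\<^sup>2" for h
        using s[of h] up[of h] by (simp add: inner_add_left)
    qed simp
    then have "s = - (q + G z)" by (rule eq_neg_iff_add_eq_0[THEN iffD2])
    then show ?thesis using s[of h] up[of h] by (simp add: abs_le_iff inner_diff_left inner_add_left)
  qed
  have Glip: "norm (G x - G y) \<le> 6 * \<Lambda> * norm (x - y)" for x y
    by (rule C11_gradient_lipschitz[of a]) (rule C11)+
  \<comment> \<open>The perturbing slope is minus the sum of the slopes of the hull and of
    \<open>B\<close>, each Lipschitz with constant 6 \<Lambda>.\<close>
  have qlip: "norm (q - q') \<le> 12 * \<Lambda> * norm (z - z')" if "mx q z" "mx q' z'" for q q' z z'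
  proof -
    have "norm (- (q + G z) - (- (q' + G z'))) \<le> 6 * \<Lambda> * norm (z - z')"
      by (rule C11_gradient_lipschitz[of B]) (rule B_C11; fact)+
    moreover have "q - q' = - (- (q + G z) - (- (q' + G z'))) - (G z - G z')" by simp
    ultimately show ?thesis
      using norm_triangle_ineq4[of "- (- (q + G z) - (- (q' + G z')))" "G z - G z'"] Glip[of z z'] by (simp only: norm_minus_cancel)
  qed
  have "ball 0 \<delta> \<subseteq> p ` K"
  proof
    fix q :: 'a assume "q \<in> ball 0 \<delta>"
    have "\<exists>z. mx q z"
      unfolding mx_def
    proof (rule coercive_attains_sup[where k = c and z = z0 and c = "A z0 + B z0 + q \<bullet> z0" and q = q])
      show "continuous_on UNIV (\<lambda>y. A y + B y + q \<bullet> y)"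
        by (intro continuous_intros semiconvex_imp_continuous[OF scA] semiconvex_imp_continuous[OF scB])
      show "A (z0 + h) + B (z0 + h) + q \<bullet> (z0 + h) \<le> A z0 + B z0 + q \<bullet> z0 + q \<bullet> h - c * (norm h)\<^sup>2" for h
        using strict[of "z0 + h"] by (simp add: inner_add_right)
    qed fact
    then obtain z where z: "mx q z" by blast
    then have "z \<in> K" using \<open>q \<in> ball 0 \<delta>\<close> by (auto simp: K_def)
    moreover have "p z = q" using qlip[OF p(2)[OF \<open>z \<in> K\<close>] z] by simp
    ultimately show "q \<in> p ` K" by blast
  qed
  moreover have "\<not> negligible (ball (0::'a) \<delta>)"
    using open_not_negligible[of "ball (0::'a) \<delta>"] \<delta>(1) by auto
  ultimately have "\<not> negligible (p ` K)" using negligible_subset by blast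
  moreover have "negligible (p ` K)" if "negligible K"
    by (rule negligible_locally_Lipschitz_image) (use that qlip p in \<open>auto intro!: exI[of _ UNIV] exI[of _ "12 * \<Lambda>"]\<close>)
  ultimately have "\<not> K \<subseteq> {z. \<not> G differentiable (at z)}"
    using negligible_subset[OF lipschitz_gradient_ae_differentiable[OF Glip]] by blast
  then obtain z where "z \<in> K" "G differentiable (at z)" by blast
  then obtain D where D: "(G has_derivative D) (at z)" by (auto simp: differentiable_def)
  then have linD: "linear D" by (rule has_derivative_linear)
  have mz: "mx (p z) z" and pz: "norm (p z) < \<delta>" using p \<open>z \<in> K\<close> by auto
  obtain r where r: "0 < r"
    "\<And>h. norm h < r \<Longrightarrow> \<bar>a (z + h) - a z - G z \<bullet> h - (D h \<bullet> h) / 2\<bar> \<le> \<kappa> * (norm h)\<^sup>2"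
    by (rule C11_second_order_expansion[OF C11 D \<open>0 < \<kappa>\<close>]) (rule that)
  \<comment> \<open>The derivative of the gradient is replaced by its symmetric part, which has the
    same quadratic form.\<close>
  define L where "L h = (1/2) *\<^sub>R (D h + adjoint D h)" for h
  have LD: "L h \<bullet> h = D h \<bullet> h" for h
    by (simp add: L_def inner_add_left adjoint_clauses[OF linD] inner_commute[of h])
  have dist: "c * (norm (z - z0))\<^sup>2 \<le> p z \<bullet> (z - z0)"
    using mz[unfolded mx_def, rule_format, of z0] strict[of z] by (simp add: inner_diff_right)
  also have "\<dots> \<le> norm (p z) * norm (z - z0)" by (rule norm_cauchy_schwarz)
  also have "\<dots> \<le> \<delta> * norm (z - z0)" using pz by (intro mult_right_mono) auto
  finally have "c * norm (z - z0) \<le> \<delta>"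
    by (cases "z = z0") (use \<delta> in \<open>auto simp: power2_eq_square\<close>)
  then have "c * norm (z - z0) < c * \<kappa>" "c * norm (z - z0) < c * 1" using \<delta> by linarith+
  then have nz: "norm (z - z0) < \<kappa>" "norm (z - z0) < 1"
    using \<open>0 < c\<close> mult_less_cancel_left_pos by blast+
  have "p z \<bullet> (z - z0) \<le> norm (p z) * norm (z - z0)" by (rule norm_cauchy_schwarz)
  also have "\<dots> \<le> norm (p z) * 1" using nz by (intro mult_left_mono) auto
  finally have pzz: "p z \<bullet> (z - z0) < \<kappa>" using pz \<delta> by simp
  show thesis
  proof (rule that[of L z "G z" "- (p z + G z)" r])
    show "linear L"
      unfolding L_def by (intro linear_compose_scale_right linear_compose_add linD adjoint_linear)
    show "L x \<bullet> y = x \<bullet> L y" for x y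
      by (simp add: L_def inner_add_left inner_add_right adjoint_clauses[OF linD])
    show "norm (z - z0) < \<kappa>" by fact
    show "norm (G z + - (p z + G z)) < \<kappa>" using pz \<delta> by simp
    show "A z0 + B z0 - \<kappa> < A z + B z"
      using mz[unfolded mx_def, rule_format, of z0] pzz by (simp add: inner_diff_right)
    show "0 < r" by fact
    fix h :: 'a assume h: "norm h < r"
    show "A (z + h) \<le> A z + G z \<bullet> h + (L h \<bullet> h) / 2 + \<kappa> * (norm h)\<^sup>2"
      using r(2)[OF h] A_le[of "z + h"] contact[OF mz] by (simp add: LD abs_le_iff)
    show "B (z + h) \<le> B z + - (p z + G z) \<bullet> h - (L h \<bullet> h) / 2 + \<kappa> * (norm h)\<^sup>2"
      using r(2)[OF h] B_le[OF mz, of "z + h"] by (simp add: LD abs_le_iff inner_diff_left)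
  qed
qed

section \<open>Minimizing hulls and the mean curvature inequality\<close>

definition rank1 :: "'a::euclidean_space \<Rightarrow> 'b::euclidean_space \<Rightarrow> 'b \<Rightarrow>\<^sub>L 'a" where
  "rank1 v u = blinfun_scaleR_left v o\<^sub>L blinfun_inner_right u"

lemma rank1_apply [simp]: "blinfun_apply (rank1 v u) h = (u \<bullet> h) *\<^sub>R v"
  by (simp add: rank1_def)

lemma continuous_on_rank1 [continuous_intros]:
  assumes "continuous_on S f" "continuous_on S g"
  shows "continuous_on S (\<lambda>x. rank1 (f x) (g x))"
  unfolding rank1_def
  by (intro bounded_bilinear.continuous_on[OF bounded_bilinear_blinfun_compose]
      bounded_linear.continuous_on[OF bounded_linear_blinfun_scaleR_left]
      bounded_linear.continuous_on[OF bounded_linear_blinfun_inner_right] assms)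

lemma divergence_rank1: "divergence (\<lambda>x. rank1 (v x) (u x)) x = u x \<bullet> v x"
  by (simp add: divergence_def euclidean_inner[of "u x" "v x"])

lemma divergence_add: "divergence (\<lambda>x. f x + g x) x = divergence f x + divergence g x"
  by (simp add: divergence_def blinfun.add_left inner_add_left sum.distrib)

lemma divergence_diff: "divergence (\<lambda>x. f x - g x) x = divergence f x - divergence g x"
  by (simp add: divergence_def blinfun.diff_left inner_diff_left sum_subtractf)

lemma divergence_scaleR: "divergence (\<lambda>x. m x *\<^sub>R f x) x = m x * divergence f x"
  by (simp add: divergence_def blinfun.scaleR_left sum_distrib_left)

lemma continuous_on_divergence:
  assumes "continuous_on UNIV X'"
  shows "continuous_on UNIV (divergence X')"
  unfolding divergence_def[abs_def] by (intro continuous_intros assms)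

lemma integrable_compact_support:
  fixes f :: "'a::euclidean_space \<Rightarrow> real"
  assumes cont: "continuous_on UNIV f" and "compact K" and zero: "\<And>x. x \<notin> K \<Longrightarrow> f x = 0"
  shows "integrable lborel f"
proof -
  have "integrable lborel (\<lambda>x. indicator K x *\<^sub>R f x)"
    by (rule borel_integrable_compact[OF \<open>compact K\<close> continuous_on_subset[OF cont]]) simp
  moreover have "(\<lambda>x. indicator K x *\<^sub>R f x) = f"
    by (rule ext) (use zero in \<open>auto simp: indicator_def\<close>)
  ultimately show ?thesis by simp
qed

lemma C1c_field_derivative_zero:
  assumes "C1c_field Z Z'" "x \<notin> closure {x. Z x \<noteq> 0}"
  shows "Z' x = 0"
proof -
  have "(Z has_derivative (\<lambda>h. 0)) (at x)"
  proof (rule has_derivative_transform_within_open[of "\<lambda>_. 0" _ _ _ "- closure {x. Z x \<noteq> 0}"])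
    show "\<And>y. y \<in> - closure {x. Z x \<noteq> 0} \<Longrightarrow> 0 = Z y"
      using closure_subset[of "{x. Z x \<noteq> 0}"] by auto
  qed (use assms in auto)
  moreover have "(Z has_derivative blinfun_apply (Z' x)) (at x)"
    using assms(1) by (simp add: C1c_field_def)
  ultimately have "blinfun_apply (Z' x) = (\<lambda>h. 0)"
    using has_derivative_unique by blast
  then show ?thesis by (intro blinfun_eqI) simp
qed

lemma C1c_field_divergence_integrable:
  assumes "C1c_field Z Z'"
  shows "integrable lborel (divergence Z')"
proof (rule integrable_compact_support)
  show "continuous_on UNIV (divergence Z')"
    using assms by (intro continuous_on_divergence) (simp add: C1c_field_def)
  show "compact (closure {x. Z x \<noteq> 0})" using assms by (simp add: C1c_field_def)
  show "\<And>x. x \<notin> closure {x. Z x \<noteq> 0} \<Longrightarrow> divergence Z' x = 0"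
    by (drule C1c_field_derivative_zero[OF assms]) (simp add: divergence_def)
qed

text \<open>Difference quotients have integral zero by translation invariance of Lebesgue measure;
  they are bounded and supported in one compact set, so dominated convergence applies.\<close>

lemma integral_directional_derivative_zero:
  fixes \<psi> :: "'a::euclidean_space \<Rightarrow> real"
  assumes der: "\<And>x. (\<psi> has_derivative D x) (at x)" and cont: "continuous_on UNIV (\<lambda>x. D x b)"
    and "compact K" and supp: "\<And>x. x \<notin> K \<Longrightarrow> \<psi> x = 0" "\<And>x. x \<notin> K \<Longrightarrow> D x b = 0"
  shows "(LINT x|lborel. D x b) = 0"
proof -
  have contpsi: "continuous_on UNIV \<psi>"
    using der by (auto intro: continuous_at_imp_continuous_on has_derivative_continuous)
  have int\<psi>: "integrable lborel \<psi>"
    by (rule integrable_compact_support[OF contpsi \<open>compact K\<close> supp(1)])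
  obtain M where M: "M > 0" "\<And>x. \<bar>D x b\<bar> \<le> M"
  proof -
    have "bounded ((\<lambda>x. D x b) ` K)"
      using \<open>compact K\<close> cont by (intro compact_imp_bounded compact_continuous_image) (auto intro: continuous_on_subset)
    then obtain M where "M > 0" "\<And>x. x \<in> K \<Longrightarrow> \<bar>D x b\<bar> \<le> M" by (auto simp: bounded_pos)
    then show thesis using supp(2) by (intro that[of M]) (metis abs_zero less_imp_le)+
  qed
  define s where "s k x = (\<psi> (x + b /\<^sub>R real (Suc k)) - \<psi> x) * real (Suc k)" for k x
  \<comment> \<open>All quotients are supported in this set, because their step is at most
    |b|.\<close>
  define K1 where "K1 = {y + z |y z. y \<in> K \<and> z \<in> cball (0::'a) (norm b)}"
  have "compact K1" unfolding K1_def by (rule compact_sums) (use \<open>compact K\<close> in auto)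
  have "K \<subseteq> K1" unfolding K1_def by force
  have s_zero: "s k x = 0" if "x \<notin> K1" for k x
  proof -
    have "x + b /\<^sub>R real (Suc k) \<notin> K"
    proof
      assume "x + b /\<^sub>R real (Suc k) \<in> K"
      moreover have "- (b /\<^sub>R real (Suc k)) \<in> cball 0 (norm b)"
        by (simp add: mult_left_le_one_le inverse_le_1_iff)
      ultimately have "(x + b /\<^sub>R real (Suc k)) + - (b /\<^sub>R real (Suc k)) \<in> K1" unfolding K1_def by blast
      then show False using that by simp
    qed
    moreover have "x \<notin> K" using that \<open>K \<subseteq> K1\<close> by blast
    ultimately show ?thesis using supp(1) by (simp add: s_def)
  qed
  have s_bound: "\<bar>s k x\<bar> \<le> M" for k x
  proof -
    define t where "t = 1 / real (Suc k)"
    have "t > 0" by (simp add: t_def)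
    have d: "((\<lambda>\<tau>. \<psi> (x + \<tau> *\<^sub>R b)) has_real_derivative D (x + \<tau> *\<^sub>R b) b) (at \<tau>)" for \<tau>
    proof -
      have "((\<lambda>\<tau>. \<psi> (x + \<tau> *\<^sub>R b)) has_derivative (\<lambda>\<sigma>. D (x + \<tau> *\<^sub>R b) (\<sigma> *\<^sub>R b))) (at \<tau>)"
        by (rule has_derivative_compose[OF _ der]) (auto intro!: derivative_eq_intros)
      then show ?thesis
        unfolding has_field_derivative_def
        by (rule has_derivative_eq_rhs) (auto simp: linear_scale[OF has_derivative_linear[OF der]])
    qed
    obtain \<tau> where "\<psi> (x + t *\<^sub>R b) - \<psi> (x + 0 *\<^sub>R b) = (t - 0) * D (x + \<tau> *\<^sub>R b) b"
      using MVT2[OF \<open>t > 0\<close>, of "\<lambda>\<tau>. \<psi> (x + \<tau> *\<^sub>R b)", OF d] by blast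
    then have "s k x = D (x + \<tau> *\<^sub>R b) b"
      by (simp add: s_def t_def field_simps)
    then show ?thesis using M by simp
  qed
  have s_lim: "(\<lambda>k. s k x) \<longlonglongrightarrow> D x b" for x
  proof -
    have "((\<lambda>\<tau>. \<psi> (x + \<tau> *\<^sub>R b)) has_derivative (\<lambda>\<sigma>. D x (\<sigma> *\<^sub>R b))) (at 0)"
      using der[of x] by (intro has_derivative_compose[where g = \<psi> and g' = "D x" and f = "\<lambda>\<tau>. x + \<tau> *\<^sub>R b"]) (auto intro!: derivative_eq_intros)
    then have "((\<lambda>\<tau>. \<psi> (x + \<tau> *\<^sub>R b)) has_real_derivative D x b) (at 0)"
      unfolding has_field_derivative_def
      by (rule has_derivative_eq_rhs) (auto simp: linear_scale[OF has_derivative_linear[OF der]])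
    then have "((\<lambda>\<tau>. (\<psi> (x + \<tau> *\<^sub>R b) - \<psi> x) / \<tau>) \<longlongrightarrow> D x b) (at 0)"
      by (simp add: has_field_derivative_iff)
    moreover have "filterlim (\<lambda>k. inverse (real (Suc k))) (at 0) sequentially"
      by (intro filterlim_atI LIMSEQ_inverse_real_of_nat) auto
    ultimately have "((\<lambda>k. (\<psi> (x + inverse (real (Suc k)) *\<^sub>R b) - \<psi> x) / inverse (real (Suc k))) \<longlongrightarrow> D x b) sequentially"
      by (rule filterlim_compose)
    then show ?thesis by (simp add: s_def divide_inverse)
  qed
  have s_int: "(LINT x|lborel. s k x) = 0" for k
  proof -
    let ?c = "b /\<^sub>R real (Suc k)"
    have i: "integrable lborel (\<lambda>x. \<psi> (?c + x))"
    proof -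
      have "integrable (distr lborel borel ((+) ?c)) \<psi>" using int\<psi> by (simp add: lborel_distr_plus)
      then show ?thesis by (simp add: integrable_distr_eq borel_measurable_continuous_onI[OF contpsi])
    qed
    have "(LINT x|lborel. \<psi> (?c + x)) = (LINT x|distr lborel borel ((+) ?c). \<psi> x)"
      by (simp add: integral_distr borel_measurable_continuous_onI[OF contpsi])
    also have "\<dots> = (LINT x|lborel. \<psi> x)" by (simp add: lborel_distr_plus)
    finally have "(LINT x|lborel. \<psi> (?c + x) - \<psi> x) = 0"
      using i int\<psi> by simp
    then show ?thesis by (simp add: s_def add.commute)
  qed
  have "(\<lambda>k. (LINT x|lborel. s k x)) \<longlonglongrightarrow> (LINT x|lborel. D x b)"
  proof (rule integral_dominated_convergence[where w = "\<lambda>x. M * indicator K1 x"])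
    show "integrable lborel (\<lambda>x. M * indicator K1 x)"
      using \<open>compact K1\<close> by (auto intro!: integrable_mult_right integrable_real_indicator emeasure_compact_finite simp: borel_compact)
    show "AE x in lborel. norm (s k x) \<le> M * indicator K1 x" for k
      using s_zero s_bound M(1) by (intro AE_I2) (auto simp: indicator_def)
    show "s k \<in> borel_measurable lborel" for k
    proof -
      have [measurable]: "\<psi> \<in> borel_measurable borel" by (rule borel_measurable_continuous_onI[OF contpsi])
      show ?thesis unfolding s_def by measurable
    qed
    show "(\<lambda>x. D x b) \<in> borel_measurable lborel"
      using borel_measurable_continuous_onI[OF cont] by simp
    show "AE x in lborel. (\<lambda>k. s k x) \<longlonglongrightarrow> D x b" by (rule AE_I2) (rule s_lim)
  qed
  then have "(\<lambda>k. 0::real) \<longlonglongrightarrow> (LINT x|lborel. D x b)" by (simp only: s_int)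
  then show ?thesis using LIMSEQ_unique[OF tendsto_const] by metis
qed

lemma integral_divergence_zero:
  assumes "C1c_field Z Z'"
  shows "(LINT x|lborel. divergence Z' x) = 0"
proof -
  let ?K = "closure {x. Z x \<noteq> 0}"
  have Z: "(Z has_derivative blinfun_apply (Z' x)) (at x)" "continuous_on UNIV Z'" "compact ?K" for x
    using assms unfolding C1c_field_def by blast+
  have Z'0: "x \<notin> ?K \<Longrightarrow> Z' x = 0" for x by (rule C1c_field_derivative_zero[OF assms])
  have Z0: "Z x = 0" if "x \<notin> ?K" for x
    using that closure_subset[of "{x. Z x \<noteq> 0}"] by blast
  have cont: "continuous_on UNIV (\<lambda>x. blinfun_apply (Z' x) b \<bullet> b)" for b
    by (intro continuous_intros Z(2))
  have int: "integrable lborel (\<lambda>x. blinfun_apply (Z' x) b \<bullet> b)" for b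
    by (rule integrable_compact_support[OF cont Z(3)]) (drule Z'0, simp)
  have "(LINT x|lborel. blinfun_apply (Z' x) b \<bullet> b) = 0" for b
  proof (rule integral_directional_derivative_zero[where \<psi> = "\<lambda>x. Z x \<bullet> b" and D = "\<lambda>x h. blinfun_apply (Z' x) h \<bullet> b", OF _ cont Z(3)])
    show "((\<lambda>x. Z x \<bullet> b) has_derivative (\<lambda>h. blinfun_apply (Z' x) h \<bullet> b)) (at x)" for x
      by (rule has_derivative_inner_left[OF Z(1)])
    show "Z x \<bullet> b = 0" if "x \<notin> ?K" for x using Z0[OF that] by simp
    show "blinfun_apply (Z' x) b \<bullet> b = 0" if "x \<notin> ?K" for x using Z'0[OF that] by simp
  qed
  then show ?thesis
    unfolding divergence_def by (subst Bochner_Integration.integral_sum) (auto simp: int)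
qed

lemma C1c_field_add:
  assumes "C1c_field X X'" "C1c_field Z Z'"
  shows "C1c_field (\<lambda>x. X x + Z x) (\<lambda>x. X' x + Z' x)"
  unfolding C1c_field_def
proof (intro conjI allI)
  show "((\<lambda>x. X x + Z x) has_derivative blinfun_apply (X' x + Z' x)) (at x)" for x
  proof -
    have "((\<lambda>x. X x + Z x) has_derivative (\<lambda>h. blinfun_apply (X' x) h + blinfun_apply (Z' x) h)) (at x)"
      using assms unfolding C1c_field_def by (intro has_derivative_add) blast+
    then show ?thesis by (rule has_derivative_eq_rhs) (simp add: blinfun.add_left fun_eq_iff)
  qed
  show "continuous_on UNIV (\<lambda>x. X' x + Z' x)"
    using assms unfolding C1c_field_def by (intro continuous_on_add) blast+
  have "bounded ({x. X x \<noteq> 0} \<union> {x. Z x \<noteq> 0})"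
    using assms unfolding C1c_field_def bounded_Un compact_closure by blast
  then show "compact (closure {x. X x + Z x \<noteq> 0})"
    unfolding compact_closure by (rule bounded_subset) auto
qed

lemma C1c_field_lebesgue_integrable:
  assumes "C1c_field Z Z'"
  shows "integrable lebesgue (divergence Z')"
proof -
  have "continuous_on UNIV (divergence Z')"
    using assms by (intro continuous_on_divergence) (simp add: C1c_field_def)
  then have "divergence Z' \<in> borel_measurable lborel"
    using borel_measurable_continuous_onI by simp
  then show ?thesis
    using integrable_completion C1c_field_divergence_integrable[OF assms] by blast
qed

text \<open>
  Any competitor \<open>X\<close> for \<open>Per F\<close> is deformed into \<open>X + m k (\<nu> - X)\<close>, which has the same flux through the boundary
  of \<open>F\<close> because \<open>m k\<close> vanishes outside \<open>F\<close>, and which tends to \<open>\<nu>\<close> on \<open>F - E\<close>.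
\<close>

lemma Per_calibration:
  fixes E F :: "'a::euclidean_space set" and \<nu> :: "'a \<Rightarrow> 'a" and m :: "nat \<Rightarrow> 'a \<Rightarrow> real"
  assumes sets: "E \<in> sets lebesgue" "F \<in> sets lebesgue" and "E \<subseteq> F" and "bounded (F - E)"
    and \<nu>: "\<And>x. (\<nu> has_derivative blinfun_apply (\<nu>' x)) (at x)" "continuous_on UNIV \<nu>'" "\<And>x. norm (\<nu> x) \<le> 1"
    and m: "\<And>k x. (m k has_derivative (\<lambda>h. Dm k x \<bullet> h)) (at x)" "\<And>k. continuous_on UNIV (Dm k)"
      "\<And>k x. 0 \<le> m k x" "\<And>k x. m k x \<le> 1" "compact K" "\<And>k x. x \<notin> K \<Longrightarrow> m k x = 0"
    and out: "\<And>k x. x \<notin> F \<Longrightarrow> m k x = 0" "\<And>k x. x \<notin> F \<Longrightarrow> Dm k x = 0"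
    and sign: "\<And>k x v. x \<in> F - E \<Longrightarrow> norm v \<le> 1 \<Longrightarrow> Dm k x \<bullet> (\<nu> x - v) \<le> 0"
    and lim: "\<And>x. x \<in> F - E \<Longrightarrow> (\<lambda>k. m k x) \<longlonglongrightarrow> 1"
  shows "Per F \<le> Per E + ereal (LINT x:F - E|lebesgue. divergence \<nu>' x)"
  unfolding Per_def[of F]
proof (rule SUP_least, clarify)
  fix X :: "'a \<Rightarrow> 'a" and X' assume X: "C1c_field X X'" and X1: "\<forall>x. norm (X x) \<le> 1"
  have Xd: "(X has_derivative blinfun_apply (X' x)) (at x)" and contX': "continuous_on UNIV X'" for x
    using X unfolding C1c_field_def by blast+
  have contX: "continuous_on UNIV X"
    using Xd by (auto intro: continuous_at_imp_continuous_on has_derivative_continuous)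
  have cont\<nu>: "continuous_on UNIV \<nu>"
    using \<nu>(1) by (auto intro: continuous_at_imp_continuous_on has_derivative_continuous)
  have contm: "continuous_on UNIV (m k)" for k
    using m(1) by (auto intro: continuous_at_imp_continuous_on has_derivative_continuous)
  define Z where "Z k x = m k x *\<^sub>R (\<nu> x - X x)" for k x
  define Z' where "Z' k x = rank1 (\<nu> x - X x) (Dm k x) + m k x *\<^sub>R (\<nu>' x - X' x)" for k x
  define Y' where "Y' k x = X' x + Z' k x" for k x
  have Z: "C1c_field (Z k) (Z' k)" for k
    unfolding C1c_field_def
  proof (intro conjI allI)
    fix x
    have "((\<lambda>x. m k x *\<^sub>R (\<nu> x - X x)) has_derivative
       (\<lambda>h. m k x *\<^sub>R (blinfun_apply (\<nu>' x) h - blinfun_apply (X' x) h) + (Dm k x \<bullet> h) *\<^sub>R (\<nu> x - X x))) (at x)"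
      by (intro has_derivative_scaleR has_derivative_diff m \<nu> Xd)
    then show "(Z k has_derivative blinfun_apply (Z' k x)) (at x)"
      unfolding Z_def Z'_def
      by (rule has_derivative_eq_rhs) (simp add: fun_eq_iff blinfun.add_left blinfun.diff_left blinfun.scaleR_left)
    show "continuous_on UNIV (Z' k)"
      unfolding Z'_def by (intro continuous_intros cont\<nu> contX contm m(2) \<nu>(2) contX')
    have "{x. Z k x \<noteq> 0} \<subseteq> K"
      using m(6) by (auto simp: Z_def)
    then show "compact (closure {x. Z k x \<noteq> 0})"
      unfolding compact_closure by (rule bounded_subset[OF compact_imp_bounded[OF m(5)]])
  qed
  have Y: "C1c_field (\<lambda>x. X x + Z k x) (Y' k)" for k
    unfolding Y'_def[abs_def] by (rule C1c_field_add[OF X Z])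
  have Y1: "norm (X x + Z k x) \<le> 1" for k x
  proof -
    have "X x + Z k x = (1 - m k x) *\<^sub>R X x + m k x *\<^sub>R \<nu> x" by (simp add: Z_def algebra_simps)
    also have "norm \<dots> \<le> (1 - m k x) * norm (X x) + m k x * norm (\<nu> x)"
      using norm_triangle_ineq[of "(1 - m k x) *\<^sub>R X x" "m k x *\<^sub>R \<nu> x"] m(3)[of k x] m(4)[of k x] by simp
    also have "\<dots> \<le> (1 - m k x) * 1 + m k x * 1"
      using X1 \<nu>(3) m(3)[of k x] m(4)[of k x] by (intro add_mono mult_left_mono) auto
    finally show ?thesis by simp
  qed
  have divZ: "divergence (Z' k) x = Dm k x \<bullet> (\<nu> x - X x) + m k x * (divergence \<nu>' x - divergence X' x)" for k x
    unfolding Z'_def divergence_add divergence_rank1 divergence_scaleR divergence_diff by simp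
  have intX: "integrable lebesgue (divergence X')" by (rule C1c_field_lebesgue_integrable[OF X])
  have intZ: "integrable lebesgue (divergence (Z' k))" for k by (rule C1c_field_lebesgue_integrable[OF Z])
  have intY: "integrable lebesgue (divergence (Y' k))" for k by (rule C1c_field_lebesgue_integrable[OF Y])
  have si: "integrable lebesgue (\<lambda>x. indicator S x *\<^sub>R f x)" if "integrable lebesgue f" "S \<in> sets lebesgue" for f :: "'a \<Rightarrow> real" and S
    using integrable_mult_indicator[OF that(2,1)] .
  have FE: "F - E \<in> sets lebesgue" using sets by blast
  \<comment> \<open>The correction and its divergence vanish outside \<open>F\<close>, so
    integrating over \<open>F\<close> is integrating over the whole space; the boundary of
    \<open>F\<close> does not enter.\<close>
  have Z0: "(LINT x:F|lebesgue. divergence (Z' k) x) = 0" for k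
  proof -
    have "(LINT x:F|lebesgue. divergence (Z' k) x) = (LINT x|lebesgue. divergence (Z' k) x)"
      unfolding set_lebesgue_integral_def using out by (intro Bochner_Integration.integral_cong) (auto simp: indicator_def divZ)
    also have "\<dots> = (LINT x|lborel. divergence (Z' k) x)"
    proof (rule integral_completion)
      show "divergence (Z' k) \<in> borel_measurable lborel"
        using C1c_field_divergence_integrable[OF Z] by (rule borel_measurable_integrable)
    qed
    also have "\<dots> = 0" by (rule integral_divergence_zero[OF Z])
    finally show ?thesis .
  qed
  have XY: "(LINT x:F|lebesgue. divergence X' x) = (LINT x:E|lebesgue. divergence (Y' k) x) + (LINT x:F - E|lebesgue. divergence (Y' k) x)" for k
  proof -
    have "(LINT x:F|lebesgue. divergence (Y' k) x) = (LINT x:F|lebesgue. divergence X' x) + (LINT x:F|lebesgue. divergence (Z' k) x)"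
      unfolding Y'_def divergence_add set_lebesgue_integral_def scaleR_add_right
      by (intro Bochner_Integration.integral_add si intX intZ sets)
    moreover have "(LINT x:F|lebesgue. divergence (Y' k) x) = (LINT x:E|lebesgue. divergence (Y' k) x) + (LINT x:F - E|lebesgue. divergence (Y' k) x)"
    proof -
      have "(LINT x|lebesgue. indicator F x *\<^sub>R divergence (Y' k) x) = (LINT x|lebesgue. indicator E x *\<^sub>R divergence (Y' k) x + indicator (F - E) x *\<^sub>R divergence (Y' k) x)"
        using \<open>E \<subseteq> F\<close> by (intro Bochner_Integration.integral_cong) (auto simp: indicator_def)
      also have "\<dots> = (LINT x|lebesgue. indicator E x *\<^sub>R divergence (Y' k) x) + (LINT x|lebesgue. indicator (F - E) x *\<^sub>R divergence (Y' k) x)"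
        by (intro Bochner_Integration.integral_add si intY sets FE)
      finally show ?thesis unfolding set_lebesgue_integral_def .
    qed
    ultimately show ?thesis using Z0[of k] by simp
  qed
  obtain b where FEb: "F - E \<subseteq> cbox (-b) b"
    using bounded_subset_cbox_symmetric[OF \<open>bounded (F - E)\<close>] by blast
  have int\<nu>: "integrable lebesgue (\<lambda>x. indicator (F - E) x *\<^sub>R divergence \<nu>' x)"
  proof -
    have c: "continuous_on UNIV (divergence \<nu>')" by (rule continuous_on_divergence[OF \<nu>(2)])
    have "integrable lborel (\<lambda>x. indicator (cbox (-b) b) x *\<^sub>R divergence \<nu>' x)"
      by (rule borel_integrable_compact[OF compact_cbox continuous_on_subset[OF c]]) simp
    moreover have "(\<lambda>x. indicator (cbox (-b) b) x *\<^sub>R divergence \<nu>' x) \<in> borel_measurable lborel"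
      using borel_measurable_continuous_onI[OF c] by simp
    ultimately have "integrable lebesgue (\<lambda>x. indicator (cbox (-b) b) x *\<^sub>R divergence \<nu>' x)"
      using integrable_completion by blast
    from si[OF this FE] show ?thesis
      by (rule back_subst[of "integrable lebesgue"]) (use FEb in \<open>auto simp: indicator_def fun_eq_iff\<close>)
  qed
  \<comment> \<open>\<open>I k\<close> is the integral that remains after the gradient term of
    \<open>m k\<close> is dropped by \<open>sign\<close>; in the limit only the divergence of
    \<open>\<nu>\<close> survives.\<close>
  define I where "I k = (LINT x|lebesgue. indicator (F - E) x *\<^sub>R ((1 - m k x) * divergence X' x + m k x * divergence \<nu>' x))" for k
  have mmeas: "m k \<in> borel_measurable lebesgue" for k
    using borel_measurable_continuous_onI[OF contm] by (intro measurable_completion) simp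
  have intI: "integrable lebesgue (\<lambda>x. indicator (F - E) x *\<^sub>R ((1 - m k x) * divergence X' x + m k x * divergence \<nu>' x))" for k
  proof (rule Bochner_Integration.integrable_bound)
    show "integrable lebesgue (\<lambda>x. \<bar>indicator (F - E) x *\<^sub>R divergence X' x\<bar> + \<bar>indicator (F - E) x *\<^sub>R divergence \<nu>' x\<bar>)"
      by (intro Bochner_Integration.integrable_add integrable_abs si intX int\<nu> FE)
    have eq: "(\<lambda>x. indicator (F - E) x *\<^sub>R ((1 - m k x) * divergence X' x + m k x * divergence \<nu>' x))
       = (\<lambda>x. (1 - m k x) * (indicator (F - E) x *\<^sub>R divergence X' x) + m k x * (indicator (F - E) x *\<^sub>R divergence \<nu>' x))"
      by (auto simp: algebra_simps)
    show "(\<lambda>x. indicator (F - E) x *\<^sub>R ((1 - m k x) * divergence X' x + m k x * divergence \<nu>' x)) \<in> borel_measurable lebesgue"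
      unfolding eq
      by (intro borel_measurable_add borel_measurable_times borel_measurable_diff borel_measurable_const mmeas
          borel_measurable_integrable[OF int\<nu>] borel_measurable_integrable[OF si[OF intX FE]])
    show "AE x in lebesgue. norm (indicator (F - E) x *\<^sub>R ((1 - m k x) * divergence X' x + m k x * divergence \<nu>' x))
         \<le> norm (\<bar>indicator (F - E) x *\<^sub>R divergence X' x\<bar> + \<bar>indicator (F - E) x *\<^sub>R divergence \<nu>' x\<bar>)"
    proof (rule AE_I2)
      fix x
      have "\<bar>(1 - m k x) * divergence X' x + m k x * divergence \<nu>' x\<bar> \<le> (1 - m k x) * \<bar>divergence X' x\<bar> + m k x * \<bar>divergence \<nu>' x\<bar>"
        using abs_triangle_ineq[of "(1 - m k x) * divergence X' x" "m k x * divergence \<nu>' x"] m(3)[of k x] m(4)[of k x]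
        by (simp add: abs_mult)
      also have "\<dots> \<le> \<bar>divergence X' x\<bar> + \<bar>divergence \<nu>' x\<bar>"
        using m(3)[of k x] m(4)[of k x] by (intro add_mono mult_left_le_one_le) auto
      finally show "norm (indicator (F - E) x *\<^sub>R ((1 - m k x) * divergence X' x + m k x * divergence \<nu>' x))
         \<le> norm (\<bar>indicator (F - E) x *\<^sub>R divergence X' x\<bar> + \<bar>indicator (F - E) x *\<^sub>R divergence \<nu>' x\<bar>)"
        by (cases "x \<in> F - E") simp_all
    qed
  qed
  have Ile: "(LINT x:F - E|lebesgue. divergence (Y' k) x) \<le> I k" for k
    unfolding set_lebesgue_integral_def I_def
  proof (rule integral_mono[OF si[OF intY FE] intI])
    fix x
    show "indicator (F - E) x *\<^sub>R divergence (Y' k) x \<le> indicator (F - E) x *\<^sub>R ((1 - m k x) * divergence X' x + m k x * divergence \<nu>' x)"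
    proof (cases "x \<in> F - E")
      case True
      then show ?thesis
      proof -
        have "divergence (Y' k) x = divergence X' x + (Dm k x \<bullet> (\<nu> x - X x) + m k x * (divergence \<nu>' x - divergence X' x))"
          unfolding Y'_def divergence_add divZ ..
        then show ?thesis
          using True sign[OF True X1[rule_format], of k x] by (simp add: algebra_simps)
      qed
    qed simp
  qed
  have Ilim: "I \<longlonglongrightarrow> (LINT x:F - E|lebesgue. divergence \<nu>' x)"
    unfolding I_def set_lebesgue_integral_def
  proof (rule integral_dominated_convergence)
    show "integrable lebesgue (\<lambda>x. \<bar>indicator (F - E) x *\<^sub>R divergence X' x\<bar> + \<bar>indicator (F - E) x *\<^sub>R divergence \<nu>' x\<bar>)"
      by (intro Bochner_Integration.integrable_add integrable_abs si intX int\<nu> FE)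
    show "(\<lambda>x. indicator (F - E) x *\<^sub>R divergence \<nu>' x) \<in> borel_measurable lebesgue"
      using int\<nu> by (rule borel_measurable_integrable)
    show "(\<lambda>x. indicator (F - E) x *\<^sub>R ((1 - m k x) * divergence X' x + m k x * divergence \<nu>' x)) \<in> borel_measurable lebesgue" for k
      using intI by (rule borel_measurable_integrable)
    show "AE x in lebesgue. (\<lambda>k. indicator (F - E) x *\<^sub>R ((1 - m k x) * divergence X' x + m k x * divergence \<nu>' x)) \<longlonglongrightarrow> indicator (F - E) x *\<^sub>R divergence \<nu>' x"
    proof (rule AE_I2)
      fix x
      show "(\<lambda>k. indicator (F - E) x *\<^sub>R ((1 - m k x) * divergence X' x + m k x * divergence \<nu>' x)) \<longlonglongrightarrow> indicator (F - E) x *\<^sub>R divergence \<nu>' x"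
      proof (cases "x \<in> F - E")
        case True
        have "(\<lambda>k. (1 - m k x) * divergence X' x + m k x * divergence \<nu>' x) \<longlonglongrightarrow> (1 - 1) * divergence X' x + 1 * divergence \<nu>' x"
          by (intro tendsto_intros lim[OF True])
        with True show ?thesis by simp
      qed simp
    qed
    show "AE x in lebesgue. norm (indicator (F - E) x *\<^sub>R ((1 - m k x) * divergence X' x + m k x * divergence \<nu>' x))
         \<le> \<bar>indicator (F - E) x *\<^sub>R divergence X' x\<bar> + \<bar>indicator (F - E) x *\<^sub>R divergence \<nu>' x\<bar>" for k
    proof (rule AE_I2)
      fix x
      have "\<bar>(1 - m k x) * divergence X' x + m k x * divergence \<nu>' x\<bar> \<le> (1 - m k x) * \<bar>divergence X' x\<bar> + m k x * \<bar>divergence \<nu>' x\<bar>"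
        using abs_triangle_ineq[of "(1 - m k x) * divergence X' x" "m k x * divergence \<nu>' x"] m(3)[of k x] m(4)[of k x]
        by (simp add: abs_mult)
      also have "\<dots> \<le> \<bar>divergence X' x\<bar> + \<bar>divergence \<nu>' x\<bar>"
        using m(3)[of k x] m(4)[of k x] by (intro add_mono mult_left_le_one_le) auto
      finally show "norm (indicator (F - E) x *\<^sub>R ((1 - m k x) * divergence X' x + m k x * divergence \<nu>' x))
         \<le> \<bar>indicator (F - E) x *\<^sub>R divergence X' x\<bar> + \<bar>indicator (F - E) x *\<^sub>R divergence \<nu>' x\<bar>"
        by (cases "x \<in> F - E") simp_all
    qed
  qed
  \<comment> \<open>The deformed field is a convex combination of \<open>X\<close> and
    \<open>\<nu>\<close>, hence still admissible in the supremum defining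
    \<open>Per E\<close>.\<close>
  have E_le: "ereal (LINT x:E|lebesgue. divergence (Y' k) x) \<le> Per E" for k
    unfolding Per_def using Y[of k] Y1[of _ k]
    by (intro SUP_upper2[of "(\<lambda>x. X x + Z k x, Y' k)"]) auto
  show "ereal (LINT x:F|lebesgue. divergence X' x) \<le> Per E + ereal (LINT x:F - E|lebesgue. divergence \<nu>' x)"
  proof (cases "Per E")
    case (real p)
    have "(LINT x:F|lebesgue. divergence X' x) \<le> p + I k" for k
      using XY[of k] E_le[of k] Ile[of k] real by simp
    then have "(LINT x:F|lebesgue. divergence X' x) \<le> p + (LINT x:F - E|lebesgue. divergence \<nu>' x)"
      by (intro LIMSEQ_le_const[OF tendsto_add[OF tendsto_const Ilim]]) auto
    then show ?thesis using real by simp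
  next
    case MInf
    then show ?thesis using E_le[of 0] by simp
  qed simp
qed

section \<open>C1 functions built from squared positive parts\<close>

lemma max0_square_derivative:
  "((\<lambda>t::real. (max 0 t)\<^sup>2) has_real_derivative 2 * max 0 t) (at t)"
proof -
  consider "t < 0" | "t = 0" | "0 < t" by linarith
  then show ?thesis
  proof cases
    case 1
    have "((\<lambda>t::real. 0) has_real_derivative 0) (at t)" by simp
    then have "((\<lambda>t::real. (max 0 t)\<^sup>2) has_real_derivative 0) (at t)"
      by (rule has_field_derivative_transform_within_open[of _ _ _ "{..<0}"]) (use 1 in auto)
    then show ?thesis using 1 by simp
  next
    case 2
    have "((\<lambda>t::real. (max 0 t)\<^sup>2) has_derivative (\<lambda>h. 0)) (at 0)"
      unfolding has_derivative_at_alt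
    proof (intro conjI allI impI bounded_linear_zero)
      fix e :: real assume "e > 0"
      have "norm ((max 0 y)\<^sup>2 - (max 0 0)\<^sup>2 - 0) \<le> e * norm (y - 0)" if "norm (y - 0) < e" for y :: real
      proof -
        have "(max 0 y)\<^sup>2 \<le> \<bar>y\<bar> * \<bar>y\<bar>" by (simp add: max_def power2_eq_square)
        also have "\<dots> \<le> e * \<bar>y\<bar>" using that by (intro mult_right_mono) auto
        finally show ?thesis by simp
      qed
      then show "\<exists>d>0. \<forall>y::real. norm (y - 0) < d \<longrightarrow> norm ((max 0 y)\<^sup>2 - (max 0 0)\<^sup>2 - 0) \<le> e * norm (y - 0)"
        using \<open>e > 0\<close> by (intro exI[of _ e]) simp
    qed
    then show ?thesis using 2 unfolding has_field_derivative_def by (auto elim!: has_derivative_eq_rhs)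
  next
    case 3
    have "((\<lambda>t::real. t\<^sup>2) has_real_derivative 2 * t) (at t)" by (auto intro!: derivative_eq_intros)
    then have "((\<lambda>t::real. (max 0 t)\<^sup>2) has_real_derivative 2 * t) (at t)"
      by (rule has_field_derivative_transform_within_open[of _ _ _ "{0<..}"]) (use 3 in auto)
    then show ?thesis using 3 by simp
  qed
qed

lemma max0_square_compose_derivative:
  assumes "(f has_real_derivative f') (at s)"
  shows "((\<lambda>s. (max 0 (f s))\<^sup>2) has_real_derivative 2 * max 0 (f s) * f') (at s)"
  using DERIV_chain'[OF assms max0_square_derivative] by (simp add: mult_ac)

lemma gradient_chain:
  assumes "(f has_derivative (\<lambda>h. u \<bullet> h)) (at x)" "(g has_real_derivative d) (at (f x))"
  shows "((\<lambda>x. g (f x)) has_derivative (\<lambda>h. (d *\<^sub>R u) \<bullet> h)) (at x)"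
  using has_derivative_compose[OF assms(1) assms(2)[unfolded has_field_derivative_def]] by simp

lemma norm_sq_derivative:
  "((\<lambda>x. (norm (x - c))\<^sup>2) has_derivative (\<lambda>h. (2 *\<^sub>R (x - c)) \<bullet> h)) (at (x::'a::euclidean_space))"
  unfolding power2_norm_eq_inner
  by (auto intro!: derivative_eq_intros simp: inner_commute)

text \<open>The cutoff is A / (A + B) in terms of the squared distance, where \<open>A\<close>
  vanishes beyond \<open>r2\<close>, \<open>B\<close> vanishes within \<open>r1\<close>, and both
  never vanish together.\<close>

lemma smooth_cutoff:
  fixes x0 :: "'a::euclidean_space"
  assumes "0 < r1" "r1 < r2"
  obtains \<theta> D\<theta> where "\<And>x. (\<theta> has_derivative (\<lambda>h. D\<theta> x \<bullet> h)) (at x)" "continuous_on UNIV D\<theta>"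
    "\<And>x. 0 \<le> \<theta> x" "\<And>x. \<theta> x \<le> 1"
    "\<And>x. dist x0 x < r1 \<Longrightarrow> \<theta> x = 1" "\<And>x. dist x0 x < r1 \<Longrightarrow> D\<theta> x = 0"
    "\<And>x. r2 \<le> dist x0 x \<Longrightarrow> \<theta> x = 0" "\<And>x. r2 \<le> dist x0 x \<Longrightarrow> D\<theta> x = 0"
proof -
  define A where "A s = (max 0 (r2\<^sup>2 - s))\<^sup>2" for s :: real
  define B where "B s = (max 0 (s - r1\<^sup>2))\<^sup>2" for s :: real
  define A' where "A' s = - (2 * max 0 (r2\<^sup>2 - s))" for s :: real
  define B' where "B' s = 2 * max 0 (s - r1\<^sup>2)" for s :: real
  have "r1\<^sup>2 < r2\<^sup>2" using assms by (intro power_strict_mono) auto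
  have pos: "A s + B s > 0" for s
  proof (cases "s < r2\<^sup>2")
    case True
    then have "A s > 0" by (simp add: A_def)
    then show ?thesis by (simp add: B_def add_pos_nonneg)
  next
    case False
    then have "B s > 0" using \<open>r1\<^sup>2 < r2\<^sup>2\<close> by (simp add: B_def)
    then show ?thesis by (simp add: A_def add_nonneg_pos)
  qed
  have dA: "(A has_real_derivative A' s) (at s)" for s
  proof -
    have "((\<lambda>s. r2\<^sup>2 - s) has_real_derivative - 1) (at s)" by (auto intro!: derivative_eq_intros)
    from max0_square_compose_derivative[OF this] show ?thesis by (simp add: A_def[abs_def] A'_def)
  qed
  have dB: "(B has_real_derivative B' s) (at s)" for s
  proof -
    have "((\<lambda>s. s - r1\<^sup>2) has_real_derivative 1) (at s)" by (auto intro!: derivative_eq_intros)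
    from max0_square_compose_derivative[OF this] show ?thesis by (simp add: B_def[abs_def] B'_def)
  qed
  define \<psi>' where "\<psi>' s = (A' s * (A s + B s) - A s * (A' s + B' s)) / ((A s + B s) * (A s + B s))" for s
  have d\<psi>: "((\<lambda>s. A s / (A s + B s)) has_real_derivative \<psi>' s) (at s)" for s
    unfolding \<psi>'_def by (intro DERIV_divide DERIV_add dA dB) (use pos[of s] in simp)
  have cont: "continuous_on UNIV \<psi>'"
  proof -
    have c: "continuous_on UNIV A" "continuous_on UNIV B" "continuous_on UNIV A'" "continuous_on UNIV B'"
      unfolding A_def B_def A'_def B'_def by (intro continuous_intros)+
    have nz: "(A s + B s) * (A s + B s) \<noteq> 0" for s using pos[of s] by simp
    show ?thesis
      unfolding \<psi>'_def
      by (intro continuous_on_divide continuous_on_mult continuous_on_diff continuous_on_add c ballI nz)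
  qed
  define \<theta> where "\<theta> x = A ((norm (x - x0))\<^sup>2) / (A ((norm (x - x0))\<^sup>2) + B ((norm (x - x0))\<^sup>2))" for x
  define D\<theta> where "D\<theta> x = \<psi>' ((norm (x - x0))\<^sup>2) *\<^sub>R (2 *\<^sub>R (x - x0))" for x
  have near: "(norm (x - x0))\<^sup>2 < r1\<^sup>2" if "dist x0 x < r1" for x
    using that by (intro power_strict_mono) (auto simp: dist_norm norm_minus_commute)
  have far: "r2\<^sup>2 \<le> (norm (x - x0))\<^sup>2" if "r2 \<le> dist x0 x" for x
    using that assms by (intro power_mono) (auto simp: dist_norm norm_minus_commute)
  show thesis
  proof (rule that[of \<theta> D\<theta>])
    show "(\<theta> has_derivative (\<lambda>h. D\<theta> x \<bullet> h)) (at x)" for x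
      unfolding \<theta>_def D\<theta>_def by (rule gradient_chain[OF norm_sq_derivative d\<psi>])
    show "continuous_on UNIV D\<theta>"
      unfolding D\<theta>_def by (intro continuous_intros continuous_on_compose2[OF cont]) auto
    show "0 \<le> \<theta> x" for x unfolding \<theta>_def A_def B_def by simp
    show "\<theta> x \<le> 1" for x using pos[of "(norm (x - x0))\<^sup>2"] by (simp add: \<theta>_def) (simp add: B_def)
    show "\<theta> x = 1" "D\<theta> x = 0" if "dist x0 x < r1" for x
      using near[OF that] pos[of "(norm (x - x0))\<^sup>2"] by (simp_all add: \<theta>_def D\<theta>_def \<psi>'_def B_def B'_def)
    show "\<theta> x = 0" "D\<theta> x = 0" if "r2 \<le> dist x0 x" for x
      using far[OF that] by (simp_all add: \<theta>_def D\<theta>_def \<psi>'_def A_def A'_def)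
  qed
qed

text \<open>
  If the inequality fails, the unit normal field of the level sets of the quadratic (made strictly larger
  away from \<open>x0\<close>) has negative divergence near \<open>x0\<close>. It calibrates the set obtained from
  a sublevel set of \<open>u0\<close> by adding a small sublevel set of the quadratic, which thus has smaller perimeter.
\<close>

lemma minimizing_hull_touched_above:
  fixes u0 :: "'a::euclidean_space \<Rightarrow> real" and T :: "'a \<Rightarrow>\<^sub>L 'a"
  assumes contu: "continuous_on UNIV u0"
    and hull: "\<And>s. s \<in> {-1..1} \<Longrightarrow> minimizing_hull {x. u0 x \<le> s}"
    and u0x0: "-1 < u0 x0" "u0 x0 \<le> 1" and "p \<noteq> 0"
    and sym: "\<And>x y. blinfun_apply T x \<bullet> y = x \<bullet> blinfun_apply T y"
    and touch: "\<forall>\<^sub>F h in nhds 0. u0 (x0 + h) \<le> u0 x0 + p \<bullet> h + (blinfun_apply T h \<bullet> h) / 2"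
  shows "0 \<le> (\<Sum>b\<in>Basis. blinfun_apply T b \<bullet> b) - (blinfun_apply T p \<bullet> p) / (norm p)\<^sup>2"
proof (rule ccontr)
  assume neg: "\<not> ?thesis"
  define n where "n = real DIM('a)"
  have "n \<ge> 1" using DIM_positive[where 'a='a] by (simp add: n_def)
  define \<delta> where "\<delta> = (blinfun_apply T p \<bullet> p) / (norm p)\<^sup>2 - (\<Sum>b\<in>Basis. blinfun_apply T b \<bullet> b)"
  have "\<delta> > 0" using neg by (simp add: \<delta>_def)
  \<comment> \<open>Raising the Hessian by 2 \<kappa> times the identity changes the curvature term
    by 2 \<kappa> (n - 1), less than \<delta> / 2, so the strict sign survives.\<close>
  define \<kappa> where "\<kappa> = \<delta> / (4 * n)"
  have "\<kappa> > 0" using \<open>\<delta> > 0\<close> \<open>n \<ge> 1\<close> by (simp add: \<kappa>_def)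
  define U where "U = T + (2 * \<kappa>) *\<^sub>R id_blinfun"
  have U: "blinfun_apply U h = blinfun_apply T h + (2 * \<kappa>) *\<^sub>R h" for h
    by (simp add: U_def blinfun.add_left blinfun.scaleR_left)
  have symU: "blinfun_apply U x \<bullet> y = x \<bullet> blinfun_apply U y" for x y
    by (simp add: U inner_add_left inner_add_right sym)
  define G where "G x = p + blinfun_apply U (x - x0)" for x
  define \<phi> where "\<phi> x = u0 x0 + p \<bullet> (x - x0) + (blinfun_apply U (x - x0) \<bullet> (x - x0)) / 2" for x
  have dG: "(G has_derivative blinfun_apply U) (at x)" for x
    unfolding G_def
    by (auto intro!: derivative_eq_intros bounded_linear.has_derivative[OF blinfun.bounded_linear_right] simp: blinfun.zero_right)
  have d\<phi>: "(\<phi> has_derivative (\<lambda>h. G x \<bullet> h)) (at x)" for x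
  proof -
    have *: "((\<lambda>x. blinfun_apply U (x - x0)) has_derivative blinfun_apply U) (at x)"
      by (auto intro!: derivative_eq_intros bounded_linear.has_derivative[OF blinfun.bounded_linear_right])
    show ?thesis
      unfolding \<phi>_def
      by (auto intro!: derivative_eq_intros * simp: G_def inner_add_left inner_add_right symU inner_commute)
  qed
  have contG: "continuous_on UNIV G"
    using dG by (auto intro: continuous_at_imp_continuous_on has_derivative_continuous)
  have cont\<phi>: "continuous_on UNIV \<phi>"
    using d\<phi> by (auto intro: continuous_at_imp_continuous_on has_derivative_continuous)
  define s0 where "s0 = (norm p)\<^sup>2 / 2"
  have s0: "0 < s0" "s0 < (norm p)\<^sup>2" using \<open>p \<noteq> 0\<close> by (auto simp: s0_def)
  \<comment> \<open>G / |G| is singular at the zeros of G, but the calibration needs a C1 field of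
    norm at most 1 on the whole space. \<open>S\<close> dominates s, is positive at 0 and equals s
    from \<open>s0\<close> on, so dividing G by the root of S at |G|^2 gives such a field, which is
    the unit normal near \<open>x0\<close>.\<close>
  define S where "S s = s + (max 0 (s0 - s))\<^sup>2" for s
  have Spos: "0 < S s" if "0 \<le> s" for s
    using that s0 by (cases "s = 0") (auto simp: S_def add_pos_nonneg)
  have dS: "(S has_real_derivative (1 - 2 * max 0 (s0 - s))) (at s)" for s
  proof -
    have "((\<lambda>s. s0 - s) has_real_derivative - 1) (at s)" by (auto intro!: derivative_eq_intros)
    from DERIV_add[OF DERIV_ident max0_square_compose_derivative[OF this]] show ?thesis
      by (simp add: S_def[abs_def])
  qed
  define R where "R s = inverse (sqrt (S s))" for s
  define R' where "R' s = - ((1 - 2 * max 0 (s0 - s)) * (inverse (sqrt (S s)) / 2) * inverse (S s))" for s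
  have dR: "(R has_real_derivative R' s) (at s)" if "0 \<le> s" for s
  proof -
    have dsq: "((\<lambda>s. sqrt (S s)) has_real_derivative (1 - 2 * max 0 (s0 - s)) * (inverse (sqrt (S s)) / 2)) (at s)"
      using DERIV_chain'[OF dS DERIV_real_sqrt[OF Spos[OF that]]] by (simp add: mult_ac)
    show ?thesis
      using DERIV_inverse_fun[OF dsq] Spos[OF that] by (simp add: R_def[abs_def] R'_def mult_ac)
  qed
  define \<nu> where "\<nu> x = R ((norm (G x))\<^sup>2) *\<^sub>R G x" for x
  define \<nu>' where "\<nu>' x = rank1 (G x) ((R' ((norm (G x))\<^sup>2) * 2) *\<^sub>R blinfun_apply U (G x)) + R ((norm (G x))\<^sup>2) *\<^sub>R U" for x
  have d\<nu>: "(\<nu> has_derivative blinfun_apply (\<nu>' x)) (at x)" for x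
  proof -
    have "((\<lambda>x. (norm (G x))\<^sup>2) has_derivative (\<lambda>h. (2 *\<^sub>R blinfun_apply U (G x)) \<bullet> h)) (at x)"
    proof -
      have "h \<bullet> blinfun_apply U (G x) = G x \<bullet> blinfun_apply U h" for h
        by (metis inner_commute symU)
      then show ?thesis
        unfolding power2_norm_eq_inner
        by (auto intro!: derivative_eq_intros dG simp: symU)
    qed
    from gradient_chain[OF this dR]
    have "((\<lambda>x. R ((norm (G x))\<^sup>2)) has_derivative (\<lambda>h. (R' ((norm (G x))\<^sup>2) *\<^sub>R 2 *\<^sub>R blinfun_apply U (G x)) \<bullet> h)) (at x)"
      by simp
    from has_derivative_scaleR[OF this dG]
    show ?thesis
      unfolding \<nu>_def \<nu>'_def
      by (rule has_derivative_eq_rhs) (auto simp: fun_eq_iff blinfun.add_left blinfun.scaleR_left)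
  qed
  have contSG: "continuous_on UNIV (\<lambda>x. S ((norm (G x))\<^sup>2))"
    unfolding S_def by (intro continuous_intros contG)
  have contUG: "continuous_on UNIV (\<lambda>x. blinfun_apply U (G x))"
    by (intro continuous_intros contG)
  have SGnz: "sqrt (S ((norm (G x))\<^sup>2)) \<noteq> 0" "S ((norm (G x))\<^sup>2) \<noteq> 0" for x using Spos[of "(norm (G x))\<^sup>2"] by auto
  have cont\<nu>': "continuous_on UNIV \<nu>'"
    unfolding \<nu>'_def R_def R'_def
    by (intro continuous_intros contG contSG contUG) (use SGnz in auto)
  have norm\<nu>: "norm (\<nu> x) \<le> 1" for x
  proof -
    have "(norm (G x))\<^sup>2 \<le> S ((norm (G x))\<^sup>2)" by (simp add: S_def)
    then have "norm (G x) \<le> sqrt (S ((norm (G x))\<^sup>2))" by (rule real_le_rsqrt)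
    then show ?thesis
      using Spos[of "(norm (G x))\<^sup>2"] by (simp add: \<nu>_def R_def divide_inverse[symmetric] mult.commute[of "inverse _"])
  qed
  have \<nu>_unit: "\<nu> x = inverse (norm (G x)) *\<^sub>R G x" if "s0 < (norm (G x))\<^sup>2" for x
    using that by (simp add: \<nu>_def R_def S_def)
  have div\<nu>: "divergence \<nu>' x = R' ((norm (G x))\<^sup>2) * 2 * (blinfun_apply U (G x) \<bullet> G x) + R ((norm (G x))\<^sup>2) * (\<Sum>b\<in>Basis. blinfun_apply U b \<bullet> b)" for x
    unfolding \<nu>'_def divergence_add divergence_rank1 divergence_scaleR by (simp add: divergence_def)
  define d where "d = divergence \<nu>' x0"
  have "d < 0"
  proof -
    have G0: "G x0 = p" by (simp add: G_def blinfun.zero_right)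
    have S0: "S ((norm p)\<^sup>2) = (norm p)\<^sup>2" using s0 by (simp add: S_def)
    have "d = (- (1 / (norm p)\<^sup>2) * (blinfun_apply U p \<bullet> p) + (\<Sum>b\<in>Basis. blinfun_apply U b \<bullet> b)) / norm p"
      unfolding d_def div\<nu> G0 R_def R'_def S0 using s0 \<open>p \<noteq> 0\<close> by (simp add: field_simps power2_eq_square)
    also have "blinfun_apply U p \<bullet> p = blinfun_apply T p \<bullet> p + 2 * \<kappa> * (norm p)\<^sup>2"
      by (simp add: U inner_add_left dot_square_norm)
    also have "(\<Sum>b\<in>Basis. blinfun_apply U b \<bullet> b) = (\<Sum>b\<in>Basis. blinfun_apply T b \<bullet> b) + 2 * \<kappa> * n"
      by (simp add: U inner_add_left sum.distrib n_def)
    finally have "d = (- \<delta> - 2 * \<kappa> + 2 * \<kappa> * n) / norm p"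
      using \<open>p \<noteq> 0\<close> by (simp add: \<delta>_def field_simps)
    also have "2 * \<kappa> * n = \<delta> / 2" using \<open>n \<ge> 1\<close> by (simp add: \<kappa>_def)
    finally show ?thesis using \<open>\<delta> > 0\<close> \<open>\<kappa> > 0\<close> \<open>p \<noteq> 0\<close> by (simp add: divide_neg_pos)
  qed
  have contdiv: "continuous_on UNIV (divergence \<nu>')" by (rule continuous_on_divergence[OF cont\<nu>'])
  have "\<forall>\<^sub>F x in nhds x0. divergence \<nu>' x < d / 2 \<and> s0 < (norm (G x))\<^sup>2 \<and> u0 x \<le> \<phi> x - \<kappa> * (norm (x - x0))\<^sup>2"
  proof (intro eventually_conj)
    have "((divergence \<nu>') \<longlongrightarrow> divergence \<nu>' x0) (nhds x0)"
      using contdiv by (simp add: continuous_on_eq_continuous_at isCont_def tendsto_nhds_iff)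
    then show "\<forall>\<^sub>F x in nhds x0. divergence \<nu>' x < d / 2"
      using \<open>d < 0\<close> by (intro order_tendstoD(2)) (auto simp: d_def)
    have "continuous_on UNIV (\<lambda>x. (norm (G x))\<^sup>2)" by (intro continuous_intros contG)
    then have "((\<lambda>x. (norm (G x))\<^sup>2) \<longlongrightarrow> (norm (G x0))\<^sup>2) (nhds x0)"
      by (simp add: continuous_on_eq_continuous_at isCont_def tendsto_nhds_iff)
    then show "\<forall>\<^sub>F x in nhds x0. s0 < (norm (G x))\<^sup>2"
      using s0 by (intro order_tendstoD(1)) (auto simp: G_def blinfun.zero_right)
    have "((\<lambda>x. x - x0) \<longlongrightarrow> x0 - x0) (nhds x0)"
      by (intro tendsto_diff tendsto_const filterlim_ident)
    then have "filterlim (\<lambda>x. x - x0) (nhds 0) (nhds x0)" by simp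
    from eventually_compose_filterlim[OF touch this]
    show "\<forall>\<^sub>F x in nhds x0. u0 x \<le> \<phi> x - \<kappa> * (norm (x - x0))\<^sup>2"
      by (rule eventually_mono) (simp add: \<phi>_def U inner_add_left dot_square_norm add_divide_distrib)
  qed
  then obtain r2 where "r2 > 0" and r2: "\<And>x. dist x x0 < r2 \<Longrightarrow> divergence \<nu>' x < d / 2"
    "\<And>x. dist x x0 < r2 \<Longrightarrow> s0 < (norm (G x))\<^sup>2"
    "\<And>x. dist x x0 < r2 \<Longrightarrow> u0 x \<le> \<phi> x - \<kappa> * (norm (x - x0))\<^sup>2"
    unfolding eventually_nhds_metric by blast
  define r1 where "r1 = r2 / 2"
  have r1: "0 < r1" "r1 < r2" using \<open>r2 > 0\<close> by (auto simp: r1_def)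
  \<comment> \<open>The first bound confines \<open>F - E\<close> to the ball of radius
    \<open>r1\<close>; the second keeps the level u0 x0 - \<eta> at or above -1, so that
    \<open>E\<close> is a minimizing hull by hypothesis.\<close>
  define \<eta> where "\<eta> = min (\<kappa> * r1\<^sup>2 / 2) (u0 x0 + 1)"
  have \<eta>: "0 < \<eta>" "2 * \<eta> \<le> \<kappa> * r1\<^sup>2" "\<eta> \<le> u0 x0 + 1"
    using \<open>\<kappa> > 0\<close> r1 u0x0 by (auto simp: \<eta>_def min_def)
  define E where "E = {x. u0 x \<le> u0 x0 - \<eta>}"
  define A where "A = ball x0 r2 \<inter> {x. \<phi> x < u0 x0 + \<eta>}"
  define F where "F = E \<union> A"
  have mh: "minimizing_hull E" unfolding E_def using \<eta> u0x0 by (intro hull) auto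
  have "closed E" unfolding E_def by (intro closed_Collect_le contu continuous_on_const)
  have "open A" unfolding A_def by (intro open_Int open_ball open_Collect_less cont\<phi> continuous_on_const)
  have FEA: "F - E = A - E" by (auto simp: F_def)
  have "open (F - E)" unfolding FEA by (intro open_Diff \<open>open A\<close> \<open>closed E\<close>)
  have "x0 \<in> F - E" unfolding FEA using \<eta> \<open>r2 > 0\<close> by (auto simp: A_def E_def \<phi>_def blinfun.zero_right)
  \<comment> \<open>On \<open>F - E\<close> the values of \<phi> and u0 differ by less than 2
    \<eta>, while \<phi> exceeds u0 by at least \<kappa> |x - x0|^2.\<close>
  have FEsub: "dist x0 x < r1 \<and> dist x0 x < r2 \<and> \<phi> x < u0 x0 + \<eta>" if "x \<in> F - E" for x
  proof -
    have x: "dist x0 x < r2" "\<phi> x < u0 x0 + \<eta>" "u0 x0 - \<eta> < u0 x" using that unfolding FEA by (auto simp: A_def E_def)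
    have "\<not> r1 \<le> dist x0 x"
    proof
      assume "r1 \<le> dist x0 x"
      then have "r1\<^sup>2 \<le> (norm (x - x0))\<^sup>2" using r1 by (intro power_mono) (auto simp: dist_norm norm_minus_commute)
      then have "\<kappa> * r1\<^sup>2 \<le> \<kappa> * (norm (x - x0))\<^sup>2" using \<open>\<kappa> > 0\<close> by simp
      then show False using r2(3)[of x] x \<eta>(2) by (simp add: dist_commute)
    qed
    with x show ?thesis by simp
  qed
  have bndFE: "bounded (F - E)"
    by (rule bounded_subset[OF bounded_ball[of x0 r1]]) (use FEsub in auto)
  have setsE: "E \<in> sets lebesgue" and setsF: "F \<in> sets lebesgue"
    using \<open>closed E\<close> \<open>open A\<close> by (auto simp: F_def intro: sets.Un borel_closed borel_open)
  obtain \<theta> D\<theta> where \<theta>: "\<And>x. (\<theta> has_derivative (\<lambda>h. D\<theta> x \<bullet> h)) (at x)" "continuous_on UNIV D\<theta>"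
    "\<And>x. 0 \<le> \<theta> x" "\<And>x. \<theta> x \<le> 1"
    "\<And>x. dist x0 x < r1 \<Longrightarrow> \<theta> x = 1" "\<And>x. dist x0 x < r1 \<Longrightarrow> D\<theta> x = 0"
    "\<And>x. r2 \<le> dist x0 x \<Longrightarrow> \<theta> x = 0" "\<And>x. r2 \<le> dist x0 x \<Longrightarrow> D\<theta> x = 0"
    using smooth_cutoff[OF r1, of x0] by metis
  have cont\<theta>: "continuous_on UNIV \<theta>"
    using \<theta>(1) by (auto intro: continuous_at_imp_continuous_on has_derivative_continuous)
  \<comment> \<open>A C1 approximation of the indicator of t > 0: it vanishes together with its
    derivative for t \<le> 0, is nondecreasing, and tends to 1 for every t > 0.\<close>
  define w where "w k t = real k * (max 0 t)\<^sup>2 / (1 + real k * (max 0 t)\<^sup>2)" for k :: nat and t :: real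
  define w' where "w' k t = real k * (2 * max 0 t) / ((1 + real k * (max 0 t)\<^sup>2) * (1 + real k * (max 0 t)\<^sup>2))" for k :: nat and t :: real
  have wpos: "1 + real k * (max 0 t)\<^sup>2 > 0" for k and t :: real
    by (simp add: add_pos_nonneg)
  have dw: "(w k has_real_derivative w' k t) (at t)" for k t
  proof -
    have "((\<lambda>t. real k * (max 0 t)\<^sup>2) has_real_derivative real k * (2 * max 0 t)) (at t)"
      by (rule DERIV_cmult[OF max0_square_derivative])
    note d1 = this
    have d2: "((\<lambda>t. 1 + real k * (max 0 t)\<^sup>2) has_real_derivative 0 + real k * (2 * max 0 t)) (at t)"
      by (intro DERIV_add DERIV_const d1)
    have nz: "1 + real k * (max 0 t)\<^sup>2 \<noteq> 0" using wpos[of k t] by simp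
    show ?thesis
      unfolding w_def
      by (rule DERIV_cong[OF DERIV_divide[OF d1 d2 nz]]) (simp add: w'_def algebra_simps)
  qed
  have contw: "continuous_on UNIV (w k)" "continuous_on UNIV (w' k)" for k
  proof -
    have c: "continuous_on UNIV (\<lambda>t::real. (max 0 t)\<^sup>2)" by (intro continuous_intros)
    have nz: "1 + real k * (max 0 t)\<^sup>2 \<noteq> 0" for t :: real using wpos[of k t] by simp
    show "continuous_on UNIV (w k)" "continuous_on UNIV (w' k)"
      unfolding w_def w'_def
      by (intro continuous_on_divide continuous_on_mult continuous_on_add continuous_on_const c ballI nz
          no_zero_divisors continuous_on_max continuous_on_id)+
  qed
  define c where "c = u0 x0 + \<eta>"
  define m where "m k x = \<theta> x * w k (c - \<phi> x)" for k x
  define Dm where "Dm k x = (\<theta> x * w' k (c - \<phi> x)) *\<^sub>R (- G x) + w k (c - \<phi> x) *\<^sub>R D\<theta> x" for k x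
  have w01: "0 \<le> w k t" "w k t \<le> 1" "0 \<le> w' k t" for k t
    using wpos[of k t] by (auto simp: w_def w'_def divide_le_eq)
  have w0: "w k t = 0" "w' k t = 0" if "t \<le> 0" for k t
    using that by (auto simp: w_def w'_def)
  have notF: "r2 \<le> dist x0 x \<or> c - \<phi> x \<le> 0" if "x \<notin> F" for x
    using that by (auto simp: F_def A_def c_def)
  have "Per F \<le> Per E + ereal (LINT x:F - E|lebesgue. divergence \<nu>' x)"
  proof (rule Per_calibration[where m = m and Dm = Dm and \<nu> = \<nu> and K = "cball x0 r2"])
    show "(m k has_derivative (\<lambda>h. Dm k x \<bullet> h)) (at x)" for k x
    proof -
      have "((\<lambda>x. c - \<phi> x) has_derivative (\<lambda>h. (- G x) \<bullet> h)) (at x)"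
        by (auto intro!: derivative_eq_intros d\<phi>)
      from has_derivative_mult[OF \<theta>(1) gradient_chain[OF this dw]]
      show ?thesis
        unfolding m_def Dm_def
        by (rule has_derivative_eq_rhs) (auto simp: fun_eq_iff inner_add_left inner_diff_left algebra_simps)
    qed
    show "continuous_on UNIV (Dm k)" for k
      unfolding Dm_def
      by (intro continuous_intros cont\<theta> \<theta>(2) contG continuous_on_compose2[OF contw(1)] continuous_on_compose2[OF contw(2)] cont\<phi>) auto
    show "0 \<le> m k x" for k x using w01 \<theta>(3) by (simp add: m_def)
    show "m k x \<le> 1" for k x using w01 \<theta>(3,4) by (simp add: m_def mult_le_one)
    show "m k x = 0" if "x \<notin> cball x0 r2" for k x using that \<theta>(7)[of x] by (simp add: m_def)
    show "m k x = 0" if "x \<notin> F" for k x using notF[OF that] \<theta>(7) w0 by (auto simp: m_def)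
    show "Dm k x = 0" if "x \<notin> F" for k x using notF[OF that] \<theta>(7,8) w0 by (auto simp: Dm_def)
    show "(\<lambda>k. m k x) \<longlonglongrightarrow> 1" if "x \<in> F - E" for x
    proof -
      define q where "q = (max 0 (c - \<phi> x))\<^sup>2"
      have "q > 0" using FEsub[OF that] by (simp add: q_def c_def)
      have "(\<lambda>k. 1 - 1 / (1 + real k * q)) \<longlonglongrightarrow> 1 - 0"
        by (intro tendsto_diff tendsto_const tendsto_divide_0[OF tendsto_const] filterlim_at_top_imp_at_infinity
            filterlim_tendsto_add_at_top[OF tendsto_const] filterlim_at_top_mult_tendsto_pos[OF tendsto_const \<open>q > 0\<close> filterlim_real_sequentially])
      moreover have "1 - 1 / (1 + real k * q) = m k x" for k
        using FEsub[OF that] \<theta>(5)[of x] wpos[of k "c - \<phi> x"] by (simp add: m_def w_def q_def field_simps)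
      ultimately show ?thesis by simp
    qed
    \<comment> \<open>On \<open>F - E\<close> the cutoff is constantly 1, so the gradient of
      \<open>m k\<close> is a nonpositive multiple of G, and the unit normal maximises the product
      with G among all vectors of norm at most 1.\<close>
    show "Dm k x \<bullet> (\<nu> x - v) \<le> 0" if x: "x \<in> F - E" and v: "norm v \<le> 1" for k x v
    proof -
      have near: "dist x0 x < r1" "dist x0 x < r2" using FEsub[OF x] by auto
      have Gs: "s0 < (norm (G x))\<^sup>2" using r2(2) near by (simp add: dist_commute)
      then have "G x \<noteq> 0" using s0 by auto
      then have "G x \<bullet> \<nu> x = norm (G x)"
        unfolding \<nu>_unit[OF Gs] by (simp add: dot_square_norm power2_eq_square)
      moreover have "G x \<bullet> v \<le> norm (G x)"
        using norm_cauchy_schwarz[of "G x" v] mult_left_mono[OF v, of "norm (G x)"] by simp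
      ultimately have "0 \<le> w' k (c - \<phi> x) * (G x \<bullet> (\<nu> x - v))"
        using w01 by (intro mult_nonneg_nonneg) (auto simp: inner_diff_right)
      then show ?thesis using \<theta>(5,6)[OF near(1)] by (simp add: Dm_def)
    qed
  qed (use setsE setsF bndFE d\<nu> cont\<nu>' norm\<nu> in \<open>auto simp: F_def\<close>)
  moreover have "Per E \<le> Per F"
    using mh setsF bndFE unfolding minimizing_hull_def by (auto simp: F_def compact_closure)
  moreover have "Per E < \<infinity>" using mh by (simp add: minimizing_hull_def finite_perimeter_def)
  \<comment> \<open>The zero field is admissible. This excludes the value minus infinity in the
    final cancellation.\<close>
  moreover have "0 \<le> Per E"
  proof -
    have "C1c_field (\<lambda>_. 0 :: 'a) (\<lambda>_. 0)" by (simp add: C1c_field_def zero_blinfun.rep_eq)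
    then show ?thesis unfolding Per_def
      by (intro SUP_upper2[of "(\<lambda>_. 0, \<lambda>_. 0)"]) (auto simp: divergence_def set_lebesgue_integral_def)
  qed
  moreover have "(LINT x:F - E|lebesgue. divergence \<nu>' x) < 0"
  proof -
    \<comment> \<open>\<open>F - E\<close> is bounded, open and contains \<open>x0\<close>, so it
      has finite positive measure, and the divergence is below d / 2 on it.\<close>
    have lm: "F - E \<in> lmeasurable" by (rule lmeasurable_open[OF bndFE \<open>open (F - E)\<close>])
    then have mpos: "measure lebesgue (F - E) > 0"
      using open_not_negligible[OF \<open>open (F - E)\<close>] \<open>x0 \<in> F - E\<close> negligible_iff_measure zero_less_measure_iff
      by (metis empty_iff measure_nonneg order_le_less)
    have "(LINT x:F - E|lebesgue. divergence \<nu>' x) \<le> (LINT x:F - E|lebesgue. d / 2)"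
      unfolding set_lebesgue_integral_def
    proof (rule integral_mono)
      obtain b where FEb: "F - E \<subseteq> cbox (-b) b"
        using bounded_subset_cbox_symmetric[OF bndFE] by blast
      have "integrable lborel (\<lambda>x. indicator (cbox (-b) b) x *\<^sub>R divergence \<nu>' x)"
        by (rule borel_integrable_compact[OF compact_cbox continuous_on_subset[OF contdiv]]) simp
      moreover have "(\<lambda>x. indicator (cbox (-b) b) x *\<^sub>R divergence \<nu>' x) \<in> borel_measurable lborel"
        using borel_measurable_continuous_onI[OF contdiv] by simp
      ultimately have "integrable lebesgue (\<lambda>x. indicator (cbox (-b) b) x *\<^sub>R divergence \<nu>' x)"
        using integrable_completion by blast
      from integrable_mult_indicator[OF fmeasurableD[OF lm] this]
      show "integrable lebesgue (\<lambda>x. indicat_real (F - E) x *\<^sub>R divergence \<nu>' x)"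
        by (rule back_subst[of "integrable lebesgue"]) (use FEb in \<open>auto simp: indicator_def fun_eq_iff\<close>)
      show "integrable lebesgue (\<lambda>x. indicat_real (F - E) x *\<^sub>R (d / 2))"
        using lm by (auto intro!: integrable_mult_left integrable_real_indicator simp: fmeasurable_def)
      show "indicat_real (F - E) x *\<^sub>R divergence \<nu>' x \<le> indicat_real (F - E) x *\<^sub>R (d / 2)" for x
        using FEsub[of x] r2(1)[of x] by (cases "x \<in> F - E") (auto simp: dist_commute less_imp_le)
    qed
    also have "\<dots> = measure lebesgue (F - E) * (d / 2)"
      by (simp add: set_lebesgue_integral_def)
    also have "\<dots> < 0" using mpos \<open>d < 0\<close> by (simp add: mult_pos_neg)
    finally show ?thesis .
  qed
  ultimately show False
    by (cases "Per E"; cases "Per F") auto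
qed

section \<open>Viscosity inequalities in terms of jets\<close>

text \<open>|Du| div(Du/|Du|) for gradient \<open>p\<close> and Hessian \<open>L\<close>. The
  Hessian is a linear map because the jets are produced in that form; the value at p = 0 is the
  default of division and appears only behind a guard.\<close>

definition mean_curv :: "real^'n \<Rightarrow> (real^'n \<Rightarrow> real^'n) \<Rightarrow> real" where
  "mean_curv p L = (\<Sum>b\<in>Basis. L b \<bullet> b) - (L p \<bullet> p) / (norm p)\<^sup>2"

lemma F_mc_eq: "F_mc q Y = (q \<bullet> (Y *v q)) / (norm q)\<^sup>2 - trace Y"
proof -
  define c where "c = 1 / (norm q)\<^sup>2"
  have "trace ((mat 1 - c *\<^sub>R tensor q q) ** Y) = (\<Sum>i\<in>UNIV. \<Sum>k\<in>UNIV. ((if i = k then 1 else 0) - c * (q $ i * q $ k)) * Y $ k $ i)"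
    by (simp add: trace_def matrix_matrix_mult_def mat_def tensor_def)
  also have "\<dots> = (\<Sum>i\<in>UNIV. Y $ i $ i) - c * (\<Sum>i\<in>UNIV. \<Sum>k\<in>UNIV. q $ i * q $ k * Y $ k $ i)"
    by (simp add: left_diff_distrib sum_subtractf sum_distrib_left mult.assoc if_distrib[of "\<lambda>x. x * _"] cong: if_cong)
  also have "(\<Sum>i\<in>UNIV. \<Sum>k\<in>UNIV. q $ i * q $ k * Y $ k $ i) = (\<Sum>k\<in>UNIV. \<Sum>i\<in>UNIV. q $ i * q $ k * Y $ k $ i)"
    by (rule sum.swap)
  also have "\<dots> = q \<bullet> (Y *v q)"
    by (simp add: inner_vec_def matrix_vector_mult_def sum_distrib_left mult_ac)
  finally show ?thesis by (simp add: F_mc_def c_def trace_def)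
qed

lemma trace_matrix: "trace (matrix L) = (\<Sum>b\<in>Basis. L b \<bullet> b)" for L :: "real^'n \<Rightarrow> real^'n"
proof -
  have B: "(Basis :: (real^'n) set) = range (\<lambda>i. axis i 1)" by (auto simp: Basis_vec_def)
  have "(\<Sum>b\<in>Basis. L b \<bullet> b) = (\<Sum>i\<in>UNIV. L (axis i 1) \<bullet> axis i 1)"
    unfolding B by (subst sum.reindex) (auto simp: inj_on_def axis_eq_axis)
  then show ?thesis by (simp add: trace_def matrix_def inner_axis)
qed

lemma matrix_linear_apply:
  fixes L :: "real^'n \<Rightarrow> real^'m"
  assumes "linear L"
  shows "matrix L *v x = L x"
  using fun_cong[OF matrix_vector_mul(2)[OF assms]] .

lemma F_mc_matrix:
  assumes "linear L"
  shows "F_mc p (matrix L) = - mean_curv p L"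
  by (simp add: F_mc_eq trace_matrix mean_curv_def matrix_linear_apply[OF assms] inner_commute)

lemma F_lower_greaterI:
  assumes "\<forall>\<^sub>F (q, Y) in nhds (p, X). q \<noteq> 0 \<longrightarrow> c \<le> F_mc q Y"
  shows "ereal c \<le> F_lower p X"
  unfolding F_lower_def
proof (rule Liminf_bounded)
  show "\<forall>\<^sub>F n in inf (nhds (p, X)) (principal F_mc_dom). ereal c \<le> (case n of (q, Y) \<Rightarrow> ereal (F_mc q Y))"
    unfolding eventually_inf_principal using assms by (rule eventually_mono) (auto simp: F_mc_dom_def)
qed

lemma ereal_le_by_epsilon:
  assumes "\<And>e. 0 < e \<Longrightarrow> ereal (c - e) \<le> X"
  shows "ereal c \<le> X"
proof (cases X)
  case (real x)
  have "c \<le> x"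
  proof (rule field_le_epsilon)
    fix e :: real assume "0 < e"
    from assms[OF this] show "c \<le> x + e" unfolding real by simp
  qed
  then show ?thesis using real by simp
next
  case MInf
  then show ?thesis using assms[of 1] by simp
qed simp

text \<open>F is continuous away from gradient zero, so the envelope does not drop there.\<close>

lemma F_lower_ge:
  assumes "p \<noteq> 0"
  shows "ereal (F_mc p X) \<le> F_lower p X"
proof (rule ereal_le_by_epsilon)
  fix e :: real assume "0 < e"
  have "((\<lambda>z. (fst z \<bullet> (snd z *v fst z)) / (norm (fst z))\<^sup>2 - trace (snd z)) \<longlongrightarrow> (p \<bullet> (X *v p)) / (norm p)\<^sup>2 - trace X) (nhds (p, X))"
  proof -
    have f: "((\<lambda>z. fst z) \<longlongrightarrow> p) (nhds (p, X))" and s: "((\<lambda>z. snd z) \<longlongrightarrow> X) (nhds (p, X))"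
      by (rule tendsto_fst[of "\<lambda>z. z" "(p, X)", simplified] tendsto_snd[of "\<lambda>z. z" "(p, X)", simplified], rule filterlim_ident)+
    have t: "((\<lambda>z. trace (snd z)) \<longlongrightarrow> trace X) (nhds (p, X))"
      unfolding trace_def by (intro tendsto_sum tendsto_vec_nth s)
    have m: "((\<lambda>z. snd z *v fst z) \<longlongrightarrow> X *v p) (nhds (p, X))"
      unfolding matrix_vector_mult_def
      by (intro tendsto_vec_lambda tendsto_sum tendsto_mult tendsto_vec_nth s f)
    show ?thesis
      using assms by (intro tendsto_intros f m t) auto
  qed
  then have "((\<lambda>z. F_mc (fst z) (snd z)) \<longlongrightarrow> F_mc p X) (nhds (p, X))" unfolding F_mc_eq .
  then have "\<forall>\<^sub>F z in nhds (p, X). F_mc p X - e < F_mc (fst z) (snd z)"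
    using \<open>0 < e\<close> by (intro order_tendstoD(1)) auto
  then show "ereal (F_mc p X - e) \<le> F_lower p X"
    by (intro F_lower_greaterI) (auto elim!: eventually_mono)
qed

text \<open>A quadratic form bounded by \<open>K\<close> has trace at most n K and is at least -K in
  every direction, so F is at least -(n + 1) K whatever the gradient; the estimate therefore passes
  to the envelope also at gradient zero.\<close>

lemma F_lower_ge_bound:
  fixes X :: "real^'n^'n"
  assumes K: "\<And>h. \<bar>h \<bullet> (X *v h)\<bar> \<le> K * (norm h)\<^sup>2"
  shows "ereal (- ((real CARD('n) + 1) * K)) \<le> F_lower p X"
proof (rule ereal_le_by_epsilon)
  fix e :: real assume "0 < e"
  define n where "n = real CARD('n)"
  have "n \<ge> 1" by (simp add: n_def Suc_leI)
  \<comment> \<open>Changing all entries by at most \<open>\<delta>\<close> changes the trace by at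
    most n \<delta> and the form in a unit direction by at most n^2 \<delta>, together
    \<open>e\<close>.\<close>
  define \<delta> where "\<delta> = e / (n + n * n)"
  have "\<delta> > 0" using \<open>0 < e\<close> \<open>n \<ge> 1\<close> by (simp add: \<delta>_def add_pos_pos)
  have \<delta>e: "n * \<delta> + n * n * \<delta> = e" using \<open>n \<ge> 1\<close> by (simp add: \<delta>_def field_simps add_nonneg_eq_0_iff)
  show "ereal (- ((real CARD('n) + 1) * K) - e) \<le> F_lower p X"
  proof (rule F_lower_greaterI)
    have "- ((n + 1) * K) - e \<le> F_mc q Y" if Y: "dist (q, Y) (p, X) < \<delta>" and q: "q \<noteq> 0" for q Y
    proof -
      have "dist Y X < \<delta>" using Y dist_snd_le[of "(q, Y)" "(p, X)"] by simp
      then have comp: "\<bar>Y $ i $ k - X $ i $ k\<bar> \<le> \<delta>" for i k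
        using order_trans[OF component_le_norm_cart[of "(Y - X) $ i" k] Finite_Cartesian_Product.norm_nth_le[of "Y - X" i]]
        by (simp add: dist_norm)
      have diag: "X $ i $ i \<le> K" for i
      proof -
        have "axis i 1 \<bullet> (X *v axis i 1) = X $ i $ i"
          by (simp add: inner_axis' matrix_vector_mult_basis column_def)
        then show ?thesis using K[of "axis i 1"] by simp
      qed
      have "trace Y \<le> (\<Sum>i\<in>(UNIV::'n set). K + \<delta>)"
        unfolding trace_def
      proof (rule sum_mono)
        fix i show "Y $ i $ i \<le> K + \<delta>" using comp[of i i] diag[of i] by linarith
      qed
      also have "\<dots> = n * K + n * \<delta>" by (simp add: n_def distrib_left)
      finally have tr: "trace Y \<le> n * K + n * \<delta>" .
      have "\<bar>q \<bullet> ((Y - X) *v q)\<bar> = \<bar>\<Sum>i\<in>UNIV. \<Sum>k\<in>UNIV. q $ i * ((Y - X) $ i $ k * q $ k)\<bar>"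
        by (simp add: inner_vec_def matrix_vector_mult_def sum_distrib_left)
      also have "\<dots> \<le> (\<Sum>i\<in>(UNIV::'n set). \<Sum>k\<in>(UNIV::'n set). \<delta> * (norm q)\<^sup>2)"
      proof (rule order_trans[OF sum_abs], rule sum_mono, rule order_trans[OF sum_abs], rule sum_mono)
        fix i k
        have "\<bar>q $ i * ((Y - X) $ i $ k * q $ k)\<bar> = \<bar>q $ i\<bar> * \<bar>Y $ i $ k - X $ i $ k\<bar> * \<bar>q $ k\<bar>"
          by (simp add: abs_mult)
        also have "\<dots> \<le> norm q * \<delta> * norm q"
          using comp[of i k] component_le_norm_cart[of q i] component_le_norm_cart[of q k] \<open>\<delta> > 0\<close>
          by (intro mult_mono) auto
        finally show "\<bar>q $ i * ((Y - X) $ i $ k * q $ k)\<bar> \<le> \<delta> * (norm q)\<^sup>2" by (simp add: power2_eq_square mult_ac)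
      qed
      also have "\<dots> = n * n * \<delta> * (norm q)\<^sup>2" by (simp add: n_def)
      finally have d: "\<bar>q \<bullet> ((Y - X) *v q)\<bar> \<le> n * n * \<delta> * (norm q)\<^sup>2" .
      have "q \<bullet> (Y *v q) = q \<bullet> (X *v q) + q \<bullet> ((Y - X) *v q)"
        by (simp add: matrix_vector_mult_diff_rdistrib inner_diff_right)
      then have "- (K + n * n * \<delta>) * (norm q)\<^sup>2 \<le> q \<bullet> (Y *v q)"
        using K[of q] d by (simp add: algebra_simps abs_le_iff)
      then have "- (K + n * n * \<delta>) \<le> (q \<bullet> (Y *v q)) / (norm q)\<^sup>2"
        using q by (subst pos_le_divide_eq) auto
      then show ?thesis using tr \<delta>e unfolding F_mc_eq by (simp add: algebra_simps)
    qed
    then show "\<forall>\<^sub>F (q, Y) in nhds (p, X). q \<noteq> 0 \<longrightarrow> - ((real CARD('n) + 1) * K) - e \<le> F_mc q Y"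
      unfolding eventually_nhds_metric using \<open>\<delta> > 0\<close> by (intro exI[of _ \<delta>]) (auto simp: n_def)
  qed
qed

text \<open>The inequality at one point with the obstacle condition left out. It applies to u and to
  -u alike; the obstacle condition is checked where the inequality is used.\<close>

definition visc_sub :: "((real^'n) \<times> real \<Rightarrow> real) \<Rightarrow> (real^'n) \<times> real \<Rightarrow> bool" where
  "visc_sub f w \<longleftrightarrow> (\<forall>\<phi> G H. C2_fun \<phi> G H \<and> (\<forall>z\<in>spacetime. f z - \<phi> z \<le> f w - \<phi> w) \<longrightarrow>
     ereal (snd (G w)) + F_lower (fst (G w)) (space_hessian (H w)) \<le> 0)"

text \<open>
  The second clause is what remains of the inequality for \<open>F_lower\<close> at a vanishing gradient; it is not sharp,
  but the comparison principle uses it only for small \<open>K\<close>.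
\<close>

definition jet_sub :: "((real^'n) \<times> real \<Rightarrow> real) \<Rightarrow> (real^'n) \<times> real \<Rightarrow> bool" where
  "jet_sub f w \<longleftrightarrow> (\<forall>P Q. linear Q \<and> (\<forall>y z. Q y \<bullet> z = y \<bullet> Q z) \<and>
       (\<forall>\<^sub>F h in nhds 0. f (w + h) \<le> f w + P \<bullet> h + (Q h \<bullet> h) / 2) \<longrightarrow>
     (fst P \<noteq> 0 \<longrightarrow> snd P \<le> mean_curv (fst P) (\<lambda>h. fst (Q (h, 0)))) \<and>
     (\<forall>K. (\<forall>h. \<bar>fst (Q (h, 0)) \<bullet> h\<bar> \<le> K * (norm h)\<^sup>2) \<longrightarrow> snd P \<le> (real CARD('n) + 1) * K))"

text \<open>The quartic term has zero gradient and Hessian at \<open>w\<close>, so it can turn a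
  local maximum into a global one without changing the jet.\<close>

lemma C2_fun_quadratic_quartic:
  fixes P w :: "'a::euclidean_space" and Q :: "'a \<Rightarrow>\<^sub>L 'a"
  assumes sym: "\<And>y z. blinfun_apply Q y \<bullet> z = y \<bullet> blinfun_apply Q z"
  shows "C2_fun (\<lambda>z. P \<bullet> (z - w) + (blinfun_apply Q (z - w) \<bullet> (z - w)) / 2 + M * ((norm (z - w))\<^sup>2 * (norm (z - w))\<^sup>2))
    (\<lambda>z. P + blinfun_apply Q (z - w) + (4 * M * (norm (z - w))\<^sup>2) *\<^sub>R (z - w))
    (\<lambda>z. Q + (4 * M * (norm (z - w))\<^sup>2) *\<^sub>R id_blinfun + (8 * M) *\<^sub>R rank1 (z - w) (z - w))"
  unfolding C2_fun_def
proof (intro conjI allI)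
  fix x
  have dQ: "((\<lambda>z. blinfun_apply Q (z - w)) has_derivative blinfun_apply Q) (at x)"
    by (auto intro!: derivative_eq_intros bounded_linear.has_derivative[OF blinfun.bounded_linear_right])
  have dn: "((\<lambda>z. (norm (z - w))\<^sup>2) has_derivative (\<lambda>h. 2 * ((x - w) \<bullet> h))) (at x)"
    unfolding power2_norm_eq_inner by (auto intro!: derivative_eq_intros simp: inner_commute)
  have d1: "((\<lambda>z. P \<bullet> (z - w)) has_derivative (\<lambda>h. P \<bullet> h)) (at x)"
    by (auto intro!: derivative_eq_intros)
  have d2: "((\<lambda>z. (blinfun_apply Q (z - w) \<bullet> (z - w)) / 2) has_derivative (\<lambda>h. blinfun_apply Q (x - w) \<bullet> h)) (at x)"
    by (auto intro!: derivative_eq_intros dQ simp: sym inner_commute)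
  have d3: "((\<lambda>z. M * ((norm (z - w))\<^sup>2 * (norm (z - w))\<^sup>2)) has_derivative (\<lambda>h. 4 * M * (norm (x - w))\<^sup>2 * ((x - w) \<bullet> h))) (at x)"
    by (rule has_derivative_eq_rhs[OF has_derivative_mult_right[OF has_derivative_mult[OF dn dn]]]) (simp add: fun_eq_iff)
  show "((\<lambda>z. P \<bullet> (z - w) + (blinfun_apply Q (z - w) \<bullet> (z - w)) / 2 + M * ((norm (z - w))\<^sup>2 * (norm (z - w))\<^sup>2)) has_derivative
      (\<lambda>h. (P + blinfun_apply Q (x - w) + (4 * M * (norm (x - w))\<^sup>2) *\<^sub>R (x - w)) \<bullet> h)) (at x)"
    by (rule has_derivative_eq_rhs[OF has_derivative_add[OF has_derivative_add[OF d1 d2] d3]]) (simp add: inner_add_left fun_eq_iff)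
  show "((\<lambda>z. P + blinfun_apply Q (z - w) + (4 * M * (norm (z - w))\<^sup>2) *\<^sub>R (z - w)) has_derivative
      blinfun_apply (Q + (4 * M * (norm (x - w))\<^sup>2) *\<^sub>R id_blinfun + (8 * M) *\<^sub>R rank1 (x - w) (x - w))) (at x)"
    by (rule has_derivative_eq_rhs[OF has_derivative_add[OF has_derivative_add[OF has_derivative_const dQ]
            has_derivative_scaleR[OF has_derivative_mult[OF has_derivative_const dn]]]])
       (auto intro!: derivative_eq_intros simp: fun_eq_iff blinfun.add_left blinfun.scaleR_left algebra_simps)
next
  show "continuous_on UNIV (\<lambda>z. Q + (4 * M * (norm (z - w))\<^sup>2) *\<^sub>R id_blinfun + (8 * M) *\<^sub>R rank1 (z - w) (z - w))"
    by (intro continuous_intros)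
qed

text \<open>Jets are local, whereas test functions must touch globally; boundedness of
  \<open>f\<close> allows a multiple of the fourth power of the distance to bridge the gap.\<close>

lemma visc_sub_imp_jet_sub:
  fixes f :: "(real^'n) \<times> real \<Rightarrow> real"
  assumes visc: "visc_sub f w" and bound: "\<And>z. z \<in> spacetime \<Longrightarrow> \<bar>f z\<bar> \<le> 1" and "w \<in> spacetime"
  shows "jet_sub f w"
  unfolding jet_sub_def
proof (intro allI impI, elim conjE)
  fix P :: "(real^'n) \<times> real" and Q :: "(real^'n) \<times> real \<Rightarrow> (real^'n) \<times> real"
  assume linQ: "linear Q" and sym: "\<forall>y z. Q y \<bullet> z = y \<bullet> Q z"
    and ev: "\<forall>\<^sub>F h in nhds 0. f (w + h) \<le> f w + P \<bullet> h + (Q h \<bullet> h) / 2"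
  define B where "B = Blinfun Q"
  have B: "blinfun_apply B = Q"
    unfolding B_def using linQ by (intro bounded_linear_Blinfun_apply) (simp add: linear_conv_bounded_linear)
  obtain r where "r > 0" and r: "\<And>h. norm h < r \<Longrightarrow> f (w + h) \<le> f w + P \<bullet> h + (Q h \<bullet> h) / 2"
    using ev unfolding eventually_nhds_metric by (auto simp: dist_norm)
  \<comment> \<open>For |h| \<ge> r the three summands times |h|^4 outweigh the oscillation of f,
    the linear part and the quadratic part of the jet.\<close>
  define M where "M = 2 / r ^ 4 + norm P / r ^ 3 + norm B / r\<^sup>2"
  define \<phi> where "\<phi> z = P \<bullet> (z - w) + (blinfun_apply B (z - w) \<bullet> (z - w)) / 2 + M * ((norm (z - w))\<^sup>2 * (norm (z - w))\<^sup>2)" for z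
  define G where "G z = P + blinfun_apply B (z - w) + (4 * M * (norm (z - w))\<^sup>2) *\<^sub>R (z - w)" for z
  define H where "H z = B + (4 * M * (norm (z - w))\<^sup>2) *\<^sub>R id_blinfun + (8 * M) *\<^sub>R rank1 (z - w) (z - w)" for z
  have C2: "C2_fun \<phi> G H"
    unfolding \<phi>_def G_def H_def by (rule C2_fun_quadratic_quartic) (simp add: B sym)
  have "M \<ge> 0" using \<open>r > 0\<close> by (simp add: M_def)
  have max: "f z - \<phi> z \<le> f w - \<phi> w" if "z \<in> spacetime" for z
  proof -
    define h where "h = z - w"
    have z: "z = w + h" by (simp add: h_def)
    have \<phi>w: "\<phi> w = 0" by (simp add: \<phi>_def blinfun.zero_right)
    have \<phi>z: "\<phi> z = P \<bullet> h + (Q h \<bullet> h) / 2 + M * norm h ^ 4"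
      by (simp add: \<phi>_def h_def B flip: power_add)
    show ?thesis
    proof (cases "norm h < r")
      case True
      have "f z \<le> f w + P \<bullet> h + (Q h \<bullet> h) / 2" using r[OF True] by (simp add: z)
      moreover have "0 \<le> M * norm h ^ 4" using \<open>M \<ge> 0\<close> by simp
      ultimately show ?thesis unfolding \<phi>w \<phi>z by linarith
    next
      case False
      then have rh: "r \<le> norm h" by simp
      have "2 / r ^ 4 * norm h ^ 4 \<ge> 2"
        using \<open>r > 0\<close> power_mono[OF rh, of 4] by (simp add: field_simps)
      moreover have "norm P / r ^ 3 * norm h ^ 4 \<ge> norm P * norm h"
      proof -
        have "r ^ 3 * norm h \<le> norm h ^ 3 * norm h"
          using \<open>r > 0\<close> by (intro mult_right_mono power_mono rh) auto
        then have "norm P * (r ^ 3 * norm h) \<le> norm P * norm h ^ 4"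
          by (intro mult_left_mono) (auto simp: power_numeral_reduce mult_ac)
        then show ?thesis using \<open>r > 0\<close> by (simp add: field_simps)
      qed
      moreover have "norm B / r\<^sup>2 * norm h ^ 4 \<ge> norm B * norm h * norm h"
      proof -
        have "r\<^sup>2 * (norm h)\<^sup>2 \<le> (norm h)\<^sup>2 * (norm h)\<^sup>2"
          using \<open>r > 0\<close> by (intro mult_right_mono power_mono rh) auto
        then have "norm B * (r\<^sup>2 * (norm h)\<^sup>2) \<le> norm B * norm h ^ 4"
          by (intro mult_left_mono) (auto simp: power_numeral_reduce mult_ac)
        then show ?thesis using \<open>r > 0\<close> by (simp add: field_simps power2_eq_square)
      qed
      moreover have "\<bar>P \<bullet> h\<bar> \<le> norm P * norm h" by (rule Cauchy_Schwarz_ineq2)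
      moreover have "\<bar>Q h \<bullet> h\<bar> \<le> norm B * norm h * norm h"
        using Cauchy_Schwarz_ineq2[of "Q h" h] mult_right_mono[OF norm_blinfun[of B h], of "norm h"] by (simp add: B)
      moreover have "f z \<le> 1" "- 1 \<le> f w" using bound[OF that] bound[OF \<open>w \<in> spacetime\<close>] by (auto simp: abs_le_iff)
      moreover have "0 \<le> norm B * norm h * norm h" by simp
      ultimately show ?thesis unfolding \<phi>w \<phi>z M_def by (simp only: distrib_right)
    qed
  qed
  define L where "L h = fst (Q (h, 0))" for h
  have linL: "linear L"
    unfolding L_def by (rule linearI) (use linear_add[OF linQ, of "(_, 0)" "(_, 0)"] linear_scale[OF linQ, of _ "(_, 0)"] in auto)
  have Gw: "G w = P" and Hw: "space_hessian (H w) = matrix L"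
    by (simp_all add: G_def H_def space_hessian_def B L_def[abs_def] blinfun.zero_right blinfun.add_left blinfun.scaleR_left linear_0[OF linQ])
  have ineq: "ereal (snd P) + F_lower (fst P) (matrix L) \<le> 0"
    using visc C2 max Gw Hw unfolding visc_sub_def by metis
  have conclude: "snd P \<le> - c" if "ereal c \<le> F_lower (fst P) (matrix L)" for c
  proof -
    have "ereal (snd P) + ereal c \<le> 0"
      using order_trans[OF add_left_mono[OF that] ineq] .
    then show ?thesis by simp
  qed
  show "(fst P \<noteq> 0 \<longrightarrow> snd P \<le> mean_curv (fst P) (\<lambda>h. fst (Q (h, 0)))) \<and>
     (\<forall>K. (\<forall>h. \<bar>fst (Q (h, 0)) \<bullet> h\<bar> \<le> K * (norm h)\<^sup>2) \<longrightarrow> snd P \<le> (real CARD('n) + 1) * K)"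
    unfolding L_def[symmetric]
  proof (intro conjI impI allI)
    assume "fst P \<noteq> 0"
    from conclude[OF F_lower_ge[OF this]] show "snd P \<le> mean_curv (fst P) L"
      by (simp add: F_mc_matrix[OF linL])
  next
    fix K assume "\<forall>h. \<bar>L h \<bullet> h\<bar> \<le> K * (norm h)\<^sup>2"
    then have "\<bar>h \<bullet> (matrix L *v h)\<bar> \<le> K * (norm h)\<^sup>2" for h
      by (simp add: matrix_linear_apply[OF linL] inner_commute)
    from conclude[OF F_lower_ge_bound[OF this]] show "snd P \<le> (real CARD('n) + 1) * K" by simp
  qed
qed

section \<open>The comparison principle\<close>

lemma usc_on_compact_attains_sup:
  fixes f :: "'a::topological_space \<Rightarrow> real"
  assumes usc: "usc_on S f" and K: "compact K" "K \<subseteq> S" "K \<noteq> {}"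
  shows "\<exists>w\<in>K. \<forall>w'\<in>K. f w' \<le> f w"
proof (rule ccontr)
  assume "\<not> ?thesis"
  then have "\<forall>w\<in>K. \<exists>b. b \<in> K \<and> f w < f b" by (auto simp: not_le)
  from bchoice[OF this] obtain b where b: "\<And>w. w \<in> K \<Longrightarrow> b w \<in> K" "\<And>w. w \<in> K \<Longrightarrow> f w < f (b w)"
    by blast
  have "\<forall>w\<in>K. \<exists>U. open U \<and> w \<in> U \<and> (\<forall>y\<in>U \<inter> S. f y < f (b w))"
  proof
    fix w assume w: "w \<in> K"
    then have "\<forall>\<^sub>F y in at w within S. f y < f (b w)"
      using usc K(2) b(2) unfolding usc_on_def by blast
    then obtain U where "open U" "w \<in> U" "\<And>y. y \<in> U \<Longrightarrow> y \<noteq> w \<Longrightarrow> y \<in> S \<Longrightarrow> f y < f (b w)"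
      unfolding eventually_at_topological by blast
    then show "\<exists>U. open U \<and> w \<in> U \<and> (\<forall>y\<in>U \<inter> S. f y < f (b w))"
      using b(2)[OF w] by (intro exI[of _ U]) (metis IntE)
  qed
  from bchoice[OF this] obtain U where U: "\<And>w. w \<in> K \<Longrightarrow> open (U w)" "\<And>w. w \<in> K \<Longrightarrow> w \<in> U w"
    "\<And>w y. w \<in> K \<Longrightarrow> y \<in> U w \<Longrightarrow> y \<in> S \<Longrightarrow> f y < f (b w)" by blast
  obtain D where D: "D \<subseteq> K" "finite D" "K \<subseteq> (\<Union>w\<in>D. U w)"
    by (rule compactE_image[OF K(1), of K U]) (use U(1,2) in auto)
  have "D \<noteq> {}" using D(3) K(3) by auto
  define m where "m = Max ((\<lambda>w. f (b w)) ` D)"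
  have "m \<in> (\<lambda>w. f (b w)) ` D" unfolding m_def using D(2) \<open>D \<noteq> {}\<close> by (intro Max_in) auto
  then obtain w where w: "w \<in> D" "m = f (b w)" by blast
  obtain v where v: "v \<in> D" "b w \<in> U v" using D b(1)[of w] w(1) by blast
  have "m < f (b v)" unfolding w(2) using U(3)[of v "b w"] v D(1) b(1)[of w] w(1) K(2) by blast
  moreover have "f (b v) \<le> m" unfolding m_def using D(2) v(1) by (intro Max_ge) auto
  ultimately show False by simp
qed

lemma usc_on_attains_sup:
  fixes f :: "'a::euclidean_space \<Rightarrow> real"
  assumes usc: "usc_on S f" and "closed S" "p \<in> S"
    and far: "\<And>w. w \<in> S \<Longrightarrow> R < norm w \<Longrightarrow> f w \<le> f p"
  shows "\<exists>w\<in>S. \<forall>w'\<in>S. f w' \<le> f w"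
proof -
  define K where "K = S \<inter> cball 0 (max R (norm p))"
  have "compact K" unfolding K_def using \<open>closed S\<close> by (intro closed_Int_compact) auto
  moreover have "p \<in> K" using \<open>p \<in> S\<close> by (simp add: K_def)
  ultimately obtain w where w: "w \<in> K" "\<And>w'. w' \<in> K \<Longrightarrow> f w' \<le> f w"
    using usc_on_compact_attains_sup[OF usc, of K] K_def by blast
  have "f w' \<le> f w" if "w' \<in> S" for w'
  proof (cases "w' \<in> K")
    case False
    then have "R < norm w'" using that by (auto simp: K_def)
    then show ?thesis using far[OF that] w(2)[OF \<open>p \<in> K\<close>] by simp
  qed (use w in auto)
  then show ?thesis using w(1) by (auto simp: K_def)
qed

lemma usc_on_add_continuous:
  fixes f :: "'a::topological_space \<Rightarrow> real"
  assumes usc: "usc_on S f" and cont: "continuous_on S g"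
  shows "usc_on S (\<lambda>x. f x + g x)"
  unfolding usc_on_def
proof (intro ballI allI impI)
  fix x a assume x: "x \<in> S" and a: "f x + g x < a"
  define e where "e = (a - f x - g x) / 2"
  have "e > 0" using a by (simp add: e_def)
  have "\<forall>\<^sub>F y in at x within S. f y < f x + e"
    using usc x \<open>e > 0\<close> unfolding usc_on_def by simp
  moreover have "\<forall>\<^sub>F y in at x within S. g y < g x + e"
    using cont x \<open>e > 0\<close> unfolding continuous_on_def by (intro order_tendstoD(2)) auto
  ultimately show "\<forall>\<^sub>F y in at x within S. f y + g y < a"
    by eventually_elim (simp add: e_def field_simps)
qed

lemma usc_on_sequence:
  fixes f :: "'a::topological_space \<Rightarrow> real"
  assumes usc: "usc_on S f" and X: "\<And>n. X n \<in> S" "X \<longlonglongrightarrow> l" and l: "l \<in> S" "f l < a"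
  shows "\<forall>\<^sub>F n in sequentially. f (X n) < a"
proof -
  have "\<forall>\<^sub>F y in at l within S. f y < a" using usc l unfolding usc_on_def by blast
  then obtain U where U: "open U" "l \<in> U" "\<And>y. y \<in> U \<Longrightarrow> y \<noteq> l \<Longrightarrow> y \<in> S \<Longrightarrow> f y < a"
    unfolding eventually_at_topological by blast
  have "\<forall>\<^sub>F n in sequentially. X n \<in> U" using X(2) U(1,2) by (rule topological_tendstoD)
  then show ?thesis by (rule eventually_mono) (metis U(3) X(1) l(2))
qed

lemma closed_spacetime: "closed (spacetime :: ((real^'n) \<times> real) set)"
  unfolding spacetime_def by (intro closed_Times) auto

section \<open>Sup-convolutions with a kernel quartic in space and quadratic in time\<close>

definition penalty :: "real \<Rightarrow> real \<Rightarrow> (real^'n) \<times> real \<Rightarrow> real" where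
  "penalty \<alpha> \<beta> z = \<alpha> * norm (fst z) ^ 4 + \<beta> * (snd z)\<^sup>2"

lemma sup_convolution_attained:
  fixes f :: "(real^'n) \<times> real \<Rightarrow> real"
  assumes usc: "usc_on spacetime f" and bound: "\<And>z. z \<in> spacetime \<Longrightarrow> \<bar>f z\<bar> \<le> 1" and "0 < \<alpha>" "0 < \<beta>"
  shows "\<exists>w\<in>spacetime. \<forall>w'\<in>spacetime. f w' - penalty \<alpha> \<beta> (z - w') \<le> f w - penalty \<alpha> \<beta> (z - w)"
proof -
  define w0 :: "(real^'n) \<times> real" where "w0 = (0, 0)"
  have w0: "w0 \<in> spacetime" by (simp add: w0_def spacetime_def)
  \<comment> \<open>A penalty of at least \<open>C\<close> exceeds that of the reference point by 2,
    more than the oscillation of \<open>f\<close> can compensate; beyond the radius below one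
    component forces such a penalty.\<close>
  define C where "C = 2 + penalty \<alpha> \<beta> (z - w0)"
  have "penalty \<alpha> \<beta> (z - w0) \<ge> 0" using \<open>0 < \<alpha>\<close> \<open>0 < \<beta>\<close> by (simp add: penalty_def)
  then have "C > 0" by (simp add: C_def)
  define \<rho> where "\<rho> = 1 + C / \<alpha> + C / \<beta>"
  have \<rho>: "1 \<le> \<rho>" "C \<le> \<alpha> * \<rho>" "C \<le> \<beta> * \<rho>"
    using \<open>C > 0\<close> \<open>0 < \<alpha>\<close> \<open>0 < \<beta>\<close> by (auto simp: \<rho>_def distrib_left)
  have "continuous_on spacetime (\<lambda>w. - penalty \<alpha> \<beta> (z - w))"
    unfolding penalty_def by (intro continuous_intros)
  from usc_on_add_continuous[OF usc this]
  have u: "usc_on spacetime (\<lambda>w. f w - penalty \<alpha> \<beta> (z - w))" by simp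
  show ?thesis
  proof (rule usc_on_attains_sup[OF u closed_spacetime w0, where R = "norm z + 2 * \<rho>"])
    fix w :: "(real^'n) \<times> real" assume w: "w \<in> spacetime" and R: "norm z + 2 * \<rho> < norm w"
    have "2 * \<rho> < norm (z - w)" using R norm_triangle_ineq4[of z "z - w"] by simp
    also have "\<dots> \<le> norm (fst (z - w)) + norm (snd (z - w))"
      using norm_Pair_le[of "fst (z - w)" "snd (z - w)"] by (simp only: prod.collapse)
    finally have "\<rho> < norm (fst (z - w)) \<or> \<rho> < \<bar>snd (z - w)\<bar>" by auto
    then have "C \<le> penalty \<alpha> \<beta> (z - w)"
    proof
      assume *: "\<rho> < norm (fst (z - w))"
      have "norm (fst (z - w)) ^ 1 \<le> norm (fst (z - w)) ^ 4"
        using * \<rho> by (intro power_increasing) auto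
      then have "\<alpha> * \<rho> \<le> \<alpha> * norm (fst (z - w)) ^ 4"
        using * \<open>0 < \<alpha>\<close> by simp
      moreover have "0 \<le> \<beta> * (snd (z - w))\<^sup>2" using \<open>0 < \<beta>\<close> by simp
      ultimately show ?thesis using \<rho> unfolding penalty_def by linarith
    next
      assume *: "\<rho> < \<bar>snd (z - w)\<bar>"
      have "\<bar>snd (z - w)\<bar> ^ 1 \<le> \<bar>snd (z - w)\<bar> ^ 2"
        using * \<rho> by (intro power_increasing) auto
      then have "\<beta> * \<rho> \<le> \<beta> * (snd (z - w))\<^sup>2"
        using * \<open>0 < \<beta>\<close> by simp
      moreover have "0 \<le> \<alpha> * norm (fst (z - w)) ^ 4" using \<open>0 < \<alpha>\<close> by simp
      ultimately show ?thesis using \<rho> unfolding penalty_def by linarith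
    qed
    then show "f w - penalty \<alpha> \<beta> (z - w) \<le> f w0 - penalty \<alpha> \<beta> (z - w0)"
      using bound[OF w] bound[OF w0] by (simp add: C_def abs_le_iff)
  qed
qed

text \<open>Squaring |a|^2 + 2 a.h + |h|^2 and using the Cauchy-Schwarz inequality on the higher
  terms; the coefficient 6 is 4 + 2.\<close>

lemma quartic_upper_bound:
  fixes a h :: "'a::real_inner"
  shows "norm (a + h) ^ 4 \<le> norm a ^ 4 + 4 * (norm a)\<^sup>2 * (a \<bullet> h) + 6 * (norm a)\<^sup>2 * (norm h)\<^sup>2 + 4 * norm a * norm h ^ 3 + norm h ^ 4"
proof -
  define s c k where "s = norm a" and "c = a \<bullet> h" and "k = norm h"
  have c: "\<bar>c\<bar> \<le> s * k" unfolding s_def c_def k_def by (rule Cauchy_Schwarz_ineq2)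
  have "(norm (a + h))\<^sup>2 = s\<^sup>2 + 2 * c + k\<^sup>2"
    unfolding s_def c_def k_def power2_norm_eq_inner by (simp add: inner_add_left inner_add_right inner_commute)
  then have "norm (a + h) ^ 4 = (s\<^sup>2 + 2 * c + k\<^sup>2)\<^sup>2"
    by (metis power_mult[of "norm (a + h)" 2 2] mult_2 numeral_Bit0)
  also have "\<dots> = s ^ 4 + 4 * s\<^sup>2 * c + (4 * c\<^sup>2 + 2 * s\<^sup>2 * k\<^sup>2) + 4 * (c * k\<^sup>2) + k ^ 4"
    by (simp add: power2_eq_square power4_eq_xxxx algebra_simps)
  also have "c\<^sup>2 \<le> s\<^sup>2 * k\<^sup>2"
    using power_mono[OF c, of 2] by (simp add: power_mult_distrib)
  also have "c * k\<^sup>2 \<le> (s * k) * k\<^sup>2" using c by (intro mult_right_mono) auto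
  finally show ?thesis unfolding s_def c_def k_def by (simp add: power2_eq_square power3_eq_cube mult_ac)
qed

text \<open>With the contact point fixed, the kernel bounds the sup-convolution from below. Its
  Hessian is controlled only where the spatial offset is, so long spatial increments need a
  different comparison point.\<close>

lemma sup_convolution_semiconvex:
  fixes f :: "(real^'n) \<times> real \<Rightarrow> real"
  assumes bound: "\<And>z. z \<in> spacetime \<Longrightarrow> \<bar>f z\<bar> \<le> 1" and "0 < \<alpha>" "0 < \<beta>"
    and W: "\<And>z. W z \<in> spacetime" "\<And>z w. w \<in> spacetime \<Longrightarrow> f w - penalty \<alpha> \<beta> (z - w) \<le> f (W z) - penalty \<alpha> \<beta> (z - W z)"
  obtains \<Lambda> where "0 < \<Lambda>" "semiconvex \<Lambda> (\<lambda>z. f (W z) - penalty \<alpha> \<beta> (z - W z))"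
proof -
  \<comment> \<open>\<open>S\<close> bounds the spatial offset: moving the contact point to the
    spatial position of \<open>z\<close> removes the spatial penalty and loses at most 2 in
    \<open>f\<close>, so \<alpha> s^4 \<le> 2.\<close>
  define S where "S = 1 + 2 / \<alpha>"
  have "S \<ge> 1" using \<open>0 < \<alpha>\<close> by (simp add: S_def)
  define \<Lambda> where "\<Lambda> = \<beta> + \<alpha> * (6 * S\<^sup>2 + 4 * S + 1) + 2 + 4 * \<alpha> * S ^ 3"
  define A where "A z = f (W z) - penalty \<alpha> \<beta> (z - W z)" for z
  have "A z + (- (4 * \<alpha> * (norm (fst (z - W z)))\<^sup>2) *\<^sub>R fst (z - W z), - 2 * \<beta> * snd (z - W z)) \<bullet> h - \<Lambda> * (norm h)\<^sup>2 \<le> A (z + h)" for z h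
  proof -
    define a b where "a = fst (z - W z)" and "b = snd (z - W z)"
    define hx ht where "hx = fst h" and "ht = snd h"
    define s c k where "s = norm a" and "c = a \<bullet> hx" and "k = norm hx"
    have s0: "0 \<le> s" and k0: "0 \<le> k" by (simp_all add: s_def k_def)
    have h: "h = (hx, ht)" by (simp add: hx_def ht_def)
    have nh: "(norm h)\<^sup>2 = k\<^sup>2 + ht\<^sup>2" by (simp add: h norm_Pair k_def)
    have W_mem: "(y, snd (W z)) \<in> spacetime" for y using W(1)[of z] by (auto simp: spacetime_def)
    have "\<alpha> * s ^ 4 \<le> 2"
    proof -
      have "f (fst z, snd (W z)) - \<beta> * b\<^sup>2 \<le> A z"
        using W(2)[OF W_mem, of "fst z" z] by (simp add: A_def penalty_def b_def)
      then show ?thesis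
        using bound[OF W_mem, of "fst z"] bound[OF W(1)[of z]] by (simp add: A_def penalty_def a_def b_def s_def abs_le_iff)
    qed
    have sS: "s \<le> S"
    proof (cases "s \<le> 1")
      case False
      then have "s ^ 1 \<le> s ^ 4" by (intro power_increasing) auto
      also have "s ^ 4 \<le> 2 / \<alpha>" using \<open>\<alpha> * s ^ 4 \<le> 2\<close> \<open>0 < \<alpha>\<close> by (simp add: field_simps)
      finally show ?thesis by (simp add: S_def)
    qed (use \<open>S \<ge> 1\<close> in simp)
    have c: "\<bar>c\<bar> \<le> s * k" unfolding s_def c_def k_def by (rule Cauchy_Schwarz_ineq2)
    have Az: "A z = f (W z) - \<alpha> * s ^ 4 - \<beta> * b\<^sup>2" by (simp add: A_def penalty_def a_def b_def s_def)
    have lhs: "A z + (- (4 * \<alpha> * (norm (fst (z - W z)))\<^sup>2) *\<^sub>R fst (z - W z), - 2 * \<beta> * snd (z - W z)) \<bullet> h - \<Lambda> * (norm h)\<^sup>2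
      = f (W z) - \<alpha> * s ^ 4 - \<beta> * b\<^sup>2 - 4 * \<alpha> * s\<^sup>2 * c - 2 * \<beta> * b * ht - \<Lambda> * k\<^sup>2 - \<Lambda> * ht\<^sup>2"
      unfolding Az nh by (simp add: h a_def b_def s_def c_def distrib_left)
    have \<Lambda>\<beta>: "\<beta> * ht\<^sup>2 \<le> \<Lambda> * ht\<^sup>2"
      using \<open>0 < \<alpha>\<close> \<open>S \<ge> 1\<close> by (intro mult_right_mono) (auto simp: \<Lambda>_def)
    have bt: "\<beta> * (b + ht)\<^sup>2 = \<beta> * b\<^sup>2 + 2 * \<beta> * b * ht + \<beta> * ht\<^sup>2"
      by (simp add: power2_eq_square algebra_simps)
    show ?thesis
    proof (cases "k \<le> 1")
      case True
      have "A (z + h) \<ge> f (W z) - penalty \<alpha> \<beta> (z + h - W z)"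
        using W(2)[OF W(1), of z "z + h"] by (simp add: A_def)
      also have "penalty \<alpha> \<beta> (z + h - W z) = \<alpha> * norm (a + hx) ^ 4 + \<beta> * (b + ht)\<^sup>2"
        by (simp add: penalty_def a_def b_def hx_def ht_def algebra_simps)
      finally have 1: "f (W z) - (\<alpha> * norm (a + hx) ^ 4 + \<beta> * (b + ht)\<^sup>2) \<le> A (z + h)" .
      have "norm (a + hx) ^ 4 \<le> s ^ 4 + 4 * s\<^sup>2 * c + 6 * s\<^sup>2 * k\<^sup>2 + 4 * s * k ^ 3 + k ^ 4"
        unfolding s_def c_def k_def by (rule quartic_upper_bound)
      also have "6 * s\<^sup>2 * k\<^sup>2 \<le> 6 * S\<^sup>2 * k\<^sup>2"
        using sS s0 by (intro mult_right_mono mult_left_mono power_mono) auto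
      also have "4 * s * k ^ 3 \<le> 4 * S * k\<^sup>2"
        using sS s0 True k0 \<open>S \<ge> 1\<close> by (intro mult_mono power_decreasing) auto
      also have "k ^ 4 \<le> k\<^sup>2" using True k0 by (intro power_decreasing) auto
      finally have "\<alpha> * norm (a + hx) ^ 4 \<le> \<alpha> * (s ^ 4 + 4 * s\<^sup>2 * c + 6 * S\<^sup>2 * k\<^sup>2 + 4 * S * k\<^sup>2 + k\<^sup>2)"
        using \<open>0 < \<alpha>\<close> by simp
      moreover have "\<alpha> * (6 * S\<^sup>2 + 4 * S + 1) * k\<^sup>2 \<le> \<Lambda> * k\<^sup>2"
        using \<open>0 < \<alpha>\<close> \<open>0 < \<beta>\<close> \<open>S \<ge> 1\<close> by (intro mult_right_mono) (auto simp: \<Lambda>_def)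
      ultimately show ?thesis unfolding lhs using 1 bt \<Lambda>\<beta> by (simp add: algebra_simps)
    next
      case False
      \<comment> \<open>For long increments the fourth power decreases too fast. The contact point
        is moved to the spatial position of z + h instead; only the time penalty remains, and the
        loss of at most 2 is absorbed by 2 k^2.\<close>
      have "A (z + h) \<ge> f (fst z + hx, snd (W z)) - penalty \<alpha> \<beta> (z + h - (fst z + hx, snd (W z)))"
        using W(2)[OF W_mem] by (simp add: A_def)
      also have "penalty \<alpha> \<beta> (z + h - (fst z + hx, snd (W z))) = \<beta> * (b + ht)\<^sup>2"
        by (simp add: penalty_def b_def hx_def ht_def algebra_simps)
      finally have 1: "f (W z) - 2 - \<beta> * (b + ht)\<^sup>2 \<le> A (z + h)"
        using bound[OF W_mem, of "fst z + hx"] bound[OF W(1)[of z]] by (simp add: abs_le_iff)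
      have "s\<^sup>2 * \<bar>c\<bar> \<le> S\<^sup>2 * (S * (k * k))"
      proof (intro mult_mono power_mono)
        have "s * k \<le> S * (k * k)" using False sS s0 by (intro mult_mono) auto
        then show "\<bar>c\<bar> \<le> S * (k * k)" using c by linarith
      qed (use sS s0 in auto)
      then have "\<alpha> * (s\<^sup>2 * \<bar>c\<bar>) \<le> \<alpha> * (S\<^sup>2 * (S * (k * k)))" using \<open>0 < \<alpha>\<close> by simp
      moreover have "- (\<alpha> * (s\<^sup>2 * c)) \<le> \<alpha> * (s\<^sup>2 * \<bar>c\<bar>)"
        using \<open>0 < \<alpha>\<close> by (metis abs_ge_minus_self abs_mult abs_of_nonneg less_imp_le zero_le_power2)
      moreover have "(2 + 4 * \<alpha> * S ^ 3) * k\<^sup>2 \<le> \<Lambda> * k\<^sup>2"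
        using \<open>0 < \<alpha>\<close> \<open>0 < \<beta>\<close> \<open>S \<ge> 1\<close> by (intro mult_right_mono) (auto simp: \<Lambda>_def)
      moreover have "2 \<le> 2 * k\<^sup>2" using False by simp
      moreover have "0 \<le> \<alpha> * s ^ 4" using \<open>0 < \<alpha>\<close> s0 by simp
      ultimately show ?thesis unfolding lhs using 1 bt \<Lambda>\<beta> by (simp add: algebra_simps power2_eq_square power3_eq_cube)
    qed
  qed
  then have "semiconvex \<Lambda> A" unfolding semiconvex_def by blast
  moreover have "0 < \<Lambda>" using \<open>0 < \<alpha>\<close> \<open>0 < \<beta>\<close> \<open>S \<ge> 1\<close> by (simp add: \<Lambda>_def add_pos_nonneg)
  ultimately show thesis using that unfolding A_def by blast
qed

lemma semiconvex_penalty: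
  fixes A :: "(real^'n) \<times> real \<Rightarrow> real"
  assumes "semiconvex \<Lambda> A" "0 \<le> \<delta>"
  shows "semiconvex (\<Lambda> + \<delta> + c) (\<lambda>z. A z - \<delta> * (norm (fst z))\<^sup>2 - \<eta> * snd z - c * (norm (z - z0))\<^sup>2)"
  unfolding semiconvex_def
proof
  fix z
  obtain q where q: "\<And>h. A z + q \<bullet> h - \<Lambda> * (norm h)\<^sup>2 \<le> A (z + h)"
    using assms unfolding semiconvex_def by blast
  let ?B = "\<lambda>z. A z - \<delta> * (norm (fst z))\<^sup>2 - \<eta> * snd z - c * (norm (z - z0))\<^sup>2"
  let ?q = "q - ((2 * \<delta>) *\<^sub>R fst z, \<eta>) - (2 * c) *\<^sub>R (z - z0)"
  have "?B z + ?q \<bullet> h - (\<Lambda> + \<delta> + c) * (norm h)\<^sup>2 \<le> ?B (z + h)" for h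
  proof -
    have 1: "(norm (fst (z + h)))\<^sup>2 = (norm (fst z))\<^sup>2 + 2 * (fst z \<bullet> fst h) + (norm (fst h))\<^sup>2"
      unfolding power2_norm_eq_inner by (simp add: inner_add_left inner_add_right inner_commute)
    have 2: "(norm (z + h - z0))\<^sup>2 = (norm (z - z0))\<^sup>2 + 2 * ((z - z0) \<bullet> h) + (norm h)\<^sup>2"
      unfolding power2_norm_eq_inner by (simp add: inner_add_left inner_add_right inner_diff_left inner_diff_right inner_commute)
    have "(norm (fst h))\<^sup>2 \<le> (norm h)\<^sup>2" by (simp add: norm_prod_def)
    then have 3: "\<delta> * (norm (fst h))\<^sup>2 \<le> \<delta> * (norm h)\<^sup>2" using \<open>0 \<le> \<delta>\<close> by (rule mult_left_mono)
    have 4: "?q \<bullet> h = q \<bullet> h - 2 * \<delta> * (fst z \<bullet> fst h) - \<eta> * snd h - 2 * c * ((z - z0) \<bullet> h)"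
      by (simp only: inner_diff_left inner_scaleR_left) (simp add: inner_prod_def)
    show ?thesis using q[of h] 3 unfolding 1 2 4 by (simp add: distrib_left distrib_right)
  qed
  then show "\<exists>q. \<forall>h. ?B z + q \<bullet> h - (\<Lambda> + \<delta> + c) * (norm h)\<^sup>2 \<le> ?B (z + h)" by blast
qed

section \<open>Jets at contact points and their incompatibility\<close>

lemma nonneg_by_scaling:
  fixes X Y :: real
  assumes "0 < b" and "\<And>t. 0 < t \<Longrightarrow> t < b \<Longrightarrow> 0 \<le> X + t * Y"
  shows "0 \<le> X"
proof (rule tendsto_lowerbound)
  show "((\<lambda>t. X + t * Y) \<longlongrightarrow> X) (at_right 0)" by (auto intro!: tendsto_eq_intros)
  show "\<forall>\<^sub>F t in at_right 0. 0 \<le> X + t * Y"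
    using assms by (intro eventually_at_rightI[of 0 b]) auto
qed simp

text \<open>A quadratic above the kernel must have its first-order term and at least its
  second-order term. The constant 12 is twice the 6 of \<open>quartic_upper_bound\<close>, because
  the form enters with the factor 1/2.\<close>

lemma quartic_touched_above:
  fixes a p :: "'a::euclidean_space" and L :: "'a \<Rightarrow> 'a"
  assumes linL: "linear L" and "0 \<le> \<alpha>"
    and touch: "\<forall>\<^sub>F h in nhds 0. - (\<alpha> * (norm (a + h) ^ 4 - norm a ^ 4)) \<le> p \<bullet> h + (L h \<bullet> h) / 2"
  shows "p = - (4 * \<alpha> * (norm a)\<^sup>2) *\<^sub>R a" and "- (12 * \<alpha> * (norm a)\<^sup>2) * (norm h)\<^sup>2 \<le> L h \<bullet> h"
proof -
  obtain r where "r > 0" and r: "\<And>h. norm h < r \<Longrightarrow> - (\<alpha> * (norm (a + h) ^ 4 - norm a ^ 4)) \<le> p \<bullet> h + (L h \<bullet> h) / 2"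
    using touch unfolding eventually_nhds_metric by (auto simp: dist_norm)
  define v where "v = p + (4 * \<alpha> * (norm a)\<^sup>2) *\<^sub>R a"
  have v: "- (v \<bullet> h) \<le> (L h \<bullet> h) / 2 + \<alpha> * (6 * (norm a)\<^sup>2 * (norm h)\<^sup>2 + 4 * norm a * norm h ^ 3 + norm h ^ 4)" if "norm h < r" for h
  proof -
    have "\<alpha> * norm (a + h) ^ 4 \<le> \<alpha> * (norm a ^ 4 + 4 * (norm a)\<^sup>2 * (a \<bullet> h) + 6 * (norm a)\<^sup>2 * (norm h)\<^sup>2 + 4 * norm a * norm h ^ 3 + norm h ^ 4)"
      by (rule mult_left_mono[OF quartic_upper_bound \<open>0 \<le> \<alpha>\<close>])
    then show ?thesis using r[OF that] by (simp add: v_def inner_add_left algebra_simps)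
  qed
  obtain B where B: "\<And>h. norm (L h) \<le> B * norm h"
    using linear_bounded[OF linL] by blast
  have "- v = 0"
  proof (rule linear_le_quadratic_imp_zero[of "min r 1"])
    fix h :: 'a assume h: "norm h < min r 1"
    have "norm h ^ 3 \<le> (norm h)\<^sup>2" "norm h ^ 4 \<le> (norm h)\<^sup>2" using h by (auto intro!: power_decreasing)
    then have "4 * norm a * norm h ^ 3 \<le> 4 * norm a * (norm h)\<^sup>2" "norm h ^ 4 \<le> (norm h)\<^sup>2"
      by (auto intro: mult_left_mono)
    then have "6 * (norm a)\<^sup>2 * (norm h)\<^sup>2 + 4 * norm a * norm h ^ 3 + norm h ^ 4 \<le> (6 * (norm a)\<^sup>2 + 4 * norm a + 1) * (norm h)\<^sup>2"
      by (simp add: distrib_right)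
    then have "\<alpha> * (6 * (norm a)\<^sup>2 * (norm h)\<^sup>2 + 4 * norm a * norm h ^ 3 + norm h ^ 4) \<le> \<alpha> * ((6 * (norm a)\<^sup>2 + 4 * norm a + 1) * (norm h)\<^sup>2)"
      using \<open>0 \<le> \<alpha>\<close> by (rule mult_left_mono)
    moreover have "L h \<bullet> h \<le> B * (norm h)\<^sup>2"
      using norm_cauchy_schwarz[of "L h" h] mult_right_mono[OF B[of h], of "norm h"] by (simp add: power2_eq_square mult.assoc)
    ultimately show "- v \<bullet> h \<le> (B / 2 + \<alpha> * (6 * (norm a)\<^sup>2 + 4 * norm a + 1)) * (norm h)\<^sup>2"
      using v[of h] h by (simp add: distrib_right mult.assoc)
  qed (use \<open>r > 0\<close> in simp)
  then have v0: "v = 0" by simp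
  then show "p = - (4 * \<alpha> * (norm a)\<^sup>2) *\<^sub>R a" by (simp add: v_def eq_neg_iff_add_eq_0)
  \<comment> \<open>Replacing h by t h and dividing by t^2 leaves remainders of order t.\<close>
  have "0 \<le> (L h \<bullet> h) / 2 + 6 * \<alpha> * (norm a)\<^sup>2 * (norm h)\<^sup>2"
  proof (rule nonneg_by_scaling[where b = "min 1 (r / (norm h + 1))" and Y = "\<alpha> * (4 * norm a * norm h ^ 3 + norm h ^ 4)"])
    show "0 < min 1 (r / (norm h + 1))" using \<open>r > 0\<close> by (simp add: add_nonneg_pos)
    fix t :: real assume t: "0 < t" "t < min 1 (r / (norm h + 1))"
    then have "t * (norm h + 1) < r" by (simp add: pos_less_divide_eq add_nonneg_pos)
    moreover have "t * norm h \<le> t * (norm h + 1)" using t by (intro mult_left_mono) auto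
    ultimately have "t * norm h < r" by linarith
    then have "norm (t *\<^sub>R h) < r" using t by simp
    from v[OF this] have "0 \<le> t\<^sup>2 * ((L h \<bullet> h) / 2 + 6 * \<alpha> * (norm a)\<^sup>2 * (norm h)\<^sup>2) + \<alpha> * (4 * norm a * (t ^ 3 * norm h ^ 3) + t ^ 4 * norm h ^ 4)"
      using t by (simp add: v0 linear_scale[OF linL] power_mult_distrib algebra_simps power2_eq_square)
    also have "\<alpha> * (4 * norm a * (t ^ 3 * norm h ^ 3) + t ^ 4 * norm h ^ 4) \<le> \<alpha> * (4 * norm a * (t ^ 3 * norm h ^ 3) + t ^ 3 * norm h ^ 4)"
      using t \<open>0 \<le> \<alpha>\<close> by (intro mult_left_mono add_left_mono mult_right_mono power_decreasing) auto
    also have "\<dots> = t\<^sup>2 * (t * (\<alpha> * (4 * norm a * norm h ^ 3 + norm h ^ 4)))"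
      by (simp add: power2_eq_square power3_eq_cube algebra_simps)
    finally have "0 \<le> t\<^sup>2 * ((L h \<bullet> h) / 2 + 6 * \<alpha> * (norm a)\<^sup>2 * (norm h)\<^sup>2 + t * (\<alpha> * (4 * norm a * norm h ^ 3 + norm h ^ 4)))"
      by (simp only: distrib_left)
    then show "0 \<le> (L h \<bullet> h) / 2 + 6 * \<alpha> * (norm a)\<^sup>2 * (norm h)\<^sup>2 + t * (\<alpha> * (4 * norm a * norm h ^ 3 + norm h ^ 4))"
      using t by (simp add: zero_le_mult_iff)
  qed
  then show "- (12 * \<alpha> * (norm a)\<^sup>2) * (norm h)\<^sup>2 \<le> L h \<bullet> h" by simp
qed

text \<open>Polarisation; rescaling \<open>u\<close> to the length of \<open>v\<close> first makes
  the parallelogram identity yield the product of the norms.\<close>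

lemma selfadjoint_form_bound:
  fixes L :: "'a::real_inner \<Rightarrow> 'a"
  assumes linL: "linear L" and sym: "\<And>x y. L x \<bullet> y = x \<bullet> L y" and K: "\<And>h. \<bar>L h \<bullet> h\<bar> \<le> K * (norm h)\<^sup>2"
  shows "\<bar>L u \<bullet> v\<bar> \<le> K * (norm u * norm v)"
proof (cases "u = 0 \<or> v = 0")
  case True
  then show ?thesis using linear_0[OF linL] by auto
next
  case False
  define s where "s = norm v / norm u"
  have "s > 0" using False by (simp add: s_def)
  let ?u = "s *\<^sub>R u"
  have nu: "norm ?u = norm v" using False by (simp add: s_def)
  have "4 * (L ?u \<bullet> v) = L (?u + v) \<bullet> (?u + v) - L (?u - v) \<bullet> (?u - v)"
    using sym[of v ?u] by (simp add: linear_add[OF linL] linear_diff[OF linL] inner_add_left inner_add_right inner_diff_left inner_diff_right inner_commute)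
  then have "\<bar>4 * (L ?u \<bullet> v)\<bar> \<le> K * (norm (?u + v))\<^sup>2 + K * (norm (?u - v))\<^sup>2"
    using K[of "?u + v"] K[of "?u - v"] by linarith
  also have "\<dots> = K * (2 * (norm ?u)\<^sup>2 + 2 * (norm v)\<^sup>2)"
    unfolding power2_norm_eq_inner distrib_left[symmetric]
    by (simp add: inner_add_left inner_add_right inner_diff_left inner_diff_right inner_commute)
  also have "\<dots> = 4 * (K * (norm v)\<^sup>2)" unfolding nu by simp
  finally have "\<bar>L ?u \<bullet> v\<bar> \<le> K * (norm v)\<^sup>2" by (simp only: abs_mult)
  moreover have "(norm v)\<^sup>2 = s * (norm u * norm v)" using False by (simp add: s_def power2_eq_square)
  moreover have "\<bar>L ?u \<bullet> v\<bar> = s * \<bar>L u \<bullet> v\<bar>" using \<open>s > 0\<close> by (simp add: linear_scale[OF linL] abs_mult)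
  ultimately have "s * \<bar>L u \<bullet> v\<bar> \<le> s * (K * (norm u * norm v))" by (simp add: mult_ac)
  then show ?thesis using \<open>s > 0\<close> by simp
qed

text \<open>Both vectors are divided by |p|. The correction this causes for \<open>q\<close> has
  norm | |p| - |q| | / |p|, which is again at most |p + q| / |p|.\<close>

lemma norm_add_unit_vectors:
  fixes p q :: "'a::real_normed_vector"
  assumes "p \<noteq> 0" "q \<noteq> 0"
  shows "norm (p /\<^sub>R norm p + q /\<^sub>R norm q) \<le> 2 * norm (p + q) / norm p"
proof -
  have "p /\<^sub>R norm p + q /\<^sub>R norm q = (p + q) /\<^sub>R norm p + (1 / norm q - 1 / norm p) *\<^sub>R q"
    by (simp add: algebra_simps divide_inverse)
  also have "norm \<dots> \<le> norm ((p + q) /\<^sub>R norm p) + norm ((1 / norm q - 1 / norm p) *\<^sub>R q)"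
    by (rule norm_triangle_ineq)
  also have "norm ((1 / norm q - 1 / norm p) *\<^sub>R q) = \<bar>norm p - norm q\<bar> / norm p"
  proof -
    have "(1 / norm q - 1 / norm p) * norm q = (norm p - norm q) / norm p" using assms by (simp add: field_simps)
    then have "\<bar>(1 / norm q - 1 / norm p) * norm q\<bar> = \<bar>(norm p - norm q) / norm p\<bar>" by (rule arg_cong)
    then show ?thesis by (simp add: abs_mult)
  qed
  also have "\<bar>norm p - norm q\<bar> \<le> norm (p + q)"
    using norm_triangle_ineq3[of p "- q"] by simp
  finally show ?thesis using assms by (simp add: divide_inverse mult.commute distrib_right add_divide_distrib)
qed

text \<open>As L2 is \<mu> times the identity minus L1, the traces cancel up to \<mu> n. For the
  unit vectors e1 and e2 the remaining difference of forms is L1 (e1 + e2) tested with e1 - e2, and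
  e1 + e2 is small.\<close>

lemma mean_curv_near_opposite:
  fixes p1 p2 :: "real^'n"
  assumes lin1: "linear L1" and sym1: "\<And>x y. L1 x \<bullet> y = x \<bullet> L1 y" and K: "\<And>h. \<bar>L1 h \<bullet> h\<bar> \<le> K * (norm h)\<^sup>2"
    and sum: "\<And>h. L1 h + L2 h = \<mu> *\<^sub>R h" and "0 \<le> \<mu>" and "p1 \<noteq> 0" "p2 \<noteq> 0"
  shows "mean_curv p1 L1 + mean_curv p2 L2 \<le> \<mu> * real CARD('n) + 4 * K * norm (p1 + p2) / norm p1"
proof -
  define e1 e2 where "e1 = p1 /\<^sub>R norm p1" and "e2 = p2 /\<^sub>R norm p2"
  have n: "norm e1 = 1" "norm e2 = 1" using assms by (simp_all add: e1_def e2_def)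
  have "K \<ge> 0" using order_trans[OF abs_ge_zero K[of e1]] n by simp
  have m: "mean_curv p L = (\<Sum>b\<in>Basis. L b \<bullet> b) - L (p /\<^sub>R norm p) \<bullet> (p /\<^sub>R norm p)" if "linear L" for p :: "real^'n" and L
    by (simp add: mean_curv_def linear_scale[OF that] power2_eq_square divide_inverse mult_ac)
  have L2: "L2 h = \<mu> *\<^sub>R h - L1 h" for h using sum[of h] by (simp add: algebra_simps)
  have lin2: "linear L2"
    unfolding L2[abs_def] by (intro linear_compose_sub linear_scaleR lin1)
  have tr: "(\<Sum>b\<in>Basis. L2 b \<bullet> b) = \<mu> * real CARD('n) - (\<Sum>b\<in>Basis. L1 b \<bullet> b)"
    by (simp add: L2 inner_diff_left sum_subtractf)
  have "L1 (e1 + e2) \<bullet> (e1 - e2) = L1 e1 \<bullet> e1 - L1 e2 \<bullet> e2"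
    using sym1[of e1 e2] by (simp add: linear_add[OF lin1] inner_add_left inner_diff_right inner_commute[of "L1 e2" e1])
  moreover have "\<bar>L1 (e1 + e2) \<bullet> (e1 - e2)\<bar> \<le> K * (norm (e1 + e2) * norm (e1 - e2))"
    by (rule selfadjoint_form_bound[OF lin1 sym1 K])
  moreover have "K * (norm (e1 + e2) * norm (e1 - e2)) \<le> K * ((2 * norm (p1 + p2) / norm p1) * 2)"
      (is "_ \<le> ?R")
    using norm_triangle_ineq4[of e1 e2] n \<open>K \<ge> 0\<close> norm_add_unit_vectors[OF \<open>p1 \<noteq> 0\<close> \<open>p2 \<noteq> 0\<close>]
    unfolding e1_def[symmetric] e2_def[symmetric] by (intro mult_left_mono mult_mono) auto
  moreover have "?R = 4 * K * norm (p1 + p2) / norm p1" by simp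
  ultimately have "- (L1 e1 \<bullet> e1) + L1 e2 \<bullet> e2 \<le> 4 * K * norm (p1 + p2) / norm p1"
    by linarith
  moreover have "L2 e2 \<bullet> e2 = \<mu> - L1 e2 \<bullet> e2"
    using n by (simp add: L2 inner_diff_left dot_square_norm)
  ultimately show ?thesis
    unfolding m[OF lin1] m[OF lin2] tr e1_def[symmetric] e2_def[symmetric] using \<open>0 \<le> \<mu>\<close> by simp
qed

text \<open>The conclusion of \<open>jet_sub\<close> for time slope \<open>s\<close>, spatial
  gradient \<open>p\<close> and spatial Hessian \<open>L\<close>, detached from the
  function.\<close>

definition jet_ineq :: "real \<Rightarrow> real^'n \<Rightarrow> (real^'n \<Rightarrow> real^'n) \<Rightarrow> bool" where
  "jet_ineq s p L \<longleftrightarrow> (p \<noteq> 0 \<longrightarrow> s \<le> mean_curv p L) \<and>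
     (\<forall>K. (\<forall>h. \<bar>L h \<bullet> h\<bar> \<le> K * (norm h)\<^sup>2) \<longrightarrow> s \<le> (real CARD('n) + 1) * K)"

lemma jets_incompatible_large_gradient:
  fixes p1 p2 :: "real^'n"
  assumes jets: "jet_ineq s1 p1 L1" "jet_ineq s2 p2 L2"
    and lin1: "linear L1" and sym1: "\<And>x y. L1 x \<bullet> y = x \<bullet> L1 y" and K: "\<And>h. \<bar>L1 h \<bullet> h\<bar> \<le> K * (norm h)\<^sup>2"
    and sum: "\<And>h. L1 h + L2 h = \<mu> *\<^sub>R h" "0 \<le> \<mu>"
    and p: "0 < \<theta>" "\<theta> \<le> norm p1" "norm (p1 + p2) \<le> \<tau>" "\<tau> \<le> \<theta> / 2"
  shows "s1 + s2 \<le> \<mu> * real CARD('n) + 4 * K * \<tau> / \<theta>"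
proof -
  have "p1 \<noteq> 0" using p by auto
  moreover have "p2 \<noteq> 0" using p by auto
  ultimately have "s1 + s2 \<le> mean_curv p1 L1 + mean_curv p2 L2"
    using jets unfolding jet_ineq_def by (intro add_mono) auto
  also have "\<dots> \<le> \<mu> * real CARD('n) + 4 * K * norm (p1 + p2) / norm p1"
    by (rule mean_curv_near_opposite) fact+
  also have "4 * K * norm (p1 + p2) / norm p1 \<le> 4 * K * \<tau> / \<theta>"
  proof -
    obtain b :: "real^'n" where "b \<in> Basis" using nonempty_Basis by blast
    then have "K \<ge> 0" using order_trans[OF abs_ge_zero K[of b]] by simp
    then show ?thesis using p by (intro frac_le mult_left_mono mult_nonneg_nonneg) (auto intro: order_trans[OF norm_ge_zero])
  qed
  finally show ?thesis by simp
qed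

text \<open>
  What is known of the jet of a sup-convolution with the quartic kernel at distance \<open>a\<close> from the contact point:
  both the gradient and the lower bound of the Hessian are controlled by \<open>a\<close>.
\<close>

definition contact_jet :: "real \<Rightarrow> real \<Rightarrow> real^'n \<Rightarrow> (real^'n \<Rightarrow> real^'n) \<Rightarrow> real^'n \<Rightarrow> bool" where
  "contact_jet \<alpha> s p L a \<longleftrightarrow> jet_ineq s p L \<and> linear L \<and> (\<forall>x y. L x \<bullet> y = x \<bullet> L y) \<and>
     p = - (4 * \<alpha> * (norm a)\<^sup>2) *\<^sub>R a \<and> (\<forall>h. - (12 * \<alpha> * (norm a)\<^sup>2) * (norm h)\<^sup>2 \<le> L h \<bullet> h) \<and> \<alpha> * norm a ^ 4 \<le> 4"

text \<open>Each Hessian is bounded below by its contact jet; since the sum is \<mu> times the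
  identity, the lower bound of one is an upper bound of the other.\<close>

lemma contact_jets_form_bound:
  assumes "contact_jet \<alpha> s1 p1 L1 a1" "contact_jet \<alpha> s2 p2 L2 a2"
    and sum: "\<And>h. L1 h + L2 h = \<mu> *\<^sub>R h" and "0 \<le> \<mu>" "\<mu> + 12 * \<alpha> * (norm a1)\<^sup>2 \<le> K" "\<mu> + 12 * \<alpha> * (norm a2)\<^sup>2 \<le> K"
  shows "\<bar>L1 h \<bullet> h\<bar> \<le> K * (norm h)\<^sup>2"
proof -
  have 1: "- (12 * \<alpha> * (norm a1)\<^sup>2) * (norm h)\<^sup>2 \<le> L1 h \<bullet> h" and 2: "- (12 * \<alpha> * (norm a2)\<^sup>2) * (norm h)\<^sup>2 \<le> L2 h \<bullet> h"
    using assms(1,2) unfolding contact_jet_def by blast+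
  have "L1 h \<bullet> h + L2 h \<bullet> h = (L1 h + L2 h) \<bullet> h" by (simp add: inner_add_left)
  also have "\<dots> = \<mu> * (norm h)\<^sup>2" unfolding sum by (simp add: dot_square_norm)
  finally have "L1 h \<bullet> h \<le> (\<mu> + 12 * \<alpha> * (norm a2)\<^sup>2) * (norm h)\<^sup>2"
    using 2 by (simp add: distrib_right)
  also have "\<dots> \<le> K * (norm h)\<^sup>2" using assms by (intro mult_right_mono) auto
  finally have up: "L1 h \<bullet> h \<le> K * (norm h)\<^sup>2" .
  have "(12 * \<alpha> * (norm a1)\<^sup>2) * (norm h)\<^sup>2 \<le> K * (norm h)\<^sup>2" using assms by (intro mult_right_mono) auto
  then show ?thesis using 1 up by (simp add: abs_le_iff)
qed

text \<open>\<open>\<epsilon>0\<close> depends only on \<alpha>, \<eta> and the dimension, since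
  \<epsilon> is fixed before the jets are found. If one offset is at least \<rho>, its gradient is
  bounded below and the mean curvatures nearly cancel; if both are smaller, the Hessians are small
  and the second clause of \<open>jet_ineq\<close> applies.\<close>

lemma jets_incompatible:
  fixes \<alpha> \<eta> :: real
  assumes "0 < \<alpha>" "0 < \<eta>"
  shows "\<exists>\<epsilon>0>0. \<forall>\<epsilon> s1 s2 p1 p2 L1 L2 a1 a2 \<mu>. 0 < \<epsilon> \<and> \<epsilon> \<le> \<epsilon>0 \<and>
     contact_jet \<alpha> s1 p1 (L1 :: real^'n \<Rightarrow> real^'n) a1 \<and> contact_jet \<alpha> s2 p2 L2 a2 \<and>
     (\<forall>h. L1 h + L2 h = \<mu> *\<^sub>R h) \<and> 0 \<le> \<mu> \<and> \<mu> \<le> 8 * \<epsilon> \<and> norm (p1 + p2) \<le> 7 * \<epsilon> \<longrightarrow> s1 + s2 < \<eta> - 3 * \<epsilon>"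
proof -
  define n where "n = real CARD('n)"
  have "n \<ge> 1" by (simp add: n_def Suc_leI)
  \<comment> \<open>Two Hessians bounded by 12 \<alpha> \<rho>^2, each with the factor n + 1, then
    contribute exactly \<eta> / 4.\<close>
  define \<rho> where "\<rho> = sqrt (\<eta> / (96 * (n + 1) * \<alpha>))"
  have "\<rho> > 0" using assms \<open>n \<ge> 1\<close> by (simp add: \<rho>_def)
  have \<rho>2: "24 * (n + 1) * \<alpha> * \<rho>\<^sup>2 = \<eta> / 4"
    using assms \<open>n \<ge> 1\<close> by (simp add: \<rho>_def field_simps add_nonneg_eq_0_iff)
  define \<theta> where "\<theta> = 4 * \<alpha> * \<rho> ^ 3"
  have "\<theta> > 0" using \<open>0 < \<alpha>\<close> \<open>\<rho> > 0\<close> by (simp add: \<theta>_def)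
  \<comment> \<open>56 is 48 + 8: the contact bound gives 12 \<alpha> |a|^2 \<le> 12 \<alpha> + 48,
    and \<mu> is at most 8 when \<epsilon> is at most 1.\<close>
  define K0 where "K0 = 56 + 12 * \<alpha>"
  have "K0 > 0" using \<open>0 < \<alpha>\<close> by (simp add: K0_def)
  \<comment> \<open>11 n collects 8 n from \<mu> n and 3 n to cover the 3 \<epsilon> of the claim;
    28 is 4 times the 7 in the bound of p1 + p2.\<close>
  define D where "D = 11 * n + 28 * K0 / \<theta>"
  have "D > 0" using \<open>n \<ge> 1\<close> \<open>K0 > 0\<close> \<open>\<theta> > 0\<close> by (simp add: D_def add_pos_pos)
  \<comment> \<open>In this order: \<mu> \<le> 8, the small-offset case, 7 \<epsilon> \<le> \<theta>
    / 2, and \<epsilon> D \<le> \<eta> / 2.\<close>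
  define \<epsilon>0 where "\<epsilon>0 = Min {1, \<eta> / (80 * (n + 1)), \<theta> / 14, \<eta> / (2 * D)}"
  have "\<epsilon>0 > 0" using assms \<open>n \<ge> 1\<close> \<open>\<theta> > 0\<close> \<open>D > 0\<close> by (simp add: \<epsilon>0_def)
  have large: "s1 + s2 < \<eta> - 3 * \<epsilon>"
    if \<epsilon>: "0 < \<epsilon>" "\<epsilon> \<le> \<epsilon>0" and c: "contact_jet \<alpha> s1 p1 (L1 :: real^'n \<Rightarrow> real^'n) a1" "contact_jet \<alpha> s2 p2 L2 a2"
      and sum: "\<And>h. L1 h + L2 h = \<mu> *\<^sub>R h" and \<mu>: "0 \<le> \<mu>" "\<mu> \<le> 8 * \<epsilon>" and pp: "norm (p1 + p2) \<le> 7 * \<epsilon>" and a: "\<rho> \<le> norm a1"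
    for \<epsilon> s1 s2 p1 p2 L1 L2 a1 a2 \<mu>
  proof -
    have \<epsilon>1: "\<epsilon> \<le> 1" "\<epsilon> \<le> \<theta> / 14" "\<epsilon> \<le> \<eta> / (2 * D)" using \<epsilon> by (auto simp: \<epsilon>0_def)
    have sq: "12 * \<alpha> * (norm a)\<^sup>2 \<le> 12 * \<alpha> + 48" if "\<alpha> * norm a ^ 4 \<le> 4" for a :: "real^'n"
    proof -
      define x where "x = (norm a)\<^sup>2"
      have "norm a ^ 4 = x * x" by (simp add: x_def flip: power_add)
      moreover have "x \<le> 1 + x * x"
      proof -
        have "0 \<le> (x - 1/2)\<^sup>2" by simp
        then show ?thesis by (simp add: power2_eq_square algebra_simps)
      qed
      then have "\<alpha> * x \<le> \<alpha> * (1 + x * x)" using \<open>0 < \<alpha>\<close> by simp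
      ultimately show ?thesis using that unfolding x_def[symmetric] by (simp add: distrib_left)
    qed
    have K: "\<bar>L1 h \<bullet> h\<bar> \<le> K0 * (norm h)\<^sup>2" for h
    proof (rule contact_jets_form_bound[OF c sum])
      show "0 \<le> \<mu>" by fact
      show "\<mu> + 12 * \<alpha> * (norm a1)\<^sup>2 \<le> K0" "\<mu> + 12 * \<alpha> * (norm a2)\<^sup>2 \<le> K0"
        using sq[of a1] sq[of a2] c \<mu> \<epsilon>1 unfolding contact_jet_def K0_def by auto
    qed
    have np: "\<theta> \<le> norm p1"
    proof -
      have "norm p1 = 4 * \<alpha> * ((norm a1)\<^sup>2 * norm a1)" using c(1) \<open>0 < \<alpha>\<close> unfolding contact_jet_def by simp
      also have "(norm a1)\<^sup>2 * norm a1 = norm a1 ^ 3" by (simp add: power2_eq_square power3_eq_cube)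
      finally show ?thesis unfolding \<theta>_def using a \<open>0 < \<rho>\<close> \<open>0 < \<alpha>\<close> by (simp add: power_mono)
    qed
    have "s1 + s2 \<le> \<mu> * real CARD('n) + 4 * K0 * (7 * \<epsilon>) / \<theta>"
    proof (rule jets_incompatible_large_gradient)
      show "jet_ineq s1 p1 L1" "jet_ineq s2 p2 L2" "linear L1" using c unfolding contact_jet_def by blast+
      show "L1 x \<bullet> y = x \<bullet> L1 y" for x y using c(1) unfolding contact_jet_def by blast
    qed (use sum \<mu> \<open>0 < \<theta>\<close> np pp \<epsilon>1 K in auto)
    also have "\<mu> * real CARD('n) \<le> 8 * \<epsilon> * n" unfolding n_def using \<mu> by (intro mult_right_mono) auto
    finally have "s1 + s2 \<le> \<epsilon> * (8 * n + 28 * K0 / \<theta>)" by (simp add: algebra_simps)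
    also have "\<dots> \<le> \<epsilon> * (D - 3 * n)" by (simp add: D_def)
    also have "\<dots> \<le> \<epsilon> * D - 3 * \<epsilon>" using \<epsilon> \<open>n \<ge> 1\<close> by (simp add: algebra_simps)
    also have "\<epsilon> * D \<le> \<eta> / 2" using \<epsilon>1(3) \<open>D > 0\<close> by (simp add: field_simps)
    finally show ?thesis using \<open>0 < \<eta>\<close> by simp
  qed
  show ?thesis
  proof (intro exI[of _ \<epsilon>0] conjI[OF \<open>\<epsilon>0 > 0\<close>] allI impI, elim conjE)
    fix \<epsilon> s1 s2 p1 p2 and L1 L2 :: "real^'n \<Rightarrow> real^'n" and a1 a2 \<mu>
    assume \<epsilon>: "0 < \<epsilon>" "\<epsilon> \<le> \<epsilon>0" and c: "contact_jet \<alpha> s1 p1 L1 a1" "contact_jet \<alpha> s2 p2 L2 a2"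
      and sum: "\<forall>h. L1 h + L2 h = \<mu> *\<^sub>R h" and \<mu>: "0 \<le> \<mu>" "\<mu> \<le> 8 * \<epsilon>" and pp: "norm (p1 + p2) \<le> 7 * \<epsilon>"
    consider "\<rho> \<le> norm a1" | "\<rho> \<le> norm a2" | "norm a1 < \<rho>" "norm a2 < \<rho>" by linarith
    then show "s1 + s2 < \<eta> - 3 * \<epsilon>"
    proof cases
      case 1
      show ?thesis by (rule large[OF \<epsilon> c _ \<mu> pp 1]) (use sum in simp)
    next
      case 2
      have "s2 + s1 < \<eta> - 3 * \<epsilon>"
        by (rule large[OF \<epsilon> c(2,1) _ \<mu> _ 2]) (use sum pp in \<open>simp_all add: add.commute\<close>)
      then show ?thesis by simp
    next
      case 3
      define K where "K = 8 * \<epsilon> + 12 * \<alpha> * \<rho>\<^sup>2"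
      have "12 * \<alpha> * (norm a)\<^sup>2 \<le> 12 * \<alpha> * \<rho>\<^sup>2" if "norm a < \<rho>" for a :: "real^'n"
        using that \<open>0 < \<alpha>\<close> by (intro mult_left_mono power_mono) auto
      then have aK: "\<mu> + 12 * \<alpha> * (norm a1)\<^sup>2 \<le> K" "\<mu> + 12 * \<alpha> * (norm a2)\<^sup>2 \<le> K"
        using 3 \<mu> unfolding K_def by (meson add_mono)+
      have "\<bar>L1 h \<bullet> h\<bar> \<le> K * (norm h)\<^sup>2" for h
        by (rule contact_jets_form_bound[OF c _ \<mu>(1) aK]) (use sum in simp)
      then have 1: "s1 \<le> (n + 1) * K" using c(1) unfolding contact_jet_def jet_ineq_def n_def by blast
      have "\<bar>L2 h \<bullet> h\<bar> \<le> K * (norm h)\<^sup>2" for h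
        by (rule contact_jets_form_bound[OF c(2,1) _ \<mu>(1) aK(2,1)]) (use sum in \<open>simp add: add.commute\<close>)
      then have 2: "s2 \<le> (n + 1) * K" using c(2) unfolding contact_jet_def jet_ineq_def n_def by blast
      have "s1 + s2 \<le> 2 * (n + 1) * K" using 1 2 by (simp add: algebra_simps)
      also have "\<dots> = 16 * (n + 1) * \<epsilon> + 24 * (n + 1) * \<alpha> * \<rho>\<^sup>2" by (simp add: K_def algebra_simps)
      finally have "s1 + s2 \<le> 16 * ((n + 1) * \<epsilon>) + \<eta> / 4" unfolding \<rho>2 by (simp add: algebra_simps)
      moreover have "\<epsilon> \<le> \<eta> / (80 * (n + 1))" using \<epsilon> by (simp add: \<epsilon>0_def)
      then have "80 * ((n + 1) * \<epsilon>) \<le> \<eta>" using \<open>n \<ge> 1\<close> by (simp add: field_simps)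
      moreover have "\<epsilon> \<le> (n + 1) * \<epsilon>" using \<epsilon> \<open>n \<ge> 1\<close> by simp
      ultimately show ?thesis using \<open>0 < \<eta>\<close> \<epsilon> by linarith
    qed
  qed
qed

section \<open>Location of the contact points\<close>

lemma penalized_contact_bounds:
  fixes f g :: "(real^'n) \<times> real \<Rightarrow> real"
  assumes bounds: "\<And>z. z \<in> spacetime \<Longrightarrow> \<bar>f z\<bar> \<le> 1" "\<And>z. z \<in> spacetime \<Longrightarrow> \<bar>g z\<bar> \<le> 1"
    and pos: "0 \<le> \<alpha>" "1 \<le> \<beta>" "0 \<le> \<delta>" "0 < \<eta>" "\<eta> \<le> 1"
    and w: "w \<in> spacetime" "w' \<in> spacetime"
    and val: "0 \<le> f w + g w' - penalty \<alpha> \<beta> (z - w) - penalty \<alpha> \<beta> (z - w') - \<delta> * (norm (fst z))\<^sup>2 - \<eta> * snd z"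
  shows "\<alpha> * norm (fst (z - w)) ^ 4 \<le> 4" "\<alpha> * norm (fst (z - w')) ^ 4 \<le> 4"
    "\<beta> * (snd (z - w))\<^sup>2 \<le> 4" "\<beta> * (snd (z - w'))\<^sup>2 \<le> 4"
    "\<delta> * (norm (fst z))\<^sup>2 \<le> 4" "- 2 \<le> snd z" "\<eta> * snd z \<le> 2"
proof -
  define A1 A2 B1 B2 X t where "A1 = \<alpha> * norm (fst (z - w)) ^ 4" and "A2 = \<alpha> * norm (fst (z - w')) ^ 4"
    and "B1 = \<beta> * (snd (z - w))\<^sup>2" and "B2 = \<beta> * (snd (z - w'))\<^sup>2" and "X = \<delta> * (norm (fst z))\<^sup>2" and "t = snd z"
  have nonneg: "0 \<le> A1" "0 \<le> A2" "0 \<le> B1" "0 \<le> B2" "0 \<le> X"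
    using pos by (simp_all add: A1_def A2_def B1_def B2_def X_def)
  \<comment> \<open>The two functions contribute at most 2, so a nonnegative value bounds all
    penalties together.\<close>
  have total: "A1 + A2 + B1 + B2 + X + \<eta> * t \<le> 2"
    using val bounds(1)[OF w(1)] bounds(2)[OF w(2)]
    by (simp add: penalty_def A1_def A2_def B1_def B2_def X_def t_def abs_le_iff)
  have t2: "- 2 \<le> t \<and> - 2 \<le> \<eta> * t"
  proof (cases "0 \<le> t")
    case True
    moreover from True have "0 \<le> \<eta> * t" using pos by simp
    ultimately show ?thesis by simp
  next
    \<comment> \<open>For negative t both contact times lie at distance at least |t|, so each time
      penalty is at least t^2, as \<beta> \<ge> 1. Then 2 t^2 + t \<le> 2, which fails for t <
      -2.\<close>
    case False
    have "t\<^sup>2 \<le> (snd (z - v))\<^sup>2" if "v \<in> spacetime" for v :: "(real^'n) \<times> real"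
    proof -
      have "\<bar>t\<bar> \<le> \<bar>snd (z - v)\<bar>" using that False by (auto simp: spacetime_def t_def)
      then show ?thesis by (rule abs_le_square_iff[THEN iffD1])
    qed
    from this[OF w(1)] this[OF w(2)] have "t\<^sup>2 \<le> B1" "t\<^sup>2 \<le> B2"
      using pos mult_right_mono[of 1 \<beta> "(snd (z - w))\<^sup>2"] mult_right_mono[of 1 \<beta> "(snd (z - w'))\<^sup>2"]
      by (simp_all add: B1_def B2_def)
    moreover have "t \<le> \<eta> * t" using False pos by (simp add: mult_le_cancel_right1)
    ultimately have "2 * t\<^sup>2 + t \<le> 2" using total nonneg by linarith
    then have "- 2 \<le> t"
    proof (rule_tac ccontr)
      assume "2 * t\<^sup>2 + t \<le> 2" "\<not> - 2 \<le> t"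
      moreover from this have "2 * 2 \<le> (- t) * (- t)" by (intro mult_mono) auto
      ultimately have "2 * (-t) \<le> (-t) * (-t)" by (intro mult_right_mono) auto
      with \<open>2 * t\<^sup>2 + t \<le> 2\<close> \<open>2 * 2 \<le> (- t) * (- t)\<close> show False by (simp add: power2_eq_square)
    qed
    then show ?thesis using \<open>t \<le> \<eta> * t\<close> by simp
  qed
  show "\<alpha> * norm (fst (z - w)) ^ 4 \<le> 4" "\<alpha> * norm (fst (z - w')) ^ 4 \<le> 4"
    "\<beta> * (snd (z - w))\<^sup>2 \<le> 4" "\<beta> * (snd (z - w'))\<^sup>2 \<le> 4"
    "\<delta> * (norm (fst z))\<^sup>2 \<le> 4" "- 2 \<le> snd z" "\<eta> * snd z \<le> 2"
    using total t2 nonneg unfolding A1_def[symmetric] A2_def[symmetric] B1_def[symmetric] B2_def[symmetric] X_def[symmetric] t_def[symmetric]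
    by linarith+
qed

text \<open>The origin of the kernel constant: 4 (4 / d)^4 turns a penalty of at most 4 into an
  offset of at most d / 4, so that two contact points of the same \<open>z\<close> are less than d
  apart in space.\<close>

lemma le_of_power4:
  fixes s d :: real
  assumes "0 < d" "0 \<le> s" "4 * (4 / d) ^ 4 * s ^ 4 \<le> 4"
  shows "s \<le> d / 4"
proof (rule ccontr)
  assume "\<not> s \<le> d / 4"
  then have "(4 / d) * s > 1" using \<open>0 < d\<close> by (simp add: field_simps)
  then have "((4 / d) * s) ^ 4 > 1" by (intro one_less_power) auto
  then show False using assms(3) unfolding power_mult_distrib by simp
qed

text \<open>Compactness. If every \<beta> failed, the bounded counterexamples would have a limit;
  the growing time penalty makes its three times equal, one of the contact times being 0 makes them
  all 0, and there the initial bound and upper semicontinuity contradict the value.\<close>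

lemma contact_at_positive_times:
  fixes f g :: "(real^'n) \<times> real \<Rightarrow> real"
  assumes usc: "usc_on spacetime f" "usc_on spacetime g"
    and bounds: "\<And>z. z \<in> spacetime \<Longrightarrow> \<bar>f z\<bar> \<le> 1" "\<And>z. z \<in> spacetime \<Longrightarrow> \<bar>g z\<bar> \<le> 1"
    and "0 \<le> c" "0 < \<sigma>" "0 < d" and init: "\<And>x y. dist x y < d \<Longrightarrow> f (x, 0) + g (y, 0) \<le> c + \<sigma>"
    and \<alpha>: "\<alpha> = 4 * (4 / d) ^ 4" and pos: "0 < \<delta>" "0 < \<eta>" "\<eta> \<le> 1"
  shows "\<exists>\<beta>\<ge>1. \<forall>z w w'. w \<in> spacetime \<longrightarrow> w' \<in> spacetime \<longrightarrow>
    c + 2 * \<sigma> \<le> f w + g w' - penalty \<alpha> \<beta> (z - w) - penalty \<alpha> \<beta> (z - w') - \<delta> * (norm (fst z))\<^sup>2 - \<eta> * snd z \<longrightarrow>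
    0 < snd w \<and> 0 < snd w'"
proof (rule ccontr)
  assume neg: "\<not> ?thesis"
  have "0 < \<alpha>" using \<open>0 < d\<close> by (simp add: \<alpha>)
  define val where "val \<beta> z w w' = f w + g w' - penalty \<alpha> \<beta> (z - w) - penalty \<alpha> \<beta> (z - w') - \<delta> * (norm (fst z))\<^sup>2 - \<eta> * snd z" for \<beta> z w w'
  define bad where "bad \<beta> p \<longleftrightarrow> fst (snd p) \<in> spacetime \<and> snd (snd p) \<in> spacetime \<and> c + 2 * \<sigma> \<le> val \<beta> (fst p) (fst (snd p)) (snd (snd p))
      \<and> \<not> (0 < snd (fst (snd p)) \<and> 0 < snd (snd (snd p)))" for \<beta> p
  have "\<exists>p. bad \<beta> p" if "1 \<le> \<beta>" for \<beta>
  proof -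
    from neg that obtain z w w' where "w \<in> spacetime" "w' \<in> spacetime" "c + 2 * \<sigma> \<le> val \<beta> z w w'" "\<not> (0 < snd w \<and> 0 < snd w')"
      unfolding val_def by blast
    then show ?thesis by (intro exI[of _ "(z, w, w')"]) (simp add: bad_def)
  qed
  then have "\<forall>j. \<exists>p. bad (real (Suc j)) p" by simp
  from choice[OF this] obtain p where p: "\<And>j. bad (real (Suc j)) (p j)" by blast
  define Z where "Z j = fst (p j)" for j
  define W where "W j = fst (snd (p j))" for j
  define W' where "W' j = snd (snd (p j))" for j
  have mem: "W j \<in> spacetime" "W' j \<in> spacetime" and v: "c + 2 * \<sigma> \<le> val (real (Suc j)) (Z j) (W j) (W' j)"
    and bad: "\<not> (0 < snd (W j) \<and> 0 < snd (W' j))" for j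
    using p[of j] unfolding bad_def Z_def W_def W'_def by auto
  have b: "\<alpha> * norm (fst (Z j - W j)) ^ 4 \<le> 4" "\<alpha> * norm (fst (Z j - W' j)) ^ 4 \<le> 4"
    "real (Suc j) * (snd (Z j - W j))\<^sup>2 \<le> 4" "real (Suc j) * (snd (Z j - W' j))\<^sup>2 \<le> 4"
    "\<delta> * (norm (fst (Z j)))\<^sup>2 \<le> 4" "- 2 \<le> snd (Z j)" "\<eta> * snd (Z j) \<le> 2" for j
  proof -
    have "0 \<le> val (real (Suc j)) (Z j) (W j) (W' j)" using v[of j] \<open>0 \<le> c\<close> \<open>0 < \<sigma>\<close> by linarith
    note * = penalized_contact_bounds[where f = f and g = g and \<alpha> = \<alpha> and \<beta> = "real (Suc j)" and \<delta> = \<delta> and \<eta> = \<eta>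
        and z = "Z j" and w = "W j" and w' = "W' j", OF bounds _ _ _ _ _ mem this[unfolded val_def]]
    show "\<alpha> * norm (fst (Z j - W j)) ^ 4 \<le> 4" "\<alpha> * norm (fst (Z j - W' j)) ^ 4 \<le> 4"
    "real (Suc j) * (snd (Z j - W j))\<^sup>2 \<le> 4" "real (Suc j) * (snd (Z j - W' j))\<^sup>2 \<le> 4"
    "\<delta> * (norm (fst (Z j)))\<^sup>2 \<le> 4" "- 2 \<le> snd (Z j)" "\<eta> * snd (Z j) \<le> 2"
      by (rule *; use \<open>0 < \<alpha>\<close> pos in simp)+
  qed
  have near: "norm (fst (Z j - W j)) \<le> d / 4" "norm (fst (Z j - W' j)) \<le> d / 4" for j
    using le_of_power4[OF \<open>0 < d\<close> norm_ge_zero b(1)[of j, unfolded \<alpha>]]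
      le_of_power4[OF \<open>0 < d\<close> norm_ge_zero b(2)[of j, unfolded \<alpha>]] by auto
  have tnear: "\<bar>snd (Z j - W j)\<bar> \<le> 2 / sqrt (real (Suc j))" "\<bar>snd (Z j - W' j)\<bar> \<le> 2 / sqrt (real (Suc j))" for j
  proof -
    have "\<bar>y\<bar> \<le> 2 / sqrt (real (Suc j))" if "real (Suc j) * y\<^sup>2 \<le> 4" for y :: real
    proof -
      have "y\<^sup>2 \<le> 4 / real (Suc j)" using that by (simp add: field_simps)
      then have "sqrt (y\<^sup>2) \<le> sqrt (4 / real (Suc j))" by (rule real_sqrt_le_mono)
      then show ?thesis by (simp add: real_sqrt_divide)
    qed
    then show "\<bar>snd (Z j - W j)\<bar> \<le> 2 / sqrt (real (Suc j))" "\<bar>snd (Z j - W' j)\<bar> \<le> 2 / sqrt (real (Suc j))"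
      using b(3,4)[of j] by blast+
  qed
  define R where "R = sqrt (4 / \<delta>) + (2 + 2 / \<eta>)"
  have nZ: "norm (Z j) \<le> R" for j
  proof -
    have "(norm (fst (Z j)))\<^sup>2 \<le> 4 / \<delta>" using b(5)[of j] pos by (simp add: field_simps)
    then have "norm (fst (Z j)) \<le> sqrt (4 / \<delta>)" by (rule real_le_rsqrt)
    moreover have "\<bar>snd (Z j)\<bar> \<le> 2 + 2 / \<eta>"
    proof -
      have "snd (Z j) \<le> 2 / \<eta>" using b(7)[of j] pos by (simp add: field_simps)
      moreover have "0 < 2 / \<eta>" using pos by simp
      ultimately show ?thesis using b(6)[of j] unfolding abs_le_iff by linarith
    qed
    ultimately show ?thesis using norm_Pair_le[of "fst (Z j)" "snd (Z j)"] by (simp add: R_def)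
  qed
  have close: "norm (Z j - V) \<le> d / 4 + 2" if "norm (fst (Z j - V)) \<le> d / 4" "\<bar>snd (Z j - V)\<bar> \<le> 2 / sqrt (real (Suc j))" for j V
  proof -
    have "2 / sqrt (real (Suc j)) \<le> 2 / 1" by (intro divide_left_mono) auto
    then show ?thesis using that norm_Pair_le[of "fst (Z j - V)" "snd (Z j - V)"] by (simp only: prod.collapse) simp
  qed
  have nW: "norm (W j) \<le> R + (d / 4 + 2)" "norm (W' j) \<le> R + (d / 4 + 2)" for j
    using close[OF near(1) tnear(1), of j] close[OF near(2) tnear(2), of j] nZ[of j]
      norm_triangle_ineq4[of "Z j" "Z j - W j"] norm_triangle_ineq4[of "Z j" "Z j - W' j"] by simp_all
  define K where "K = cball (0 :: (real^'n) \<times> real) R \<times> cball (0 :: (real^'n) \<times> real) (R + (d / 4 + 2)) \<times> cball (0 :: (real^'n) \<times> real) (R + (d / 4 + 2))"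
  have "compact K" unfolding K_def by (intro compact_Times compact_cball)
  have "\<forall>j. (Z j, W j, W' j) \<in> K" using nZ nW by (simp add: K_def)
  then obtain l r where r: "strict_mono r" "((\<lambda>j. (Z j, W j, W' j)) \<circ> r) \<longlonglongrightarrow> l"
    by (rule seq_compactE[OF compact_imp_seq_compact[OF \<open>compact K\<close>]])
  define z w w' where "z = fst l" and "w = fst (snd l)" and "w' = snd (snd l)"
  have lim: "(\<lambda>j. Z (r j)) \<longlonglongrightarrow> z" "(\<lambda>j. W (r j)) \<longlonglongrightarrow> w" "(\<lambda>j. W' (r j)) \<longlonglongrightarrow> w'"
    using tendsto_fst[OF r(2)] tendsto_fst[OF tendsto_snd[OF r(2)]] tendsto_snd[OF tendsto_snd[OF r(2)]]
    by (simp_all add: o_def z_def w_def w'_def)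
  have wmem: "w \<in> spacetime" "w' \<in> spacetime"
    by (rule closed_sequentially[OF closed_spacetime _ lim(2)] closed_sequentially[OF closed_spacetime _ lim(3)], rule mem)+
  have sq0: "(\<lambda>j. 2 / sqrt (real (Suc (r j)))) \<longlonglongrightarrow> 0"
  proof -
    have "filterlim (\<lambda>j. sqrt (real (Suc j))) at_top sequentially"
      by (intro filterlim_compose[OF sqrt_at_top] filterlim_compose[OF filterlim_real_sequentially] filterlim_Suc)
    then have "(\<lambda>j. 2 / sqrt (real (Suc j))) \<longlonglongrightarrow> 0"
      by (intro tendsto_divide_0[OF tendsto_const] filterlim_at_top_imp_at_infinity)
    from LIMSEQ_subseq_LIMSEQ[OF this r(1)] show ?thesis by (simp add: o_def)
  qed
  \<comment> \<open>The time penalties stay below 4 while their weight tends to infinity.\<close>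
  have same: "snd z = snd w" "snd z = snd w'"
  proof -
    have "(\<lambda>j. snd (Z (r j) - W (r j))) \<longlonglongrightarrow> 0" "(\<lambda>j. snd (Z (r j) - W' (r j))) \<longlonglongrightarrow> 0"
      by (rule Lim_null_comparison[OF _ sq0]; use tnear in simp)+
    moreover have "(\<lambda>j. snd (Z (r j) - W (r j))) \<longlonglongrightarrow> snd (z - w)" "(\<lambda>j. snd (Z (r j) - W' (r j))) \<longlonglongrightarrow> snd (z - w')"
      by (intro tendsto_intros lim)+
    ultimately have "snd (z - w) = 0" "snd (z - w') = 0" using LIMSEQ_unique by blast+
    then show "snd z = snd w" "snd z = snd w'" by simp_all
  qed
  \<comment> \<open>In each counterexample one of the two times is 0; the product records this
    without deciding which one, and passes to the limit.\<close>
  have "snd w * snd w' = 0"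
  proof -
    have "snd (W j) * snd (W' j) = 0" for j
      using bad[of j] mem[of j] by (auto simp: spacetime_def)
    then have "(\<lambda>j. snd (W (r j)) * snd (W' (r j))) = (\<lambda>j. 0)" by (intro ext)
    then have "(\<lambda>j. 0) \<longlonglongrightarrow> snd w * snd w'"
      using tendsto_mult[OF tendsto_snd[OF lim(2)] tendsto_snd[OF lim(3)]] by simp
    then show ?thesis using LIMSEQ_unique tendsto_const by blast
  qed
  then have w0: "w = (fst w, 0)" "w' = (fst w', 0)" using same by (auto simp: prod_eq_iff)
  have "norm (fst (z - w)) \<le> d / 4"
    by (rule LIMSEQ_le_const2[OF tendsto_norm[OF tendsto_fst[OF tendsto_diff[OF lim(1) lim(2)]]]]) (intro exI allI impI near)
  moreover have "norm (fst (z - w')) \<le> d / 4"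
    by (rule LIMSEQ_le_const2[OF tendsto_norm[OF tendsto_fst[OF tendsto_diff[OF lim(1) lim(3)]]]]) (intro exI allI impI near)
  ultimately have "dist (fst w) (fst w') \<le> d / 4 + d / 4"
    using dist_triangle3[of "fst w" "fst w'" "fst z"] by (simp add: dist_norm norm_minus_commute)
  then have le: "f w + g w' \<le> c + \<sigma>" using init[of "fst w" "fst w'"] w0 \<open>0 < d\<close> by simp
  have "\<forall>\<^sub>F j in sequentially. f (W (r j)) < f w + \<sigma> / 4"
    by (rule usc_on_sequence[OF usc(1) _ lim(2)]) (use mem wmem \<open>0 < \<sigma>\<close> in auto)
  moreover have "\<forall>\<^sub>F j in sequentially. g (W' (r j)) < g w' + \<sigma> / 4"
    by (rule usc_on_sequence[OF usc(2) _ lim(3)]) (use mem wmem \<open>0 < \<sigma>\<close> in auto)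
  moreover have "\<forall>\<^sub>F j in sequentially. - \<sigma> / 4 < \<eta> * snd (Z (r j))"
  proof -
    have "(\<lambda>j. \<eta> * snd (Z (r j))) \<longlonglongrightarrow> \<eta> * snd z" by (intro tendsto_intros lim)
    moreover have "\<eta> * snd z = 0" using same w0 by (metis mult_zero_right snd_conv)
    ultimately show ?thesis using \<open>0 < \<sigma>\<close> by (intro order_tendstoD(1)[of _ 0]) auto
  qed
  \<comment> \<open>Each of the three limits costs a quarter of \<sigma>, so the value would be
    below c + \<sigma> + 3 \<sigma> / 4.\<close>
  ultimately have "\<forall>\<^sub>F j in sequentially. False"
  proof (eventually_elim)
    case (elim j)
    have "0 \<le> penalty \<alpha> (real (Suc (r j))) y" for y :: "(real^'n) \<times> real" using \<open>0 < \<alpha>\<close> by (simp add: penalty_def)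
    note pen = this[of "Z (r j) - W (r j)"] this[of "Z (r j) - W' (r j)"]
    have "0 \<le> \<delta> * (norm (fst (Z (r j))))\<^sup>2" using pos by simp
    with pen have "c + 2 * \<sigma> \<le> f (W (r j)) + g (W' (r j)) - \<eta> * snd (Z (r j))"
      using v[of "r j"] unfolding val_def by linarith
    then show False using elim le \<open>0 < \<sigma>\<close> by linarith
  qed
  then show False by simp
qed

text \<open>Moving \<open>z\<close> and the contact point together leaves the penalty unchanged, so
  the jet of the sup-convolution is a jet of \<open>f\<close> at \<open>W z\<close>. Moving
  \<open>z\<close> alone puts the kernel below the same quadratic, which determines the gradient and
  bounds the Hessian.\<close>

lemma sup_convolution_contact_jet:
  fixes f :: "(real^'n) \<times> real \<Rightarrow> real"
  assumes W: "\<And>z. W z \<in> spacetime" "\<And>z w. w \<in> spacetime \<Longrightarrow> f w - penalty \<alpha> \<beta> (z - w) \<le> f (W z) - penalty \<alpha> \<beta> (z - W z)"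
    and "0 < \<alpha>" and small: "\<alpha> * norm (fst (z - W z)) ^ 4 \<le> 4" and pos: "0 < snd (W z)" and jet: "jet_sub f (W z)"
    and linL: "linear L" and sym: "\<And>x y. L x \<bullet> y = x \<bullet> L y"
    and touch: "\<forall>\<^sub>F h in nhds 0. f (W (z + h)) - penalty \<alpha> \<beta> (z + h - W (z + h)) \<le> f (W z) - penalty \<alpha> \<beta> (z - W z) + P \<bullet> h + (L h \<bullet> h) / 2"
  shows "contact_jet \<alpha> (snd P) (fst P) (\<lambda>h. fst (L (h, 0))) (fst (z - W z))"
proof -
  define M where "M h = fst (L (h, 0))" for h
  have linM: "linear M"
    unfolding M_def by (rule linearI) (use linear_add[OF linL, of "(_, 0)" "(_, 0)"] linear_scale[OF linL, of _ "(_, 0)"] in auto)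
  have symM: "M x \<bullet> y = x \<bullet> M y" for x y
    using sym[of "(x, 0)" "(y, 0)"] by (simp add: M_def inner_prod_def)
  have "\<forall>\<^sub>F h in nhds 0. f (W z + h) \<le> f (W z) + P \<bullet> h + (L h \<bullet> h) / 2"
  proof -
    have "((\<lambda>h::(real^'n) \<times> real. snd (W z) + snd h) \<longlongrightarrow> snd (W z) + snd (0 :: (real^'n) \<times> real)) (nhds 0)"
      by (rule tendsto_add[OF tendsto_const tendsto_snd[OF filterlim_ident]])
    \<comment> \<open>A positive contact time keeps \<open>W z + h\<close> in
      \<open>spacetime\<close> for all small h, including those pointing backwards in time.\<close>
    then have "\<forall>\<^sub>F h::(real^'n) \<times> real in nhds 0. 0 < snd (W z) + snd h"
      using pos by (intro order_tendstoD(1)) auto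
    with touch show ?thesis
    proof eventually_elim
      case (elim h)
      have "W z + h \<in> spacetime" using elim(2) by (simp add: spacetime_def mem_Times_iff)
      from W(2)[OF this, of "z + h"] elim(1) show ?case by simp
    qed
  qed
  then have ji: "jet_ineq (snd P) (fst P) M"
    using jet linL sym unfolding jet_sub_def jet_ineq_def M_def by blast
  let ?a = "fst (z - W z)"
  have "\<forall>\<^sub>F h in nhds 0. - (\<alpha> * (norm (?a + h) ^ 4 - norm ?a ^ 4)) \<le> fst P \<bullet> h + (M h \<bullet> h) / 2"
  proof -
    have "((\<lambda>h::real^'n. (h, 0::real)) \<longlongrightarrow> (0, 0)) (nhds 0)"
      by (intro tendsto_Pair tendsto_const filterlim_ident)
    then have "filterlim (\<lambda>h::real^'n. (h, 0::real)) (nhds 0) (nhds 0)" by (simp add: zero_prod_def)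
    from eventually_compose_filterlim[OF touch this]
    show ?thesis
    proof (rule eventually_mono)
      fix h assume *: "f (W (z + (h, 0))) - penalty \<alpha> \<beta> (z + (h, 0) - W (z + (h, 0)))
          \<le> f (W z) - penalty \<alpha> \<beta> (z - W z) + P \<bullet> (h, 0) + (L (h, 0) \<bullet> (h, 0)) / 2"
      have "f (W z) - penalty \<alpha> \<beta> (z + (h, 0) - W z) \<le> f (W (z + (h, 0))) - penalty \<alpha> \<beta> (z + (h, 0) - W (z + (h, 0)))"
        by (rule W(2)[OF W(1)])
      moreover have "penalty \<alpha> \<beta> (z + (h, 0) - W z) = \<alpha> * norm (?a + h) ^ 4 + \<beta> * (snd (z - W z))\<^sup>2"
        by (simp add: penalty_def algebra_simps)
      ultimately show "- (\<alpha> * (norm (?a + h) ^ 4 - norm ?a ^ 4)) \<le> fst P \<bullet> h + (M h \<bullet> h) / 2"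
        using * by (simp add: penalty_def M_def inner_prod_def algebra_simps)
    qed
  qed
  from quartic_touched_above[OF linM _ this] \<open>0 < \<alpha>\<close>
  have "fst P = - (4 * \<alpha> * (norm ?a)\<^sup>2) *\<^sub>R ?a" "\<And>h. - (12 * \<alpha> * (norm ?a)\<^sup>2) * (norm h)\<^sup>2 \<le> M h \<bullet> h"
    by auto
  then show ?thesis
    using ji linM symM small unfolding contact_jet_def M_def by blast
qed

text \<open>
  The statement is symmetric in \<open>f\<close> and \<open>g\<close>: the supersolution enters with the opposite sign, and no equation
  is required where an obstacle is active.
\<close>

theorem comparison_principle:
  fixes f g :: "(real^'n) \<times> real \<Rightarrow> real"
  assumes usc: "usc_on spacetime f" "usc_on spacetime g"
    and bounds: "\<And>z. z \<in> spacetime \<Longrightarrow> \<bar>f z\<bar> \<le> 1" "\<And>z. z \<in> spacetime \<Longrightarrow> \<bar>g z\<bar> \<le> 1"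
    and "0 \<le> c"
    and init: "\<And>e. 0 < e \<Longrightarrow> \<exists>d>0. \<forall>x y. dist x y < d \<longrightarrow> f (x, 0) + g (y, 0) \<le> c + e"
    and visc: "\<And>e. 0 < e \<Longrightarrow> \<exists>d>0. \<forall>x y s t. dist x y < d \<longrightarrow> 0 < s \<longrightarrow> 0 < t \<longrightarrow>
        c + e < f (x, s) + g (y, t) \<longrightarrow> jet_sub f (x, s) \<and> jet_sub g (y, t)"
    and "0 \<le> t0"
  shows "f (x0, t0) + g (x0, t0) \<le> c"
proof (rule ccontr)
  assume neg: "\<not> ?thesis"
  \<comment> \<open>The excess is spent in fifths: two on the penalties at (x0, t0), one on the
    approximate maximum, one on the time penalties at the contact points; one remains to invoke
    \<open>visc\<close>.\<close>
  define \<sigma> where "\<sigma> = (f (x0, t0) + g (x0, t0) - c) / 5"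
  have "\<sigma> > 0" using neg by (simp add: \<sigma>_def)
  have top: "f (x0, t0) + g (x0, t0) = c + 5 * \<sigma>" by (simp add: \<sigma>_def field_simps)
  have mem0: "(x0, t0) \<in> spacetime" using \<open>0 \<le> t0\<close> by (simp add: spacetime_def)
  obtain d1 where "d1 > 0" and d1: "\<And>x y. dist x y < d1 \<Longrightarrow> f (x, 0) + g (y, 0) \<le> c + \<sigma>"
    using init[OF \<open>\<sigma> > 0\<close>] by blast
  obtain d2 where "d2 > 0" and d2: "\<And>x y s t. dist x y < d2 \<Longrightarrow> 0 < s \<Longrightarrow> 0 < t \<Longrightarrow>
        c + \<sigma> < f (x, s) + g (y, t) \<Longrightarrow> jet_sub f (x, s) \<and> jet_sub g (y, t)"
    using visc[OF \<open>\<sigma> > 0\<close>] by blast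
  define d where "d = min d1 d2"
  have "d > 0" using \<open>d1 > 0\<close> \<open>d2 > 0\<close> by (simp add: d_def)
  define \<alpha> where "\<alpha> = 4 * (4 / d) ^ 4"
  have "\<alpha> > 0" using \<open>d > 0\<close> by (simp add: \<alpha>_def)
  \<comment> \<open>The penalty \<eta> t excludes late times and is also the strict surplus in the
    final sum of the time slopes; its size limits the cost at t0 to \<sigma>.\<close>
  define \<eta> where "\<eta> = min 1 (\<sigma> / (t0 + 1))"
  have \<eta>: "0 < \<eta>" "\<eta> \<le> 1" using \<open>\<sigma> > 0\<close> \<open>0 \<le> t0\<close> by (auto simp: \<eta>_def)
  have \<eta>\<sigma>: "\<eta> \<le> \<sigma>"
  proof -
    have "\<sigma> / (t0 + 1) \<le> \<sigma> / 1" using \<open>\<sigma> > 0\<close> \<open>0 \<le> t0\<close> by (intro divide_left_mono) auto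
    then show ?thesis by (simp add: \<eta>_def)
  qed
  have \<eta>t0: "\<eta> * t0 \<le> \<sigma>"
  proof -
    have "\<eta> * t0 \<le> (\<sigma> / (t0 + 1)) * (t0 + 1)" using \<open>0 \<le> t0\<close> \<open>\<sigma> > 0\<close> by (intro mult_mono) (auto simp: \<eta>_def)
    then show ?thesis using \<open>0 \<le> t0\<close> by simp
  qed
  obtain \<epsilon>0 where \<epsilon>0: "0 < \<epsilon>0 \<and> (\<forall>\<epsilon> s1 s2 p1 p2 L1 L2 a1 a2 \<mu>. 0 < \<epsilon> \<and> \<epsilon> \<le> \<epsilon>0 \<and>
     contact_jet \<alpha> s1 p1 (L1 :: real^'n \<Rightarrow> real^'n) a1 \<and> contact_jet \<alpha> s2 p2 L2 a2 \<and>
     (\<forall>h. L1 h + L2 h = \<mu> *\<^sub>R h) \<and> 0 \<le> \<mu> \<and> \<mu> \<le> 8 * \<epsilon> \<and> norm (p1 + p2) \<le> 7 * \<epsilon> \<longrightarrow> s1 + s2 < \<eta> - 3 * \<epsilon>)"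
    using jets_incompatible[OF \<open>\<alpha> > 0\<close> \<eta>(1), where 'n = 'n] ..
  then have "\<epsilon>0 > 0" ..
  define \<epsilon> where "\<epsilon> = min \<epsilon>0 (min 1 (\<sigma> / ((norm x0)\<^sup>2 + 1)))"
  have \<epsilon>: "0 < \<epsilon>" "\<epsilon> \<le> \<epsilon>0" "\<epsilon> \<le> 1"
    using \<open>\<epsilon>0 > 0\<close> \<open>\<sigma> > 0\<close> by (auto simp: \<epsilon>_def add_nonneg_pos)
  \<comment> \<open>Contact points satisfy \<delta> |x|^2 \<le> 4, hence \<epsilon> |x| \<le> 4 and
    \<delta> |x| \<le> \<epsilon>: the gradient of the spatial penalty is small although x is not
    bounded uniformly in \<epsilon>.\<close>
  define \<delta> where "\<delta> = \<epsilon>\<^sup>2 / 4"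
  have \<delta>: "0 < \<delta>" "\<delta> \<le> \<epsilon> / 4" using \<epsilon> by (auto simp: \<delta>_def power2_eq_square mult_left_le)
  have \<delta>x0: "\<delta> * (norm x0)\<^sup>2 \<le> \<sigma>"
  proof -
    have "\<delta> * (norm x0)\<^sup>2 \<le> (\<sigma> / ((norm x0)\<^sup>2 + 1)) * ((norm x0)\<^sup>2 + 1)"
      using \<delta> \<epsilon> \<open>\<sigma> > 0\<close> by (intro mult_mono) (auto simp: \<epsilon>_def)
    also have "\<dots> = \<sigma>" by (metis add_nonneg_pos less_irrefl nonzero_eq_divide_eq zero_le_power2 zero_less_one)
    finally show ?thesis .
  qed
  obtain \<beta> where "1 \<le> \<beta>" and \<beta>: "\<And>z w w'. w \<in> spacetime \<Longrightarrow> w' \<in> spacetime \<Longrightarrow>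
    c + 2 * \<sigma> \<le> f w + g w' - penalty \<alpha> \<beta> (z - w) - penalty \<alpha> \<beta> (z - w') - \<delta> * (norm (fst z))\<^sup>2 - \<eta> * snd z \<Longrightarrow>
    0 < snd w \<and> 0 < snd w'"
    using contact_at_positive_times[OF usc bounds \<open>0 \<le> c\<close> \<open>\<sigma> > 0\<close> \<open>d > 0\<close> _ \<alpha>_def \<delta>(1) \<eta>] d1 by (auto simp: d_def)
  have "0 < \<beta>" using \<open>1 \<le> \<beta>\<close> by simp
  have "\<forall>z. \<exists>w. w \<in> spacetime \<and> (\<forall>w'\<in>spacetime. f w' - penalty \<alpha> \<beta> (z - w') \<le> f w - penalty \<alpha> \<beta> (z - w))"
    using sup_convolution_attained[OF usc(1) bounds(1) \<open>\<alpha> > 0\<close> \<open>0 < \<beta>\<close>] by blast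
  from choice[OF this] obtain W where W: "\<And>z. W z \<in> spacetime"
    "\<And>z w. w \<in> spacetime \<Longrightarrow> f w - penalty \<alpha> \<beta> (z - w) \<le> f (W z) - penalty \<alpha> \<beta> (z - W z)" by blast
  have "\<forall>z. \<exists>w. w \<in> spacetime \<and> (\<forall>w'\<in>spacetime. g w' - penalty \<alpha> \<beta> (z - w') \<le> g w - penalty \<alpha> \<beta> (z - w))"
    using sup_convolution_attained[OF usc(2) bounds(2) \<open>\<alpha> > 0\<close> \<open>0 < \<beta>\<close>] by blast
  from choice[OF this] obtain V where V: "\<And>z. V z \<in> spacetime"
    "\<And>z w. w \<in> spacetime \<Longrightarrow> g w - penalty \<alpha> \<beta> (z - w) \<le> g (V z) - penalty \<alpha> \<beta> (z - V z)" by blast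
  define A where "A z = f (W z) - penalty \<alpha> \<beta> (z - W z)" for z
  define A2 where "A2 z = g (V z) - penalty \<alpha> \<beta> (z - V z)" for z
  obtain \<Lambda>1 where \<Lambda>1: "0 < \<Lambda>1" "semiconvex \<Lambda>1 A"
    using sup_convolution_semiconvex[OF bounds(1) \<open>\<alpha> > 0\<close> \<open>0 < \<beta>\<close> W] unfolding A_def by blast
  obtain \<Lambda>2 where \<Lambda>2: "0 < \<Lambda>2" "semiconvex \<Lambda>2 A2"
    using sup_convolution_semiconvex[OF bounds(2) \<open>\<alpha> > 0\<close> \<open>0 < \<beta>\<close> V] unfolding A2_def by blast
  have A_le: "A z \<le> 1" for z
  proof -
    have "0 \<le> penalty \<alpha> \<beta> (z - W z)" using \<open>\<alpha> > 0\<close> \<open>0 < \<beta>\<close> by (simp add: penalty_def)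
    then show ?thesis using bounds(1)[OF W(1)[of z]] unfolding A_def by linarith
  qed
  define \<Phi> where "\<Phi> z = A z + A2 z - \<delta> * (norm (fst z))\<^sup>2 - \<eta> * snd z" for z
  have contact: "\<alpha> * norm (fst (z - W z)) ^ 4 \<le> 4" "\<alpha> * norm (fst (z - V z)) ^ 4 \<le> 4"
    "\<delta> * (norm (fst z))\<^sup>2 \<le> 4" "- 2 \<le> snd z" "\<eta> * snd z \<le> 2" if "0 \<le> \<Phi> z" for z
  proof -
    have "0 \<le> f (W z) + g (V z) - penalty \<alpha> \<beta> (z - W z) - penalty \<alpha> \<beta> (z - V z) - \<delta> * (norm (fst z))\<^sup>2 - \<eta> * snd z"
      using that by (simp add: \<Phi>_def A_def A2_def)
    note * = penalized_contact_bounds[where f = f and g = g and \<alpha> = \<alpha> and \<beta> = \<beta> and \<delta> = \<delta> and \<eta> = \<eta>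
        and z = z and w = "W z" and w' = "V z", OF bounds _ \<open>1 \<le> \<beta>\<close> _ \<eta> W(1) V(1) this]
    show "\<alpha> * norm (fst (z - W z)) ^ 4 \<le> 4" "\<alpha> * norm (fst (z - V z)) ^ 4 \<le> 4"
      "\<delta> * (norm (fst z))\<^sup>2 \<le> 4" "- 2 \<le> snd z" "\<eta> * snd z \<le> 2"
      by (rule *; use \<open>\<alpha> > 0\<close> \<delta> in simp)+
  qed
  have \<Phi>0: "c + 3 * \<sigma> \<le> \<Phi> (x0, t0)"
  proof -
    have "f (x0, t0) \<le> A (x0, t0)" using W(2)[OF mem0, of "(x0, t0)"] by (simp add: A_def penalty_def)
    moreover have "g (x0, t0) \<le> A2 (x0, t0)" using V(2)[OF mem0, of "(x0, t0)"] by (simp add: A2_def penalty_def)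
    ultimately show ?thesis using top \<delta>x0 \<eta>t0 by (simp add: \<Phi>_def)
  qed
  \<comment> \<open>\<open>contact\<close> confines all points with a nonnegative value to a bounded
    set, and the value at (x0, t0) is positive.\<close>
  have "\<exists>z0\<in>UNIV. \<forall>z\<in>UNIV. \<Phi> z \<le> \<Phi> z0"
  proof (rule usc_on_attains_sup[where p = "(x0, t0)" and R = "sqrt (4 / \<delta>) + (2 + 2 / \<eta>)"])
    have "continuous_on UNIV \<Phi>"
      unfolding \<Phi>_def by (intro continuous_intros semiconvex_imp_continuous[OF \<Lambda>1(2)] semiconvex_imp_continuous[OF \<Lambda>2(2)])
    then show "usc_on UNIV \<Phi>"
      unfolding usc_on_def continuous_on_def by (auto intro: order_tendstoD(2))
    fix z :: "(real^'n) \<times> real" assume far: "sqrt (4 / \<delta>) + (2 + 2 / \<eta>) < norm z"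
    show "\<Phi> z \<le> \<Phi> (x0, t0)"
    proof (rule ccontr)
      assume "\<not> \<Phi> z \<le> \<Phi> (x0, t0)"
      then have "0 \<le> \<Phi> z" using \<Phi>0 \<open>0 \<le> c\<close> \<open>\<sigma> > 0\<close> by linarith
      note b = contact[OF this]
      have "(norm (fst z))\<^sup>2 \<le> 4 / \<delta>" using b(3) \<delta> by (simp add: field_simps)
      then have "norm (fst z) \<le> sqrt (4 / \<delta>)" by (rule real_le_rsqrt)
      moreover have "\<bar>snd z\<bar> \<le> 2 + 2 / \<eta>"
      proof -
        have "snd z \<le> 2 / \<eta>" using b(5) \<eta> by (simp add: field_simps)
        moreover have "0 < 2 / \<eta>" using \<eta> by simp
        ultimately show ?thesis using b(4) unfolding abs_le_iff by linarith
      qed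
      ultimately show False using norm_Pair_le[of "fst z" "snd z"] far by simp
    qed
  qed simp_all
  then obtain z0 where z0: "\<And>z. \<Phi> z \<le> \<Phi> z0" by blast
  \<comment> \<open>The additional \<open>\<delta> * (norm (z - z0))\<^sup>2\<close> makes the
    maximum at \<open>z0\<close> strict with quadratic decay, as \<open>theorem_on_sums\<close>
    demands.\<close>
  define B where "B z = A2 z - \<delta> * (norm (fst z))\<^sup>2 - \<eta> * snd z - \<delta> * (norm (z - z0))\<^sup>2" for z
  define \<Lambda> where "\<Lambda> = max \<Lambda>1 (\<Lambda>2 + \<delta> + \<delta>)"
  have mono: "semiconvex \<Lambda>' h" if sc: "semiconvex \<Lambda>'' h" and le: "\<Lambda>'' \<le> \<Lambda>'" for \<Lambda>' \<Lambda>'' and h :: "(real^'n) \<times> real \<Rightarrow> real"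
    unfolding semiconvex_def
  proof
    fix z
    obtain q where q: "\<And>k. h z + q \<bullet> k - \<Lambda>'' * (norm k)\<^sup>2 \<le> h (z + k)" using sc unfolding semiconvex_def by blast
    have "h z + q \<bullet> k - \<Lambda>' * (norm k)\<^sup>2 \<le> h (z + k)" for k
      using q[of k] mult_right_mono[OF le, of "(norm k)\<^sup>2"] by simp
    then show "\<exists>q. \<forall>k. h z + q \<bullet> k - \<Lambda>' * (norm k)\<^sup>2 \<le> h (z + k)" by blast
  qed
  have scA: "semiconvex \<Lambda> A" by (rule mono[OF \<Lambda>1(2)]) (simp add: \<Lambda>_def)
  have scB: "semiconvex \<Lambda> B"
    unfolding B_def using \<delta> by (intro mono[OF semiconvex_penalty[OF \<Lambda>2(2)]]) (auto simp: \<Lambda>_def)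
  have "0 < \<Lambda>" using \<Lambda>1 by (simp add: \<Lambda>_def)
  define \<kappa> where "\<kappa> = min \<delta> \<sigma>"
  have \<kappa>: "0 < \<kappa>" "\<kappa> \<le> \<delta>" "\<kappa> \<le> \<sigma>" using \<delta> \<open>\<sigma> > 0\<close> by (auto simp: \<kappa>_def)
  have AB: "A z + B z = \<Phi> z - \<delta> * (norm (z - z0))\<^sup>2" for z by (simp add: \<Phi>_def B_def)
  have strict: "A z + B z \<le> A z0 + B z0 - \<delta> * (norm (z - z0))\<^sup>2" for z
    unfolding AB using z0[of z] by simp
  obtain z P Q L r where linL: "linear L" and symL: "\<And>x y. L x \<bullet> y = x \<bullet> L y"
    and zz0: "norm (z - z0) < \<kappa>" and PQ: "norm (P + Q) < \<kappa>" and val: "A z0 + B z0 - \<kappa> < A z + B z" and "0 < r"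
    and Atouch: "\<And>h. norm h < r \<Longrightarrow> A (z + h) \<le> A z + P \<bullet> h + (L h \<bullet> h) / 2 + \<kappa> * (norm h)\<^sup>2"
    and Btouch: "\<And>h. norm h < r \<Longrightarrow> B (z + h) \<le> B z + Q \<bullet> h - (L h \<bullet> h) / 2 + \<kappa> * (norm h)\<^sup>2"
    using theorem_on_sums[OF scA scB \<open>0 < \<Lambda>\<close> A_le strict \<delta>(1) \<kappa>(1)] by metis
  have \<Phi>z: "c + 2 * \<sigma> \<le> \<Phi> z"
  proof -
    have "\<Phi> z0 - \<kappa> < \<Phi> z - \<delta> * (norm (z - z0))\<^sup>2" using val unfolding AB by simp
    moreover have "0 \<le> \<delta> * (norm (z - z0))\<^sup>2" using \<delta> by simp
    ultimately show ?thesis using z0[of "(x0, t0)"] \<Phi>0 \<kappa> by linarith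
  qed
  then have "0 \<le> \<Phi> z" using \<open>0 \<le> c\<close> \<open>\<sigma> > 0\<close> by linarith
  note cz = contact[OF this]
  have pos: "0 < snd (W z)" "0 < snd (V z)"
    using \<beta>[OF W(1) V(1), of z z z] \<Phi>z by (auto simp: \<Phi>_def A_def A2_def)
  have near: "norm (fst (z - W z)) \<le> d / 4" "norm (fst (z - V z)) \<le> d / 4"
    by (rule le_of_power4[OF \<open>d > 0\<close> norm_ge_zero cz(1)[unfolded \<alpha>_def]] le_of_power4[OF \<open>d > 0\<close> norm_ge_zero cz(2)[unfolded \<alpha>_def]])+
  have "dist (fst (W z)) (fst (V z)) \<le> d / 4 + d / 4"
    using dist_triangle3[of "fst (W z)" "fst (V z)" "fst z"] near by (simp add: dist_norm norm_minus_commute)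
  then have dWV: "dist (fst (W z)) (fst (V z)) < d2" using \<open>d > 0\<close> by (simp add: d_def)
  have "c + \<sigma> < f (W z) + g (V z)"
  proof -
    have "\<Phi> z \<le> f (W z) + g (V z) - \<eta> * snd z - \<beta> * (snd (z - W z))\<^sup>2"
    proof -
      have "0 \<le> \<alpha> * norm (fst (z - W z)) ^ 4" "0 \<le> penalty \<alpha> \<beta> (z - V z)" "0 \<le> \<delta> * (norm (fst z))\<^sup>2"
        using \<open>\<alpha> > 0\<close> \<open>0 < \<beta>\<close> \<delta> by (simp_all add: penalty_def)
      then show ?thesis unfolding \<Phi>_def A_def A2_def penalty_def[of _ _ "z - W z"] by linarith
    qed
    \<comment> \<open>If \<open>z\<close> lies before time 0, the positive contact time makes the
      time penalty at least t^2; completing the square in t^2 + \<eta> t loses only \<eta>^2 /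
      4.\<close>
    moreover have "- \<sigma> < \<eta> * snd z + \<beta> * (snd (z - W z))\<^sup>2"
    proof (cases "0 \<le> snd z")
      case True
      then have "0 \<le> \<eta> * snd z" using \<eta> by simp
      moreover have "0 \<le> \<beta> * (snd (z - W z))\<^sup>2" using \<open>0 < \<beta>\<close> by simp
      ultimately show ?thesis using \<open>\<sigma> > 0\<close> by linarith
    next
      case False
      then have "\<bar>snd z\<bar> \<le> \<bar>snd (z - W z)\<bar>" using pos by simp
      then have "(snd z)\<^sup>2 \<le> (snd (z - W z))\<^sup>2" by (rule abs_le_square_iff[THEN iffD1])
      also have "\<dots> \<le> \<beta> * (snd (z - W z))\<^sup>2" using \<open>1 \<le> \<beta>\<close> mult_right_mono[of 1 \<beta> "(snd (z - W z))\<^sup>2"] by simp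
      finally have "(snd z)\<^sup>2 \<le> \<beta> * (snd (z - W z))\<^sup>2" .
      moreover have "0 \<le> (snd z + \<eta> / 2)\<^sup>2" by simp
      then have "- (\<eta> * \<eta>) / 4 \<le> (snd z)\<^sup>2 + \<eta> * snd z" by (simp add: power2_eq_square algebra_simps)
      moreover have "\<eta> * \<eta> \<le> \<eta>" using \<eta> by (simp add: mult_left_le)
      ultimately show ?thesis using \<eta>\<sigma> \<open>\<sigma> > 0\<close> by linarith
    qed
    ultimately show ?thesis using \<Phi>z by linarith
  qed
  then have jets: "jet_sub f (W z)" "jet_sub g (V z)"
    using d2[OF dWV pos] by simp_all
  have ball: "\<forall>\<^sub>F h in nhds 0. norm (h :: (real^'n) \<times> real) < r"
    unfolding eventually_nhds_metric using \<open>0 < r\<close> by (intro exI[of _ r]) (simp add: dist_norm)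
  \<comment> \<open>The error \<kappa> |h|^2 is absorbed into both Hessians, and \<open>L2\<close>
    and \<open>P2\<close> restore the derivatives of the penalties subtracted in \<open>B\<close>.
    The parts L and -L cancel, so the spatial Hessians add up to (4 \<kappa> + 4 \<delta>) times the
    identity.\<close>
  define L1 where "L1 h = L h + (2 * \<kappa>) *\<^sub>R h" for h
  define L2 where "L2 h = (2 * \<kappa> + 2 * \<delta>) *\<^sub>R h - L h + ((2 * \<delta>) *\<^sub>R fst h, 0)" for h
  define P2 where "P2 = Q + ((2 * \<delta>) *\<^sub>R fst z, \<eta>) + (2 * \<delta>) *\<^sub>R (z - z0)"
  have c1: "contact_jet \<alpha> (snd P) (fst P) (\<lambda>h. fst (L1 (h, 0))) (fst (z - W z))"
  proof (rule sup_convolution_contact_jet[where L = L1 and P = P, OF W \<open>\<alpha> > 0\<close> cz(1) pos(1) jets(1)])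
    show "linear L1" unfolding L1_def by (intro linear_compose_add linL linear_scaleR)
    show "L1 x \<bullet> y = x \<bullet> L1 y" for x y by (simp add: L1_def inner_add_left inner_add_right symL)
    show "\<forall>\<^sub>F h in nhds 0. f (W (z + h)) - penalty \<alpha> \<beta> (z + h - W (z + h)) \<le> f (W z) - penalty \<alpha> \<beta> (z - W z) + P \<bullet> h + (L1 h \<bullet> h) / 2"
      using ball
    proof (rule eventually_mono)
      fix h :: "(real^'n) \<times> real" assume "norm h < r"
      from Atouch[OF this]
      show "f (W (z + h)) - penalty \<alpha> \<beta> (z + h - W (z + h)) \<le> f (W z) - penalty \<alpha> \<beta> (z - W z) + P \<bullet> h + (L1 h \<bullet> h) / 2"
        by (simp add: A_def L1_def inner_add_left add_divide_distrib dot_square_norm)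
    qed
  qed
  have c2: "contact_jet \<alpha> (snd P2) (fst P2) (\<lambda>h. fst (L2 (h, 0))) (fst (z - V z))"
  proof (rule sup_convolution_contact_jet[where L = L2 and P = P2, OF V \<open>\<alpha> > 0\<close> cz(2) pos(2) jets(2)])
    show "linear L2"
    proof (rule linearI)
      show "L2 (x + y) = L2 x + L2 y" for x y
        by (simp add: L2_def linear_add[OF linL] prod_eq_iff algebra_simps)
      show "L2 (s *\<^sub>R x) = s *\<^sub>R L2 x" for s x
        by (simp add: L2_def linear_scale[OF linL] prod_eq_iff algebra_simps)
    qed
    show "L2 x \<bullet> y = x \<bullet> L2 y" for x y
      by (simp add: L2_def inner_add_left inner_add_right inner_diff_left inner_diff_right symL) (simp add: inner_prod_def)
    show "\<forall>\<^sub>F h in nhds 0. g (V (z + h)) - penalty \<alpha> \<beta> (z + h - V (z + h)) \<le> g (V z) - penalty \<alpha> \<beta> (z - V z) + P2 \<bullet> h + (L2 h \<bullet> h) / 2"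
      using ball
    proof (rule eventually_mono)
      fix h :: "(real^'n) \<times> real" assume h: "norm h < r"
      have 1: "(norm (fst (z + h)))\<^sup>2 = (norm (fst z))\<^sup>2 + 2 * (fst z \<bullet> fst h) + (norm (fst h))\<^sup>2"
        unfolding power2_norm_eq_inner by (simp add: inner_add_left inner_add_right inner_commute)
      have 2: "(norm (z + h - z0))\<^sup>2 = (norm (z - z0))\<^sup>2 + 2 * ((z - z0) \<bullet> h) + (norm h)\<^sup>2"
        unfolding power2_norm_eq_inner by (simp add: inner_add_left inner_add_right inner_diff_left inner_diff_right inner_commute)
      have 3: "P2 \<bullet> h = Q \<bullet> h + 2 * \<delta> * (fst z \<bullet> fst h) + \<eta> * snd h + 2 * \<delta> * ((z - z0) \<bullet> h)"
        unfolding P2_def by (simp only: inner_add_left inner_scaleR_left) (simp add: inner_prod_def)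
      have 4: "L2 h \<bullet> h = (2 * \<kappa> + 2 * \<delta>) * (norm h)\<^sup>2 - L h \<bullet> h + 2 * \<delta> * (norm (fst h))\<^sup>2"
        unfolding L2_def by (simp only: inner_add_left inner_diff_left inner_scaleR_left dot_square_norm)
          (simp add: inner_prod_def dot_square_norm)
      have "A2 (z + h) \<le> A2 z + P2 \<bullet> h + (L2 h \<bullet> h) / 2"
        using Btouch[OF h] unfolding B_def 1 2 3 4 by (simp add: algebra_simps add_divide_distrib diff_divide_distrib)
      then show "g (V (z + h)) - penalty \<alpha> \<beta> (z + h - V (z + h)) \<le> g (V z) - penalty \<alpha> \<beta> (z - V z) + P2 \<bullet> h + (L2 h \<bullet> h) / 2"
        by (simp add: A2_def)
    qed
  qed
  have norm_fst: "norm (fst v) \<le> norm v" and norm_snd: "norm (snd v) \<le> norm v" for v :: "(real^'n) \<times> real"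
    using norm_fst_le[of "fst v" "snd v"] norm_snd_le[of "snd v" "fst v"] by (simp_all only: prod.collapse)
  have \<delta>1: "\<delta> \<le> 1" "\<kappa> \<le> 1" using \<delta> \<epsilon> \<kappa> by auto
  have \<delta>zz: "2 * \<delta> * norm (z - z0) \<le> \<epsilon> / 2"
  proof -
    have "\<delta> * norm (z - z0) \<le> \<delta> * 1" using zz0 \<delta>1 \<delta> by (intro mult_left_mono) auto
    then show ?thesis using \<delta> by linarith
  qed
  have "snd P + snd P2 < \<eta> - 3 * \<epsilon>"
  proof (rule \<epsilon>0[THEN conjunct2, rule_format, OF conjI[OF \<epsilon>(1) conjI[OF \<epsilon>(2) conjI[OF c1 conjI[OF c2]]]]], intro conjI)
    show "\<forall>h. fst (L1 (h, 0)) + fst (L2 (h, 0)) = (4 * \<kappa> + 4 * \<delta>) *\<^sub>R h"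
      by (simp add: L1_def L2_def algebra_simps flip: scaleR_left_distrib)
    show "0 \<le> 4 * \<kappa> + 4 * \<delta>" using \<kappa> \<delta> by simp
    show "4 * \<kappa> + 4 * \<delta> \<le> 8 * \<epsilon>" using \<kappa> \<delta> \<epsilon> by simp
    have "fst P + fst P2 = fst (P + Q) + (2 * \<delta>) *\<^sub>R fst z + (2 * \<delta>) *\<^sub>R fst (z - z0)"
      by (simp add: P2_def)
    also have "norm \<dots> \<le> norm (fst (P + Q)) + norm ((2 * \<delta>) *\<^sub>R fst z) + norm ((2 * \<delta>) *\<^sub>R fst (z - z0))"
      by (intro order_trans[OF norm_triangle_ineq] add_right_mono norm_triangle_ineq)
    also have "\<dots> = norm (fst (P + Q)) + 2 * (\<delta> * norm (fst z)) + 2 * \<delta> * norm (fst (z - z0))"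
      using \<delta> by simp
    also have "norm (fst (P + Q)) \<le> \<epsilon>"
      using norm_fst[of "P + Q"] PQ \<kappa> \<delta> \<epsilon> by linarith
    also have "\<delta> * norm (fst z) \<le> \<epsilon>"
    proof -
      have "(\<epsilon> * norm (fst z))\<^sup>2 \<le> 4\<^sup>2" using cz(3) by (simp add: \<delta>_def power_mult_distrib)
      then have "\<epsilon> * norm (fst z) \<le> 4" by (rule power2_le_imp_le) simp
      then have "\<epsilon> * (\<epsilon> * norm (fst z)) \<le> \<epsilon> * 4" using \<epsilon> by (intro mult_left_mono) auto
      then show ?thesis by (simp add: \<delta>_def power2_eq_square)
    qed
    also have "2 * \<delta> * norm (fst (z - z0)) \<le> 2 * \<delta> * norm (z - z0)"
      using \<delta> norm_fst[of "z - z0"] by (intro mult_left_mono) auto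
    also note \<delta>zz
    finally show "norm (fst P + fst P2) \<le> 7 * \<epsilon>" using \<epsilon> by simp
  qed
  \<comment> \<open>The sum of the time slopes equals \<eta> up to 3 \<epsilon> / 2, incompatible
    with a value below \<eta> - 3 \<epsilon>.\<close>
  moreover have "snd P + snd P2 = snd (P + Q) + \<eta> + 2 * \<delta> * snd (z - z0)" by (simp add: P2_def)
  moreover have "\<bar>snd (P + Q)\<bar> \<le> \<epsilon>"
    using norm_snd[of "P + Q"] PQ \<kappa> \<delta> \<epsilon> unfolding real_norm_def by linarith
  moreover have "\<bar>2 * \<delta> * snd (z - z0)\<bar> \<le> \<epsilon> / 2"
  proof -
    have "\<bar>2 * \<delta> * snd (z - z0)\<bar> = 2 * \<delta> * norm (snd (z - z0))" using \<delta> by (simp add: abs_mult)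
    also have "\<dots> \<le> 2 * \<delta> * norm (z - z0)" using \<delta> norm_snd[of "z - z0"] by (intro mult_left_mono) auto
    finally show ?thesis using \<delta>zz by linarith
  qed
  ultimately show False using \<epsilon> by linarith
qed

section \<open>Long time behaviour\<close>

lemma F_mc_uminus: "F_mc (- q) (- Y) = - F_mc q Y"
proof -
  have "(- Y) *v (- q) = Y *v q" by (simp add: matrix_vector_mult_def vec_eq_iff)
  moreover have "trace (- Y) = - trace Y" by (simp add: trace_def sum_negf)
  ultimately show ?thesis by (simp add: F_mc_eq)
qed

lemma F_mc_dom_uminus: "(- q, - Y) \<in> F_mc_dom \<longleftrightarrow> (q, Y) \<in> F_mc_dom"
  by (auto simp: F_mc_dom_def transpose_def vec_eq_iff)

lemma eventually_F_filter_uminus: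
  assumes "\<forall>\<^sub>F z in inf (nhds (p, X)) (principal F_mc_dom). R z"
  shows "\<forall>\<^sub>F z in inf (nhds (- p, - X)) (principal F_mc_dom). R (- z)"
proof -
  have "((\<lambda>z. - z) \<longlongrightarrow> - (- p, - X)) (nhds (- p, - X))"
    by (intro tendsto_minus filterlim_ident)
  then have "filterlim uminus (nhds (p, X)) (nhds (- p, - X))" by simp
  from eventually_compose_filterlim[OF assms[unfolded eventually_inf_principal] this]
  show ?thesis unfolding eventually_inf_principal
    by (rule eventually_mono) (auto simp: F_mc_dom_uminus)
qed

text \<open>F is odd in the pair (p, X), so reversing signs exchanges the two envelopes. This makes
  -u satisfy the subsolution inequality, with the same operator, wherever u is a supersolution below
  its obstacle.\<close>

lemma F_upper_uminus: "F_upper (- p) (- X) = - F_lower p X"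
proof (rule antisym)
  show "F_upper (- p) (- X) \<le> - F_lower p X"
    unfolding F_upper_def Limsup_le_iff
  proof (intro allI impI)
    fix y assume "- F_lower p X < y"
    then have "- y < F_lower p X" by (simp add: ereal_uminus_less_reorder)
    then have "\<forall>\<^sub>F z in inf (nhds (p, X)) (principal F_mc_dom). - y < (case z of (q, Y) \<Rightarrow> ereal (F_mc q Y))"
      unfolding F_lower_def by (rule less_LiminfD)
    from eventually_F_filter_uminus[OF this]
    show "\<forall>\<^sub>F z in inf (nhds (- p, - X)) (principal F_mc_dom). (case z of (q, Y) \<Rightarrow> ereal (F_mc q Y)) < y"
      by (rule eventually_mono) (auto simp: F_mc_uminus ereal_uminus_less_reorder simp flip: uminus_ereal.simps)
  qed
  have "- F_upper (- p) (- X) \<le> F_lower p X"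
    unfolding F_lower_def le_Liminf_iff
  proof (intro allI impI)
    fix y assume "y < - F_upper (- p) (- X)"
    then have "F_upper (- p) (- X) < - y" by (simp add: ereal_less_uminus_reorder)
    then have "\<forall>\<^sub>F z in inf (nhds (- p, - X)) (principal F_mc_dom). (case z of (q, Y) \<Rightarrow> ereal (F_mc q Y)) < - y"
      unfolding F_upper_def by (rule Limsup_lessD)
    from eventually_F_filter_uminus[OF this]
    show "\<forall>\<^sub>F z in inf (nhds (p, X)) (principal F_mc_dom). y < (case z of (q, Y) \<Rightarrow> ereal (F_mc q Y))"
      by (simp add: case_prod_beta) (rule eventually_mono, assumption, simp add: F_mc_uminus ereal_uminus_less_reorder flip: uminus_ereal.simps)
  qed
  then show "- F_lower p X \<le> F_upper (- p) (- X)" by (metis ereal_uminus_le_reorder)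
qed

text \<open>A bound on a punctured or full neighbourhood, intersected with the domain, is inherited
  by the liminf at every point of the open set.\<close>

lemma F_lower_lsc:
  assumes "ereal a < F_lower p X"
  obtains U where "open U" "(p, X) \<in> U" "\<And>q Y. (q, Y) \<in> U \<Longrightarrow> ereal a \<le> F_lower q Y"
proof -
  have "\<forall>\<^sub>F z in nhds (p, X). z \<in> F_mc_dom \<longrightarrow> ereal a < (case z of (q, Y) \<Rightarrow> ereal (F_mc q Y))"
    using less_LiminfD[OF assms[unfolded F_lower_def]] unfolding eventually_inf_principal .
  then obtain U where U: "open U" "(p, X) \<in> U" "\<And>z. z \<in> U \<Longrightarrow> z \<in> F_mc_dom \<Longrightarrow> ereal a < (case z of (q, Y) \<Rightarrow> ereal (F_mc q Y))"
    unfolding eventually_nhds by blast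
  have "ereal a \<le> F_lower q Y" if "(q, Y) \<in> U" for q Y
    unfolding F_lower_def
  proof (rule Liminf_bounded)
    have "\<forall>\<^sub>F z in nhds (q, Y). z \<in> U" using U(1) that by (simp add: eventually_nhds) blast
    then show "\<forall>\<^sub>F z in inf (nhds (q, Y)) (principal F_mc_dom). ereal a \<le> (case z of (q, Y) \<Rightarrow> ereal (F_mc q Y))"
      unfolding eventually_inf_principal by (rule eventually_mono) (use U(3) less_imp_le in blast)
  qed
  with U show thesis using that by blast
qed

lemma C2_fun_uminus:
  assumes "C2_fun \<phi> G H"
  shows "C2_fun (\<lambda>z. - \<phi> z) (\<lambda>z. - G z) (\<lambda>z. - H z)"
  unfolding C2_fun_def
proof (intro conjI allI)
  fix x
  have 1: "(\<phi> has_derivative (\<lambda>h. G x \<bullet> h)) (at x)" "(G has_derivative blinfun_apply (H x)) (at x)"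
    using assms unfolding C2_fun_def by blast+
  show "((\<lambda>z. - \<phi> z) has_derivative (\<lambda>h. - G x \<bullet> h)) (at x)"
    using has_derivative_minus[OF 1(1)] by simp
  show "((\<lambda>z. - G z) has_derivative blinfun_apply (- H x)) (at x)"
    using has_derivative_minus[OF 1(2)] by (simp add: uminus_blinfun.rep_eq)
next
  show "continuous_on UNIV (\<lambda>z. - H z)"
    using assms unfolding C2_fun_def by (intro continuous_intros) blast
qed

lemma matrix_uminus: "matrix (\<lambda>h. - L h) = - matrix L"
  by (simp add: matrix_def vec_eq_iff)

lemma evol_subsolution_visc_sub:
  assumes "evol_subsolution um up u0 u" "0 < t" "um x < u (x, t)"
  shows "visc_sub u (x, t)"
  using assms unfolding evol_subsolution_def visc_sub_def by blast

lemma evol_supersolution_visc_sub: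
  assumes sup: "evol_supersolution um up u0 u" and "0 < t" "u (x, t) < up x"
  shows "visc_sub (\<lambda>z. - u z) (x, t)"
  unfolding visc_sub_def
proof (intro allI impI, elim conjE)
  fix \<phi> G H assume C2: "C2_fun \<phi> G H" and max: "\<forall>z\<in>spacetime. - u z - \<phi> z \<le> - u (x, t) - \<phi> (x, t)"
  have "\<forall>z\<in>spacetime. u z - - \<phi> z \<ge> u (x, t) - - \<phi> (x, t)" using max by fastforce
  then have "ereal (snd (- G (x, t))) + F_upper (fst (- G (x, t))) (space_hessian (- H (x, t))) \<ge> 0"
    using sup C2_fun_uminus[OF C2] assms(2,3) unfolding evol_supersolution_def by blast
  moreover have "space_hessian (- H (x, t)) = - space_hessian (H (x, t))"
    by (simp add: space_hessian_def uminus_blinfun.rep_eq matrix_uminus)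
  ultimately have "0 \<le> ereal (- snd (G (x, t))) + - F_lower (fst (G (x, t))) (space_hessian (H (x, t)))"
    by (simp add: F_upper_uminus)
  then show "ereal (snd (G (x, t))) + F_lower (fst (G (x, t))) (space_hessian (H (x, t))) \<le> 0"
    by (cases "F_lower (fst (G (x, t))) (space_hessian (H (x, t)))") auto
qed

section \<open>Passage to the limit in the equation\<close>

lemma C2_fun_space_time_penalty:
  fixes \<phi> :: "real^'n \<Rightarrow> real" and x0 :: "real^'n"
  assumes C2: "C2_fun \<phi> G H"
  defines "G' \<equiv> \<lambda>x. G x + (4 * (norm (x - x0))\<^sup>2) *\<^sub>R (x - x0)"
    and "H' \<equiv> \<lambda>x. H x + (4 * (norm (x - x0))\<^sup>2) *\<^sub>R id_blinfun + 8 *\<^sub>R rank1 (x - x0) (x - x0)"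
  obtains J where "C2_fun (\<lambda>z. \<phi> (fst z) + norm (fst z - x0) ^ 4 + (snd z - T)\<^sup>2) (\<lambda>z. (G' (fst z), 2 * (snd z - T))) J"
    "\<And>z. space_hessian (J z) = matrix (blinfun_apply (H' (fst z)))"
proof -
  define inl where "inl = Blinfun (\<lambda>x::real^'n. (x, 0::real))"
  define pr where "pr = Blinfun (\<lambda>h::(real^'n) \<times> real. fst h)"
  define tt where "tt = Blinfun (\<lambda>h::(real^'n) \<times> real. (0::real^'n, 2 * snd h))"
  have ap: "blinfun_apply inl = (\<lambda>x. (x, 0))" "blinfun_apply pr = fst" "blinfun_apply tt = (\<lambda>h. (0, 2 * snd h))"
    unfolding inl_def pr_def tt_def
    by (rule bounded_linear_Blinfun_apply; intro bounded_linear_intros)+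
  define J where "J z = ((inl o\<^sub>L H' (fst z)) o\<^sub>L pr) + tt" for z :: "(real^'n) \<times> real"
  have J: "blinfun_apply (J z) h = (blinfun_apply (H' (fst z)) (fst h), 2 * snd h)" for z h
    by (simp add: J_def blinfun.add_left ap)
  have d: "(\<phi> has_derivative (\<lambda>h. G x \<bullet> h)) (at x)" "(G has_derivative blinfun_apply (H x)) (at x)" "continuous_on UNIV H" for x
    using C2 unfolding C2_fun_def by blast+
  have "C2_fun (\<lambda>x. 0 \<bullet> (x - x0) + (blinfun_apply 0 (x - x0) \<bullet> (x - x0)) / 2 + 1 * ((norm (x - x0))\<^sup>2 * (norm (x - x0))\<^sup>2))
    (\<lambda>x. 0 + blinfun_apply 0 (x - x0) + (4 * 1 * (norm (x - x0))\<^sup>2) *\<^sub>R (x - x0))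
    (\<lambda>x. 0 + (4 * 1 * (norm (x - x0))\<^sup>2) *\<^sub>R id_blinfun + (8 * 1) *\<^sub>R rank1 (x - x0) (x - x0))"
    by (rule C2_fun_quadratic_quartic) (simp add: zero_blinfun.rep_eq)
  then have "C2_fun (\<lambda>x. norm (x - x0) ^ 4) (\<lambda>x. (4 * (norm (x - x0))\<^sup>2) *\<^sub>R (x - x0))
    (\<lambda>x. (4 * (norm (x - x0))\<^sup>2) *\<^sub>R id_blinfun + 8 *\<^sub>R rank1 (x - x0) (x - x0))"
    by (simp add: zero_blinfun.rep_eq flip: power_add)
  then have q: "((\<lambda>x. norm (x - x0) ^ 4) has_derivative (\<lambda>h. ((4 * (norm (x - x0))\<^sup>2) *\<^sub>R (x - x0)) \<bullet> h)) (at x)"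
    "((\<lambda>x. (4 * (norm (x - x0))\<^sup>2) *\<^sub>R (x - x0)) has_derivative blinfun_apply ((4 * (norm (x - x0))\<^sup>2) *\<^sub>R id_blinfun + 8 *\<^sub>R rank1 (x - x0) (x - x0))) (at x)" for x
    unfolding C2_fun_def by blast+
  have d1: "((\<lambda>x. \<phi> x + norm (x - x0) ^ 4) has_derivative (\<lambda>h. G' x \<bullet> h)) (at x)" for x
    by (rule has_derivative_eq_rhs[OF has_derivative_add[OF d(1) q(1)]]) (simp add: G'_def inner_add_left fun_eq_iff)
  have d2: "(G' has_derivative blinfun_apply (H' x)) (at x)" for x
    unfolding G'_def
    by (rule has_derivative_eq_rhs[OF has_derivative_add[OF d(2) q(2)]]) (simp add: H'_def blinfun.add_left fun_eq_iff)
  have cH': "continuous_on UNIV H'" unfolding H'_def by (intro continuous_intros d(3))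
  have "C2_fun (\<lambda>z. \<phi> (fst z) + norm (fst z - x0) ^ 4 + (snd z - T)\<^sup>2) (\<lambda>z. (G' (fst z), 2 * (snd z - T))) J"
    unfolding C2_fun_def
  proof (intro conjI allI)
    fix z :: "(real^'n) \<times> real"
    have f: "(fst has_derivative fst) (at z)" and s: "(snd has_derivative snd) (at z)"
      by (auto intro!: derivative_eq_intros)
    have t: "((\<lambda>z. (snd z - T)\<^sup>2) has_derivative (\<lambda>h. 2 * (snd z - T) * snd h)) (at z)"
      by (auto intro!: derivative_eq_intros s)
    show "((\<lambda>z. \<phi> (fst z) + norm (fst z - x0) ^ 4 + (snd z - T)\<^sup>2) has_derivative (\<lambda>h. (G' (fst z), 2 * (snd z - T)) \<bullet> h)) (at z)"
      by (rule has_derivative_eq_rhs[OF has_derivative_add[OF has_derivative_compose[OF f d1] t]]) (simp add: inner_prod_def fun_eq_iff)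
    show "((\<lambda>z. (G' (fst z), 2 * (snd z - T))) has_derivative blinfun_apply (J z)) (at z)"
      by (rule has_derivative_eq_rhs[OF has_derivative_Pair[OF has_derivative_compose[OF f d2]]])
         (auto intro!: derivative_eq_intros s simp: J fun_eq_iff)
  next
    have "continuous_on UNIV (\<lambda>z::(real^'n) \<times> real. H' (fst z))"
      by (rule continuous_on_compose2[OF cH']) (auto intro!: continuous_intros)
    then show "continuous_on UNIV J"
      unfolding J_def
      by (intro continuous_on_add continuous_on_const bounded_bilinear.continuous_on[OF bounded_bilinear_blinfun_compose])
  qed
  moreover have "space_hessian (J z) = matrix (blinfun_apply (H' (fst z)))" for z
    by (simp add: space_hessian_def J)
  ultimately show thesis by (rule that)
qed

lemma continuous_on_matrix_blinfun:
  assumes "continuous_on S (H :: 'a::topological_space \<Rightarrow> (real^'n) \<Rightarrow>\<^sub>L (real^'m))"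
  shows "continuous_on S (\<lambda>x. matrix (blinfun_apply (H x)))"
  unfolding matrix_def using assms by (intro continuous_intros)

text \<open>If the inequality failed with margin \<open>a\<close>, the envelope would exceed
  \<open>a\<close> near x0 by semicontinuity. The quartic term localises a maximum that need not be
  strict; the contact time then differs from \<open>T\<close> by less than a / 2, so the time slope
  is above -a, a contradiction.\<close>

lemma visc_sub_limit:
  fixes w :: "(real^'n) \<times> real \<Rightarrow> real"
  assumes usc: "usc_on spacetime w" and bound: "\<And>z. z \<in> spacetime \<Longrightarrow> \<bar>w z\<bar> \<le> 1"
    and bound': "\<And>x. \<bar>w' x\<bar> \<le> 1"
    and lim: "uniform_limit (cball x0 2) (\<lambda>t x. w (x, t)) w' at_top"
    and visc: "0 < r" "\<And>x t. dist x x0 < r \<Longrightarrow> T1 \<le> t \<Longrightarrow> visc_sub w (x, t)"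
    and C2: "C2_fun \<phi> G H" and max: "\<And>y. w' y - \<phi> y \<le> w' x0 - \<phi> x0"
  shows "F_lower (G x0) (matrix (blinfun_apply (H x0))) \<le> 0"
proof (rule ccontr)
  assume "\<not> ?thesis"
  then have "0 < F_lower (G x0) (matrix (blinfun_apply (H x0)))" by simp
  then obtain a where a: "ereal 0 < ereal a" "ereal a < F_lower (G x0) (matrix (blinfun_apply (H x0)))"
    using ereal_dense2 zero_ereal_def by metis
  then have "0 < a" by simp
  obtain U where U: "open U" "(G x0, matrix (blinfun_apply (H x0))) \<in> U"
      "\<And>q Y. (q, Y) \<in> U \<Longrightarrow> ereal a \<le> F_lower q Y"
    using F_lower_lsc[OF a(2)] by metis
  define G' where "G' x = G x + (4 * (norm (x - x0))\<^sup>2) *\<^sub>R (x - x0)" for x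
  define H' where "H' x = H x + (4 * (norm (x - x0))\<^sup>2) *\<^sub>R id_blinfun + 8 *\<^sub>R rank1 (x - x0) (x - x0)" for x
  have cG: "continuous_on UNIV G"
    using C2 unfolding C2_fun_def by (intro continuous_at_imp_continuous_on ballI) (meson has_derivative_continuous)
  have cH: "continuous_on UNIV H" using C2 unfolding C2_fun_def by blast
  have "continuous_on UNIV G'" unfolding G'_def by (intro continuous_intros cG)
  moreover have "continuous_on UNIV (\<lambda>x. matrix (blinfun_apply (H' x)))"
    unfolding H'_def by (intro continuous_on_matrix_blinfun continuous_intros cH continuous_on_rank1)
  ultimately have "continuous_on UNIV (\<lambda>x. (G' x, matrix (blinfun_apply (H' x))))"
    by (rule continuous_on_Pair)
  then have "open ((\<lambda>x. (G' x, matrix (blinfun_apply (H' x)))) -` U)"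
    using open_vimage[OF U(1)] by blast
  moreover have "x0 \<in> (\<lambda>x. (G' x, matrix (blinfun_apply (H' x)))) -` U"
  proof -
    have "rank1 (0::real^'n) (0::real^'n) = 0" by (rule blinfun_eqI) (simp add: rank1_apply)
    then show ?thesis using U(2) by (simp add: G'_def H'_def)
  qed
  ultimately obtain \<rho> where \<rho>: "0 < \<rho>" "ball x0 \<rho> \<subseteq> (\<lambda>x. (G' x, matrix (blinfun_apply (H' x)))) -` U"
    unfolding open_contains_ball by blast
  define m where "m = min \<rho> r"
  have "0 < m" using \<rho> visc(1) by (simp add: m_def)
  \<comment> \<open>By \<open>gap\<close> the penalties at the contact point sum to less than 2 e,
    which puts it within \<open>m\<close> of x0 in space and within a / 2 of \<open>T\<close> in
    time.\<close>
  define e where "e = min (m ^ 4 / 4) (a\<^sup>2 / 16)"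
  have "0 < e" using \<open>0 < m\<close> \<open>0 < a\<close> by (simp add: e_def)
  from uniform_limitD[OF lim \<open>0 < e\<close>] obtain T2 where
    T2: "\<And>t x. T2 \<le> t \<Longrightarrow> x \<in> cball x0 2 \<Longrightarrow> dist (w (x, t)) (w' x) < e"
    unfolding eventually_at_top_linorder by blast
  \<comment> \<open>Contact times lie within 2 of \<open>T\<close>; the summand 2 keeps them beyond
    1, \<open>T1\<close> and \<open>T2\<close>.\<close>
  define T where "T = max 1 (max T1 T2) + 2"
  define \<psi> where "\<psi> z = \<phi> (fst z) + norm (fst z - x0) ^ 4 + (snd z - T)\<^sup>2" for z :: "(real^'n) \<times> real"
  obtain J where J: "C2_fun \<psi> (\<lambda>z. (G' (fst z), 2 * (snd z - T))) J"
    "\<And>z. space_hessian (J z) = matrix (blinfun_apply (H' (fst z)))"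
    by (rule C2_fun_space_time_penalty[OF C2, of x0 T, folded \<psi>_def G'_def H'_def]) (rule that)
  have T: "(x0, T) \<in> spacetime" by (simp add: T_def spacetime_def)
  have gap: "norm (fst z - x0) ^ 4 + (snd z - T)\<^sup>2 \<le> (w z - w' (fst z)) + (w' x0 - w (x0, T))"
    if "w (x0, T) - \<psi> (x0, T) \<le> w z - \<psi> z" for z
    using that max[of "fst z"] by (simp add: \<psi>_def)
  have near: "norm (fst z - x0) \<le> 2 \<and> \<bar>snd z - T\<bar> \<le> 2"
    if z: "z \<in> spacetime" and "w (x0, T) - \<psi> (x0, T) \<le> w z - \<psi> z" for z
  proof -
    \<comment> \<open>Each difference in \<open>gap\<close> is at most 2. This is why uniform
      convergence on the ball of radius 2 suffices.\<close>
    have le: "norm (fst z - x0) ^ 4 + (snd z - T)\<^sup>2 \<le> 4"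
      using gap[OF that(2)] bound[OF z] bound[OF T] bound'[of x0] bound'[of "fst z"] by linarith
    have "norm (fst z - x0) ^ 4 \<le> 16" using le zero_le_power2[of "snd z - T"] by linarith
    then have "norm (fst z - x0) ^ 4 \<le> 2 ^ 4" by simp
    moreover have "0 \<le> norm (fst z - x0) ^ 4" by simp
    then have "(snd z - T)\<^sup>2 \<le> 4" using le by linarith
    then have "(snd z - T)\<^sup>2 \<le> 2\<^sup>2" by simp
    ultimately show ?thesis using power_le_imp_le_base[of "norm (fst z - x0)" 3 2] abs_le_square_iff[of "snd z - T" 2] by simp
  qed
  have cont: "continuous_on UNIV \<psi>"
    using J(1) unfolding C2_fun_def by (intro continuous_at_imp_continuous_on ballI) (meson has_derivative_continuous)
  have "\<exists>z1\<in>spacetime. \<forall>z\<in>spacetime. w z + - \<psi> z \<le> w z1 + - \<psi> z1"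
  proof (rule usc_on_attains_sup[where p = "(x0, T)" and R = "norm (x0, T) + 4", OF _ closed_spacetime T])
    show "usc_on spacetime (\<lambda>z. w z + - \<psi> z)"
      by (intro usc_on_add_continuous usc continuous_on_minus continuous_on_subset[OF cont] subset_UNIV)
    fix z :: "(real^'n) \<times> real" assume z: "z \<in> spacetime" and far: "norm (x0, T) + 4 < norm z"
    show "w z + - \<psi> z \<le> w (x0, T) + - \<psi> (x0, T)"
    proof (rule ccontr)
      assume "\<not> ?thesis"
      then have "norm (fst z - x0) \<le> 2 \<and> \<bar>snd z - T\<bar> \<le> 2" by (intro near z) simp
      then have "norm (z - (x0, T)) \<le> 4" using norm_Pair_le[of "fst z - x0" "snd z - T"] by (cases z) simp
      then show False using far norm_triangle_sub[of z "(x0, T)"] by linarith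
    qed
  qed
  then obtain z1 where z1: "z1 \<in> spacetime" and z1max: "\<And>z. z \<in> spacetime \<Longrightarrow> w z - \<psi> z \<le> w z1 - \<psi> z1"
    by auto
  obtain x1 t1 where z1_eq: "z1 = (x1, t1)" by (cases z1)
  have n1: "norm (x1 - x0) \<le> 2" "\<bar>t1 - T\<bar> \<le> 2" using near[OF z1 z1max[OF T]] z1_eq by auto
  have t1: "1 \<le> t1" "T1 \<le> t1" "T2 \<le> t1" using n1(2) unfolding T_def by linarith+
  have "\<bar>w z1 - w' x1\<bar> < e" using T2[OF t1(3), of x1] n1(1) z1_eq by (simp add: dist_norm norm_minus_commute)
  moreover have "\<bar>w (x0, T) - w' x0\<bar> < e" using T2[of T x0] by (simp add: T_def dist_norm)
  ultimately have le: "norm (x1 - x0) ^ 4 + (t1 - T)\<^sup>2 < 2 * e"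
    using gap[OF z1max[OF T]] z1_eq by simp
  have "norm (x1 - x0) ^ 4 < m ^ 4"
    using le zero_le_power2[of "t1 - T"] \<open>0 < m\<close> zero_less_power[OF \<open>0 < m\<close>, of 4] unfolding e_def by linarith
  then have x1: "norm (x1 - x0) < m" using \<open>0 < m\<close> by (simp add: power_less_imp_less_base)
  have "0 \<le> norm (x1 - x0) ^ 4" "0 < a\<^sup>2" using \<open>0 < a\<close> by simp_all
  then have "(t1 - T)\<^sup>2 < a\<^sup>2 / 4" using le unfolding e_def by linarith
  then have "(t1 - T)\<^sup>2 < (a / 2)\<^sup>2" by (simp add: power_divide)
  then have ta: "\<bar>t1 - T\<bar> < a / 2" using \<open>0 < a\<close> abs_le_square_iff[of "a / 2" "t1 - T"] by linarith
  have "visc_sub w z1"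
    unfolding z1_eq using x1 t1 by (intro visc(2)) (auto simp: m_def dist_norm)
  then have "ereal (2 * (t1 - T)) + F_lower (G' x1) (matrix (blinfun_apply (H' x1))) \<le> 0"
    using J z1max z1_eq unfolding visc_sub_def by force
  moreover have "ereal a \<le> F_lower (G' x1) (matrix (blinfun_apply (H' x1)))"
    using \<rho>(2) x1 by (intro U(3)) (auto simp: m_def dist_norm norm_minus_commute subset_iff)
  then have "ereal (2 * (t1 - T)) + ereal a \<le> ereal (2 * (t1 - T)) + F_lower (G' x1) (matrix (blinfun_apply (H' x1)))"
    by (rule add_left_mono)
  ultimately have "ereal (2 * (t1 - T)) + ereal a \<le> 0" by (rule order_trans[rotated])
  then have "2 * (t1 - T) + a \<le> 0" by simp
  moreover have "- (t1 - T) < a / 2" by (rule le_less_trans[OF abs_ge_minus_self ta])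
  ultimately show False by argo
qed

text \<open>Independence of time forces the time slope to be 0. For a nonzero gradient the
  calibration result applies; for the remaining clause it is enough that \<open>K\<close> is
  nonnegative.\<close>

lemma minimizing_hull_jet_sub:
  fixes u0 :: "real^'n \<Rightarrow> real"
  assumes contu: "continuous_on UNIV u0"
    and hull: "\<And>s. s \<in> {-1..1} \<Longrightarrow> minimizing_hull {x. u0 x \<le> s}"
    and u0x: "-1 < u0 x" "u0 x \<le> 1"
  shows "jet_sub (\<lambda>z. u0 (fst z)) (x, t)"
  unfolding jet_sub_def
proof (intro allI impI, elim conjE)
  fix P :: "(real^'n) \<times> real" and Q :: "(real^'n) \<times> real \<Rightarrow> (real^'n) \<times> real"
  assume linQ: "linear Q" and sym: "\<forall>y z. Q y \<bullet> z = y \<bullet> Q z"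
    and ev: "\<forall>\<^sub>F h in nhds 0. u0 (fst ((x, t) + h)) \<le> u0 (fst (x, t)) + P \<bullet> h + (Q h \<bullet> h) / 2"
  obtain r where r: "0 < r" "\<And>h. norm h < r \<Longrightarrow> u0 (fst ((x, t) + h)) \<le> u0 x + P \<bullet> h + (Q h \<bullet> h) / 2"
    using ev unfolding eventually_nhds_metric by (auto simp: dist_norm)
  have "- snd P = 0"
  proof (rule linear_le_quadratic_imp_zero[OF r(1)])
    fix \<tau> :: real assume "norm \<tau> < r"
    then have "0 \<le> P \<bullet> (0, \<tau>) + (Q (0, \<tau>) \<bullet> (0, \<tau>)) / 2" using r(2)[of "(0, \<tau>)"] by simp
    moreover have "Q (0, \<tau>) = \<tau> *\<^sub>R Q (0, 1)" using linear_scale[OF linQ, of \<tau> "(0, 1)"] by simp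
    ultimately have "0 \<le> snd P * \<tau> + \<tau> * snd (Q (0, 1)) * \<tau> / 2" by (simp add: inner_prod_def)
    also have "\<tau> * snd (Q (0, 1)) * \<tau> = snd (Q (0, 1)) * (norm \<tau>)\<^sup>2" by (simp add: power2_eq_square)
    finally show "- snd P \<bullet> \<tau> \<le> (snd (Q (0, 1)) / 2) * (norm \<tau>)\<^sup>2" by simp
  qed
  then have P0: "snd P = 0" by simp
  define L where "L h = fst (Q (h, 0))" for h
  have linL: "linear L"
  proof (rule linearI)
    show "L (h + k) = L h + L k" for h k using linear_add[OF linQ, of "(h, 0)" "(k, 0)"] by (simp add: L_def)
    show "L (c *\<^sub>R h) = c *\<^sub>R L h" for c h using linear_scale[OF linQ, of c "(h, 0)"] by (simp add: L_def)
  qed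
  have "bounded_linear L" using linL linear_conv_bounded_linear by blast
  then have ap: "blinfun_apply (Blinfun L) = L" by (rule bounded_linear_Blinfun_apply)
  have in0: "Q (h, 0) \<bullet> (k, 0) = L h \<bullet> k" for h k by (simp add: inner_prod_def L_def)
  show "(fst P \<noteq> 0 \<longrightarrow> snd P \<le> mean_curv (fst P) (\<lambda>h. fst (Q (h, 0)))) \<and>
     (\<forall>K. (\<forall>h. \<bar>fst (Q (h, 0)) \<bullet> h\<bar> \<le> K * (norm h)\<^sup>2) \<longrightarrow> snd P \<le> (real CARD('n) + 1) * K)"
  proof (intro conjI impI allI)
    assume "fst P \<noteq> 0"
    have "\<forall>\<^sub>F h in nhds 0. u0 (x + h) \<le> u0 x + fst P \<bullet> h + (blinfun_apply (Blinfun L) h \<bullet> h) / 2"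
      unfolding eventually_nhds_metric ap
    proof (intro exI[of _ r] conjI r(1) allI impI)
      fix h :: "real^'n" assume "dist h 0 < r"
      then show "u0 (x + h) \<le> u0 x + fst P \<bullet> h + (L h \<bullet> h) / 2"
        using r(2)[of "(h, 0)"] by (simp add: in0 inner_prod_def[of P])
    qed
    moreover have "L y \<bullet> z = y \<bullet> L z" for y z
      using sym in0[of y z] in0[of z y] by (metis inner_commute)
    ultimately have "0 \<le> (\<Sum>b\<in>Basis. L b \<bullet> b) - (L (fst P) \<bullet> fst P) / (norm (fst P))\<^sup>2"
      using minimizing_hull_touched_above[OF contu hull u0x \<open>fst P \<noteq> 0\<close>, of "Blinfun L"] unfolding ap by blast
    then show "snd P \<le> mean_curv (fst P) (\<lambda>h. fst (Q (h, 0)))"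
      unfolding P0 mean_curv_def L_def by (simp add: inner_commute)
  next
    fix K assume K: "\<forall>h. \<bar>fst (Q (h, 0)) \<bullet> h\<bar> \<le> K * (norm h)\<^sup>2"
    \<comment> \<open>Testing the form with a unit vector shows that \<open>K\<close> is
      nonnegative.\<close>
    obtain b :: "real^'n" where "norm b = 1" using vector_choose_size[of 1] by auto
    then have "0 \<le> K" using K[rule_format, of b] abs_ge_zero[of "fst (Q (b, 0)) \<bullet> b"] by simp
    then show "snd P \<le> (real CARD('n) + 1) * K" unfolding P0 by simp
  qed
qed

lemma usc_on_spacetime_shift:
  assumes "usc_on spacetime f" "0 \<le> snd v"
  shows "usc_on spacetime (\<lambda>z. f (z + v))"
  unfolding usc_on_def
proof (intro ballI allI impI)
  fix w a assume w: "w \<in> spacetime" "f (w + v) < a"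
  have mem: "z + v \<in> spacetime" if "z \<in> spacetime" for z
    using that assms(2) by (cases v) (auto simp: spacetime_def)
  have "\<forall>\<^sub>F y in at (w + v) within spacetime. f y < a"
    using assms(1) w mem unfolding usc_on_def by blast
  then obtain U where U: "open U" "w + v \<in> U" "\<And>y. y \<in> U \<Longrightarrow> y \<noteq> w + v \<Longrightarrow> y \<in> spacetime \<Longrightarrow> f y < a"
    unfolding eventually_at_topological by blast
  have "open ((\<lambda>z. z + v) -` U)" by (intro open_vimage U continuous_intros)
  then show "\<forall>\<^sub>F y in at w within spacetime. f (y + v) < a"
    unfolding eventually_at_topological using U mem by (intro exI[of _ "(\<lambda>z. z + v) -` U"]) auto
qed

lemma jet_sub_shift:
  assumes "jet_sub f (w + v)"
  shows "jet_sub (\<lambda>z. f (z + v)) w"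
proof -
  have "f (w + h + v) = f (w + v + h)" for h by (simp add: ac_simps)
  then show ?thesis using assms unfolding jet_sub_def by simp
qed

section \<open>Ordering, monotonicity and equicontinuity by comparison\<close>

locale minimizing_hull_flow =
  fixes u0 up :: "real^'n \<Rightarrow> real" and u :: "(real^'n) \<times> real \<Rightarrow> real"
  assumes uc_u0: "uniformly_continuous_on UNIV u0" and u0_range: "\<And>x. u0 x \<in> {-1..1}"
    and uc_up: "uniformly_continuous_on UNIV up" and up_range: "\<And>x. up x \<in> {-1..1}"
    and u0_le_up: "\<And>x. u0 x \<le> up x"
    and hull: "\<And>s. s \<in> {-1..1} \<Longrightarrow> minimizing_hull {x. u0 x \<le> s}"
    and sol: "evol_solution (\<lambda>_. -1) up u0 u"
begin

lemma sub: "evol_subsolution (\<lambda>_. -1) up u0 u" and sup: "evol_supersolution (\<lambda>_. -1) up u0 u"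
  using sol by (simp_all add: evol_solution_def)

lemma usc: "usc_on spacetime u"
  using sub by (simp add: evol_subsolution_def)

lemma usc_minus: "usc_on spacetime (\<lambda>z. - u z)"
  unfolding usc_on_def
proof (intro ballI allI impI)
  fix x a assume "x \<in> spacetime" "- u x < a"
  moreover from this have "- a < u x" by simp
  ultimately have "\<forall>\<^sub>F y in at x within spacetime. - a < u y"
    using sup unfolding evol_supersolution_def lsc_on_def by blast
  then show "\<forall>\<^sub>F y in at x within spacetime. - u y < a" by (rule eventually_mono) simp
qed

lemma range: "0 \<le> t \<Longrightarrow> -1 \<le> u (x, t)" "0 \<le> t \<Longrightarrow> u (x, t) \<le> up x"
  using sub by (simp_all add: evol_subsolution_def)

lemma bound: "z \<in> spacetime \<Longrightarrow> \<bar>u z\<bar> \<le> 1"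
  using range[of "snd z" "fst z"] up_range[of "fst z"] by (cases z) (auto simp: spacetime_def)

lemma initial: "u (x, 0) = u0 x"
  using sub sup by (intro antisym) (simp_all add: evol_subsolution_def evol_supersolution_def)

lemma visc: "0 < t \<Longrightarrow> -1 < u (x, t) \<Longrightarrow> visc_sub u (x, t)"
  by (rule evol_subsolution_visc_sub[OF sub])

lemma visc_minus: "0 < t \<Longrightarrow> u (x, t) < up x \<Longrightarrow> visc_sub (\<lambda>z. - u z) (x, t)"
  by (rule evol_supersolution_visc_sub[OF sup])

lemma jet: "0 < t \<Longrightarrow> -1 < u (x, t) \<Longrightarrow> jet_sub u (x, t)"
  by (intro visc_sub_imp_jet_sub visc bound) (simp_all add: spacetime_def)

lemma jet_minus: "0 < t \<Longrightarrow> u (x, t) < up x \<Longrightarrow> jet_sub (\<lambda>z. - u z) (x, t)"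
  by (intro visc_sub_imp_jet_sub visc_minus) (simp_all add: spacetime_def bound)

lemma close_u0: "0 < e \<Longrightarrow> \<exists>d>0. \<forall>x y. dist x y < d \<longrightarrow> \<bar>u0 x - u0 y\<bar> < e"
  using uc_u0 unfolding uniformly_continuous_on_def by (metis UNIV_I dist_commute dist_real_def)

lemma close_up: "0 < e \<Longrightarrow> \<exists>d>0. \<forall>x y. dist x y < d \<longrightarrow> \<bar>up x - up y\<bar> < e"
  using uc_up unfolding uniformly_continuous_on_def by (metis UNIV_I dist_commute dist_real_def)

text \<open>Comparison of the stationary subsolution with -u. Where u0 x exceeds u (y, t) by more
  than e at nearby points, u0 x is above -1, and u (y, t) is below up y because u0 \<le> up and up
  varies by less than e.\<close>

lemma u0_le:
  assumes "0 \<le> t"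
  shows "u0 x \<le> u (x, t)"
proof -
  have contu: "continuous_on UNIV u0" by (rule uniformly_continuous_imp_continuous[OF uc_u0])
  have cont: "continuous_on spacetime (\<lambda>z. u0 (fst z))"
    by (rule continuous_on_compose2[OF contu]) (auto intro!: continuous_intros)
  have "(\<lambda>z. u0 (fst z)) (x, t) + (\<lambda>z. - u z) (x, t) \<le> 0"
  proof (rule comparison_principle[OF _ usc_minus _ _ _ _ _ assms])
    show "usc_on spacetime (\<lambda>z. u0 (fst z))"
      using cont unfolding usc_on_def continuous_on_def by (auto intro: order_tendstoD(2))
    show "\<bar>u0 (fst z)\<bar> \<le> 1" for z :: "(real^'n) \<times> real" using u0_range[of "fst z"] by auto
    show "\<bar>- u z\<bar> \<le> 1" if "z \<in> spacetime" for z using bound[OF that] by simp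
    fix e :: real assume "0 < e"
    obtain d where d: "0 < d" "\<And>x y. dist x y < d \<Longrightarrow> \<bar>u0 x - u0 y\<bar> < e" using close_u0[OF \<open>0 < e\<close>] by blast
    have "u0 (fst (x, 0::real)) + - u (y, 0) \<le> 0 + e" if "dist x y < d" for x y
      using d(2)[OF that] by (simp add: initial)
    with d(1) show "\<exists>d>0. \<forall>x y. dist x y < d \<longrightarrow> u0 (fst (x, 0::real)) + - u (y, 0) \<le> 0 + e" by blast
  next
    fix e :: real assume "0 < e"
    obtain d where d: "0 < d" "\<And>x y. dist x y < d \<Longrightarrow> \<bar>up x - up y\<bar> < e" using close_up[OF \<open>0 < e\<close>] by blast
    have "jet_sub (\<lambda>z. u0 (fst z)) (x, s) \<and> jet_sub (\<lambda>z. - u z) (y, t)"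
      if "dist x y < d" "0 < s" "0 < t" and gap: "0 + e < u0 (fst (x, s)) + - u (y, t)" for x y s t
    proof
      have "-1 < u0 x" using gap range(1)[of t y] \<open>0 < t\<close> \<open>0 < e\<close> by simp
      then show "jet_sub (\<lambda>z. u0 (fst z)) (x, s)"
        using u0_range[of x] by (intro minimizing_hull_jet_sub contu hull) auto
      show "jet_sub (\<lambda>z. - u z) (y, t)"
        using gap u0_le_up[of x] d(2)[OF that(1)] by (intro jet_minus \<open>0 < t\<close>) simp
    qed
    with d(1) show "\<exists>d>0. \<forall>x y s t. dist x y < d \<longrightarrow> 0 < s \<longrightarrow> 0 < t \<longrightarrow>
        0 + e < u0 (fst (x, s)) + - u (y, t) \<longrightarrow> jet_sub (\<lambda>z. u0 (fst z)) (x, s) \<and> jet_sub (\<lambda>z. - u z) (y, t)"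
      by blast
  qed simp_all
  then show ?thesis by simp
qed

text \<open>\<open>u\<close> is compared with its translate by \<open>h\<close> in time; the
  translate starts above \<open>u0\<close> by \<open>u0_le\<close>.\<close>

lemma nondecreasing:
  assumes "0 \<le> t" "0 \<le> h"
  shows "u (x, t) \<le> u (x, t + h)"
proof -
  have "u (x, t) + (\<lambda>z. - u (z + (0, h))) (x, t) \<le> 0"
  proof (rule comparison_principle[OF usc _ bound _ _ _ _ assms(1)])
    show "usc_on spacetime (\<lambda>z. - u (z + (0, h)))"
      by (rule usc_on_spacetime_shift[OF usc_minus]) (simp add: assms)
    show "\<bar>- u (z + (0, h))\<bar> \<le> 1" if "z \<in> spacetime" for z
    proof -
      have "z + (0, h) \<in> spacetime" using that assms(2) by (cases z) (simp add: spacetime_def)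
      then show ?thesis using bound by simp
    qed
    fix e :: real assume "0 < e"
    obtain d where d: "0 < d" "\<And>x y. dist x y < d \<Longrightarrow> \<bar>u0 x - u0 y\<bar> < e" using close_u0[OF \<open>0 < e\<close>] by blast
    have "u (x, 0) + - u ((y, 0) + (0, h)) \<le> 0 + e" if "dist x y < d" for x y
      using d(2)[OF that] u0_le[OF assms(2), of y] by (simp add: initial)
    with d(1) show "\<exists>d>0. \<forall>x y. dist x y < d \<longrightarrow> u (x, 0) + - u ((y, 0) + (0, h)) \<le> 0 + e" by blast
  next
    fix e :: real assume "0 < e"
    obtain d where d: "0 < d" "\<And>x y. dist x y < d \<Longrightarrow> \<bar>up x - up y\<bar> < e" using close_up[OF \<open>0 < e\<close>] by blast
    have "jet_sub u (x, s) \<and> jet_sub (\<lambda>z. - u (z + (0, h))) (y, t)"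
      if "dist x y < d" "0 < s" "0 < t" and gap: "0 + e < u (x, s) + - u ((y, t) + (0, h))" for x y s t
    proof
      show "jet_sub u (x, s)"
        using gap range(1)[of "t + h" y] \<open>0 < t\<close> \<open>0 < e\<close> \<open>0 \<le> h\<close> by (intro jet \<open>0 < s\<close>) simp
      have "jet_sub (\<lambda>z. - u z) (y, t + h)"
        using gap range(2)[of s x] d(2)[OF that(1)] \<open>0 < s\<close> \<open>0 < t\<close> \<open>0 \<le> h\<close> by (intro jet_minus) simp_all
      then show "jet_sub (\<lambda>z. - u (z + (0, h))) (y, t)" by (intro jet_sub_shift) simp
    qed
    with d(1) show "\<exists>d>0. \<forall>x y s t. dist x y < d \<longrightarrow> 0 < s \<longrightarrow> 0 < t \<longrightarrow>
        0 + e < u (x, s) + - u ((y, t) + (0, h)) \<longrightarrow> jet_sub u (x, s) \<and> jet_sub (\<lambda>z. - u (z + (0, h))) (y, t)"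
      by blast
  qed simp_all
  then show ?thesis by simp
qed

lemma mono: "0 \<le> s \<Longrightarrow> s \<le> t \<Longrightarrow> u (x, s) \<le> u (x, t)"
  using nondecreasing[of s "t - s" x] by simp

text \<open>A spatial translate of \<open>u\<close> is compared with \<open>u\<close> itself with
  the constant \<open>e\<close>: the shift changes the initial datum and the obstacle by less than
  \<open>e\<close>. The resulting modulus does not depend on time.\<close>

lemma equicontinuous:
  assumes "0 < e"
  obtains d where "0 < d" "\<And>x y t. dist x y < d \<Longrightarrow> 0 \<le> t \<Longrightarrow> u (y, t) \<le> u (x, t) + e"
proof -
  obtain d1 where d1: "0 < d1" "\<And>x y. dist x y < d1 \<Longrightarrow> \<bar>u0 x - u0 y\<bar> < e" using close_u0[OF \<open>0 < e\<close>] by blast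
  obtain d2 where d2: "0 < d2" "\<And>x y. dist x y < d2 \<Longrightarrow> \<bar>up x - up y\<bar> < e" using close_up[OF \<open>0 < e\<close>] by blast
  define d where "d = min d1 d2"
  have "0 < d" using d1 d2 by (simp add: d_def)
  moreover have "u (y0, t0) \<le> u (x0, t0) + e" if near: "dist x0 y0 < d" and "0 \<le> t0" for x0 y0 t0
  proof -
    define \<xi> where "\<xi> = y0 - x0"
    have \<xi>: "dist x (x + \<xi>) < d" for x using near by (simp add: \<xi>_def dist_norm norm_minus_commute)
    have "(\<lambda>z. u (z + (\<xi>, 0))) (x0, t0) + (\<lambda>z. - u z) (x0, t0) \<le> e"
    proof (rule comparison_principle[OF _ usc_minus _ _ _ _ _ \<open>0 \<le> t0\<close>])
      show "usc_on spacetime (\<lambda>z. u (z + (\<xi>, 0)))"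
        by (rule usc_on_spacetime_shift[OF usc]) simp
      show "\<bar>u (z + (\<xi>, 0))\<bar> \<le> 1" if "z \<in> spacetime" for z
        using that by (intro bound) (cases z, simp add: spacetime_def)
      show "\<bar>- u z\<bar> \<le> 1" if "z \<in> spacetime" for z using bound[OF that] by simp
      show "0 \<le> e" using \<open>0 < e\<close> by simp
      fix e' :: real assume "0 < e'"
      obtain d' where d': "0 < d'" "\<And>x y. dist x y < d' \<Longrightarrow> \<bar>u0 x - u0 y\<bar> < e'" using close_u0[OF \<open>0 < e'\<close>] by blast
      have "u ((x, 0) + (\<xi>, 0)) + - u (y, 0) \<le> e + e'" if "dist x y < d'" for x y
        using d'(2)[OF that] d1(2)[of x "x + \<xi>"] \<xi>[of x] by (simp add: initial d_def)
      with d'(1) show "\<exists>d>0. \<forall>x y. dist x y < d \<longrightarrow> u ((x, 0) + (\<xi>, 0)) + - u (y, 0) \<le> e + e'" by blast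
    next
      fix e' :: real assume "0 < e'"
      obtain d' where d': "0 < d'" "\<And>x y. dist x y < d' \<Longrightarrow> \<bar>up x - up y\<bar> < e'" using close_up[OF \<open>0 < e'\<close>] by blast
      have "jet_sub (\<lambda>z. u (z + (\<xi>, 0))) (x, s) \<and> jet_sub (\<lambda>z. - u z) (y, t)"
        if "dist x y < d'" "0 < s" "0 < t" and gap: "e + e' < u ((x, s) + (\<xi>, 0)) + - u (y, t)" for x y s t
      proof
        have "jet_sub u (x + \<xi>, s)"
          using gap range(1)[of t y] \<open>0 < t\<close> \<open>0 < e\<close> \<open>0 < e'\<close> by (intro jet \<open>0 < s\<close>) simp
        then show "jet_sub (\<lambda>z. u (z + (\<xi>, 0))) (x, s)" by (intro jet_sub_shift) simp
        show "jet_sub (\<lambda>z. - u z) (y, t)"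
          using gap range(2)[of s "x + \<xi>"] d'(2)[OF that(1)] d2(2)[of x "x + \<xi>"] \<xi>[of x] \<open>0 < s\<close>
          by (intro jet_minus \<open>0 < t\<close>) (simp add: d_def)
      qed
      with d'(1) show "\<exists>d>0. \<forall>x y s t. dist x y < d \<longrightarrow> 0 < s \<longrightarrow> 0 < t \<longrightarrow>
          e + e' < u ((x, s) + (\<xi>, 0)) + - u (y, t) \<longrightarrow> jet_sub (\<lambda>z. u (z + (\<xi>, 0))) (x, s) \<and> jet_sub (\<lambda>z. - u z) (y, t)"
        by blast
    qed
    then show ?thesis by (simp add: \<xi>_def)
  qed
  ultimately show thesis by (rule that)
qed

section \<open>The limit in time and its equation\<close>

definition uinf :: "real^'n \<Rightarrow> real" where
  "uinf x = (SUP t\<in>{0..}. u (x, t))"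

lemma uinf_upper: "0 \<le> t \<Longrightarrow> u (x, t) \<le> uinf x"
  unfolding uinf_def using range(2)[of _ x] by (intro cSUP_upper) (auto intro!: bdd_aboveI)

lemma uinf_least: "(\<And>t. 0 \<le> t \<Longrightarrow> u (x, t) \<le> b) \<Longrightarrow> uinf x \<le> b"
  unfolding uinf_def by (intro cSUP_least) auto

lemma uinf_range: "-1 \<le> uinf x" "uinf x \<le> up x"
  using uinf_least[of x "up x"] range(2)[of _ x] range(1)[of 0 x] uinf_upper[of 0 x] by simp_all

lemma uinf_approx:
  assumes "0 < e"
  obtains T where "0 \<le> T" "\<And>t. T \<le> t \<Longrightarrow> uinf x < u (x, t) + e"
proof -
  have "\<exists>T\<ge>0. uinf x - e < u (x, T)"
  proof (rule ccontr)
    assume "\<not> ?thesis"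
    then have "uinf x \<le> uinf x - e" by (intro uinf_least) (auto simp: not_less)
    then show False using assms by simp
  qed
  then obtain T where T: "0 \<le> T" "uinf x - e < u (x, T)" by blast
  show thesis
  proof (rule that[OF T(1)])
    fix t assume "T \<le> t"
    then show "uinf x < u (x, t) + e" using mono[OF T(1), of t x] T(2) by simp
  qed
qed

lemma uinf_equicontinuous:
  assumes "\<And>x y t. dist x y < d \<Longrightarrow> 0 \<le> t \<Longrightarrow> u (y, t) \<le> u (x, t) + e" "dist x y < d"
  shows "uinf y \<le> uinf x + e"
proof (rule uinf_least)
  fix t :: real assume "0 \<le> t"
  then show "u (y, t) \<le> uinf x + e" using assms(1)[OF assms(2), of t] uinf_upper[of t x] by linarith
qed

lemma continuous_on_uinf: "continuous_on UNIV uinf"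
  unfolding continuous_on_iff
proof (intro ballI allI impI)
  fix x :: "real^'n" and e :: real assume "0 < e"
  then have "0 < e / 2" by simp
  obtain d where d: "0 < d" "\<And>x y t. dist x y < d \<Longrightarrow> 0 \<le> t \<Longrightarrow> u (y, t) \<le> u (x, t) + e / 2"
    using equicontinuous[OF \<open>0 < e / 2\<close>] by metis
  have "dist (uinf y) (uinf x) < e" if "dist y x < d" for y
  proof -
    have "uinf y \<le> uinf x + e / 2" "uinf x \<le> uinf y + e / 2"
      using that by (auto intro!: uinf_equicontinuous[OF d(2)] simp: dist_commute)
    then show ?thesis using \<open>0 < e\<close> by (simp add: dist_real_def abs_less_iff)
  qed
  with d(1) show "\<exists>d>0. \<forall>y\<in>UNIV. dist y x < d \<longrightarrow> dist (uinf y) (uinf x) < e" by blast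
qed

text \<open>An argument of Dini type: monotone convergence at the finitely many centres of a
  covering is spread to the compact set by equicontinuity, which costs e / 3 for \<open>u\<close>
  and e / 3 for \<open>uinf\<close>.\<close>

lemma uniform_limit_uinf:
  assumes "compact K"
  shows "uniform_limit K (\<lambda>t x. u (x, t)) uinf at_top"
  unfolding uniform_limit_iff
proof (intro allI impI)
  fix e :: real assume "0 < e"
  then have e3: "0 < e / 3" by simp
  obtain d where d: "0 < d" "\<And>x y t. dist x y < d \<Longrightarrow> 0 \<le> t \<Longrightarrow> u (y, t) \<le> u (x, t) + e / 3"
    using equicontinuous[OF e3] by metis
  obtain C where C: "finite C" "K \<subseteq> (\<Union>k\<in>C. ball k d)"
    using compactE_image[OF assms, of K "\<lambda>k. ball k d"] d(1) by (metis UN_I centre_in_ball open_ball subsetI)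
  have "\<forall>\<^sub>F t in at_top. uinf k < u (k, t) + e / 3" for k
    using uinf_approx[OF e3, of k] unfolding eventually_at_top_linorder by metis
  then have "\<forall>\<^sub>F t in at_top. \<forall>k\<in>C. uinf k < u (k, t) + e / 3"
    using C(1) by (simp add: eventually_ball_finite)
  moreover have "\<forall>\<^sub>F t in at_top. (0::real) \<le> t" by (rule eventually_ge_at_top)
  ultimately show "\<forall>\<^sub>F t in at_top. \<forall>x\<in>K. dist (u (x, t)) (uinf x) < e"
  proof eventually_elim
    case (elim t)
    show ?case
    proof
      fix x assume "x \<in> K"
      then obtain k where k: "k \<in> C" "dist k x < d" using C(2) by auto
      have "uinf x \<le> uinf k + e / 3" by (rule uinf_equicontinuous[OF d(2) k(2)])
      moreover have "u (k, t) \<le> u (x, t) + e / 3" using k(2) elim by (intro d(2)) (simp_all add: dist_commute)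
      moreover have "uinf k < u (k, t) + e / 3" using elim k(1) by blast
      moreover have "u (x, t) \<le> uinf x" using elim by (simp add: uinf_upper)
      ultimately show "dist (u (x, t)) (uinf x) < e" by (simp add: dist_real_def)
    qed
  qed
qed

lemma uinf_bound: "\<bar>uinf x\<bar> \<le> 1"
  using uinf_range[of x] up_range[of x] by auto

lemma stat_subsolution_uinf: "stat_subsolution (\<lambda>_. -1) up uinf"
  unfolding stat_subsolution_def
proof (intro conjI allI impI)
  show "usc_on UNIV uinf"
    using continuous_on_uinf unfolding usc_on_def continuous_on_def by (auto intro: order_tendstoD(2))
  fix \<phi> G H x
  assume *: "C2_fun \<phi> G H \<and> (\<forall>y. uinf y - \<phi> y \<le> uinf x - \<phi> x) \<and> uinf x > -1"
  \<comment> \<open>Half of the height of \<open>uinf x\<close> above the lower obstacle: one half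
    is spent on convergence in time, the other on moving from x to y, so u (y, t) stays above
    -1.\<close>
  define e where "e = (uinf x + 1) / 2"
  have "0 < e" using * by (simp add: e_def)
  obtain T where T: "0 \<le> T" "\<And>t. T \<le> t \<Longrightarrow> uinf x < u (x, t) + e" using uinf_approx[OF \<open>0 < e\<close>] by metis
  obtain d where d: "0 < d" "\<And>x y t. dist x y < d \<Longrightarrow> 0 \<le> t \<Longrightarrow> u (y, t) \<le> u (x, t) + e"
    using equicontinuous[OF \<open>0 < e\<close>] by metis
  show "F_lower (G x) (matrix (blinfun_apply (H x))) \<le> 0"
  proof (rule visc_sub_limit[OF usc bound uinf_bound uniform_limit_uinf d(1)])
    show "visc_sub u (y, t)" if "dist y x < d" "T + 1 \<le> t" for y t
    proof (rule visc)
      show "-1 < u (y, t)"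
        using T(2)[of t] d(2)[OF that(1), of t] that(2) T(1) by (simp add: e_def field_simps)
    qed (use that T(1) in simp)
  qed (use * in auto)
next
  show "-1 \<le> uinf x" "uinf x \<le> up x" for x by (rule uinf_range)+
qed

text \<open>By continuity \<open>uinf\<close> is below \<open>up\<close> near x, and
  \<open>u\<close> never exceeds \<open>uinf\<close>, so the upper obstacle is inactive there at all
  times. Sign reversal then reduces the claim to \<open>visc_sub_limit\<close>.\<close>

lemma stat_supersolution_uinf: "stat_supersolution (\<lambda>_. -1) up uinf"
  unfolding stat_supersolution_def
proof (intro conjI allI impI)
  show "lsc_on UNIV uinf"
    using continuous_on_uinf unfolding lsc_on_def continuous_on_def by (auto intro: order_tendstoD(1))
  fix \<phi> G H x
  assume *: "C2_fun \<phi> G H \<and> (\<forall>y. uinf y - \<phi> y \<ge> uinf x - \<phi> x) \<and> uinf x < up x"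
  have "open {y. uinf y < up y}"
    using continuous_on_uinf uniformly_continuous_imp_continuous[OF uc_up] by (intro open_Collect_less)
  then obtain d where d: "0 < d" "ball x d \<subseteq> {y. uinf y < up y}"
    using * unfolding open_contains_ball by blast
  have "F_lower (- G x) (matrix (blinfun_apply (- H x))) \<le> 0"
  proof (rule visc_sub_limit[OF usc_minus _ _ _ d(1) _ C2_fun_uminus])
    show "C2_fun \<phi> G H" using * by blast
    show "\<bar>- u z\<bar> \<le> 1" if "z \<in> spacetime" for z using bound[OF that] by simp
    show "\<bar>- uinf y\<bar> \<le> 1" for y using uinf_bound by simp
    show "uniform_limit (cball x 2) (\<lambda>t x. - u (x, t)) (\<lambda>x. - uinf x) at_top"
      by (intro uniform_limit_intros uniform_limit_uinf compact_cball)
    show "- uinf y - - \<phi> y \<le> - uinf x - - \<phi> x" for y using *[THEN conjunct2, THEN conjunct1, rule_format, of y] by linarith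
    show "visc_sub (\<lambda>z. - u z) (y, t)" if "dist y x < d" "1 \<le> t" for y t
    proof (rule visc_minus)
      have "uinf y < up y" using d(2) that(1) by (auto simp: dist_commute)
      then show "u (y, t) < up y" using uinf_upper[of t y] that(2) by simp
    qed (use that in simp)
  qed
  then have "0 \<le> - F_lower (- G x) (- matrix (blinfun_apply (H x)))"
    by (simp add: uminus_blinfun.rep_eq matrix_uminus ereal_0_le_uminus_iff)
  then show "F_upper (G x) (matrix (blinfun_apply (H x))) \<ge> 0"
    using F_upper_uminus[of "- G x" "- matrix (blinfun_apply (H x))"] by simp
next
  show "-1 \<le> uinf x" "uinf x \<le> up x" for x by (rule uinf_range)+
qed

end

theorem mainTheorem5:
  fixes u0 up :: "real^'n \<Rightarrow> real" and u :: "(real^'n) \<times> real \<Rightarrow> real"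
  assumes "uniformly_continuous_on UNIV u0" and "\<And>x. u0 x \<in> {-1..1}"
    and "uniformly_continuous_on UNIV up" and "\<And>x. up x \<in> {-1..1}"
    and "\<And>x. u0 x \<le> up x"
    and "\<And>s. s \<in> {-1..1} \<Longrightarrow> minimizing_hull {x. u0 x \<le> s}"
    and "evol_solution (\<lambda>_. -1) up u0 u"
  shows "(\<forall>x s t. 0 \<le> s \<and> s \<le> t \<longrightarrow> u (x, s) \<le> u (x, t)) \<and>
    (\<exists>uinf :: real^'n \<Rightarrow> real.
       (\<forall>K. compact K \<longrightarrow> uniform_limit K (\<lambda>t x. u (x, t)) uinf at_top) \<and>
       stat_solution (\<lambda>_. -1) up uinf)"
proof -
  interpret minimizing_hull_flow u0 up u by unfold_locales (fact assms)+
  have "stat_solution (\<lambda>_. -1) up uinf"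
    using stat_subsolution_uinf stat_supersolution_uinf by (simp add: stat_solution_def)
  then show ?thesis using mono uniform_limit_uinf by blast
qed

end
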